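(* Let $\ell\ge 2$ and let $\mathbf G(\mathfrak o_\ell)$ be either ${\rm GL}_n(\mathfrak o_\ell)$ (any $p$) or ${\rm SL}_n(\mathfrak o_\ell)$ with $p$ odd and $p\nmid n$. Then: (1) an irreducible representation of $\mathbf G(\mathfrak o_\ell)$ admits a $\theta$-Whittaker model for some non-degenerate character $\theta$ of $\mathbf U(\mathfrak o_\ell)$ if and only if it is regular; (2) for every non-degenerate character $\theta$ of $\mathbf U(\mathfrak o_\ell)$, every irreducible representation of $\mathbf G(\mathfrak o_\ell)$ admits at most one $\theta$-Whittaker model.
   Context: Let $\mathbf F$ be a non-archimedean local field with ring of integers $\mathfrak o$, maximal ideal $\mathfrak p=\varpi\mathfrak o$, residue field $\mathbf k\cong\mathbb F_q$ of characteristic $p$; $\mathfrak o_r=\mathfrak o/\mathfrak p^r$. $\mathbf U(\mathfrak o_\ell)$ is the group of upper triangular unipotent matrices in $\mathbf G(\mathfrak o_\ell)$. A character $\varphi$ of $(\mathfrak o_\ell,+)$ is primitive if it is nontrivial on $\varpi^{\ell-1}\mathfrak o_\ell$; a non-degenerate character of $\mathbf U(\mathfrak o_\ell)$ is $\theta((u_{ij}))=\prod_{i=1}^{n-1}\varphi_i(u_{i,i+1})$ with all $\varphi_i$ primitive. An irreducible representation $\pi$ of $\mathbf G(\mathfrak o_\ell)$ admits a $\theta$-Whittaker model if $\mathrm{Hom}_{\mathbf G(\mathfrak o_\ell)}(\pi,\mathrm{Ind}_{\mathbf U(\mathfrak o_\ell)}^{\mathbf G(\mathfrak o_\ell)}\theta)\neq0$,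 and admits at most one if this space has dimension $\le1$. Regular representations: let $\mathfrak g=M_n$ if $\mathbf G={\rm GL}_n$ and $\mathfrak g=\mathfrak{sl}_n$ (trace-zero matrices) if $\mathbf G={\rm SL}_n$. For $1\le i<\ell$ let $K_\ell^i=\ker(\mathbf G(\mathfrak o_\ell)\to\mathbf G(\mathfrak o_i))$. Fix a primitive character $\varphi$ of $\mathfrak o_\ell$. For $i\ge\ell/2$ the group $K_\ell^i=\{I+\varpi^i y\}$ is abelian, and each $x\in\mathfrak g(\mathfrak o_{\ell-i})$ gives a character $\varphi_x$ of $K_\ell^i$, $\varphi_x(I+\varpi^i y)=\varphi(\varpi^i\,\mathrm{tr}(\hat x y))$, with $\hat x$ any lift of $x$ to $\mathfrak g(\mathfrak o_\ell)$. An element $x\in\mathfrak g(\mathfrak o_r)$ is regular if there is $v\in\mathfrak o_r^{\oplus n}$ such that $v,xv,\dots,x^{n-1}v$ is a basis of $\mathfrak o_r^{\oplus n}$ (for $r=1$: the characteristic polynomial equals the minimal polynomial). An irreducible representation $\rho$ of $\mathbf G(\mathfrak o_\ell)$ is regular if its restriction to $K_\ell^{\ell-1}$ contains $\varphi_x$ for some regular $x\in\mathfrak g(\mathbb F_q)$. *)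

theory Defs
  imports Complex_Main "Jordan_Normal_Form.Determinant"
begin

text \<open>We model o_l abstractly as a finite commutative ring R with an element unif
 (the image of the uniformizer) such that unif^l = 0, unif^(l-1) \<noteq> 0, every element
 outside unif R is a unit (so unif R is the unique maximal ideal), and the residue
 field R / unif R has characteristic the prime p.\<close>

definition in_uR :: "'r::comm_ring_1 \<Rightarrow> 'r \<Rightarrow> bool" where
  "in_uR unif a \<longleftrightarrow> (\<exists>t. a = unif * t)"

definition trunc_dvr :: "'r::{comm_ring_1,finite} \<Rightarrow> nat \<Rightarrow> nat \<Rightarrow> bool" where
  "trunc_dvr unif l p \<longleftrightarrow>
     unif ^ l = 0 \<and> unif ^ (l - 1) \<noteq> 0 \<and>
     (\<forall>a. \<not> in_uR unif a \<longrightarrow> a dvd 1) \<and>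
     prime p \<and> in_uR unif (of_nat p)"

definition add_char :: "('r::comm_ring_1 \<Rightarrow> complex) \<Rightarrow> bool" where
  "add_char phi \<longleftrightarrow> phi 0 = 1 \<and> (\<forall>a b. phi (a + b) = phi a * phi b)"

definition primitive_char :: "'r::comm_ring_1 \<Rightarrow> nat \<Rightarrow> ('r \<Rightarrow> complex) \<Rightarrow> bool" where
  "primitive_char unif l phi \<longleftrightarrow> add_char phi \<and> (\<exists>a. phi (unif ^ (l - 1) * a) \<noteq> 1)"

definition Gset :: "bool \<Rightarrow> nat \<Rightarrow> 'r::comm_ring_1 mat set" where
  "Gset sl n = (if sl then {A \<in> carrier_mat n n. det A = 1}
                else {A \<in> carrier_mat n n. det A dvd 1})"

definition mtrace :: "'r::comm_ring_1 mat \<Rightarrow> 'r" where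
  "mtrace A = (\<Sum>i<dim_row A. A $$ (i, i))"

definition galg :: "bool \<Rightarrow> nat \<Rightarrow> 'r::comm_ring_1 mat set" where
  "galg sl n = (if sl then {A \<in> carrier_mat n n. mtrace A = 0} else carrier_mat n n)"

definition Uset :: "nat \<Rightarrow> 'r::comm_ring_1 mat set" where
  "Uset n = {A \<in> carrier_mat n n. \<forall>i<n. \<forall>j<n.
              (j < i \<longrightarrow> A $$ (i, j) = 0) \<and> (i = j \<longrightarrow> A $$ (i, j) = 1)}"

definition nondeg_char :: "'r::comm_ring_1 \<Rightarrow> nat \<Rightarrow> nat \<Rightarrow> ('r mat \<Rightarrow> complex) \<Rightarrow> bool" where
  "nondeg_char unif l n theta \<longleftrightarrow>
     (\<exists>phis :: nat \<Rightarrow> 'r \<Rightarrow> complex.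
        (\<forall>i < n - 1. primitive_char unif l (phis i)) \<and>
        (\<forall>u \<in> Uset n. theta u = (\<Prod>i < n - 1. phis i (u $$ (i, i + 1)))))"

definition is_rep :: "nat \<Rightarrow> 'r::comm_ring_1 mat set \<Rightarrow> nat \<Rightarrow> ('r mat \<Rightarrow> complex mat) \<Rightarrow> bool" where
  "is_rep n G d rho \<longleftrightarrow>
     (\<forall>g \<in> G. rho g \<in> carrier_mat d d) \<and>
     (\<forall>g \<in> G. \<forall>h \<in> G. rho (g * h) = rho g * rho h) \<and>
     rho (1\<^sub>m n) = 1\<^sub>m d"

definition irreducible_rep :: "nat \<Rightarrow> 'r::comm_ring_1 mat set \<Rightarrow> nat \<Rightarrow> ('r mat \<Rightarrow> complex mat) \<Rightarrow> bool" where
  "irreducible_rep n G d rho \<longleftrightarrow> is_rep n G d rho \<and> 0 < d \<and>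
     (\<forall>W \<subseteq> carrier_vec d.
        (0\<^sub>v d \<in> W \<and> (\<forall>v \<in> W. \<forall>w \<in> W. v + w \<in> W) \<and> (\<forall>c. \<forall>v \<in> W. c \<cdot>\<^sub>v v \<in> W) \<and>
         (\<forall>g \<in> G. \<forall>v \<in> W. rho g *\<^sub>v v \<in> W))
        \<longrightarrow> W = {0\<^sub>v d} \<or> W = carrier_vec d)"

text \<open>Ind_U^G theta is realised as the space of functions f on matrices, supported on G,
 with f(u h) = theta(u) f(h) (u in U, h in G), with G acting by right translation.
 An element of Hom_G(rho, Ind theta) is a linear map T from complex^d to this space
 intertwining rho with right translation.\<close>

definition whittaker_hom :: "nat \<Rightarrow> 'r::comm_ring_1 mat set \<Rightarrow> ('r mat \<Rightarrow> complex) \<Rightarrow> nat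
     \<Rightarrow> ('r mat \<Rightarrow> complex mat) \<Rightarrow> (complex vec \<Rightarrow> 'r mat \<Rightarrow> complex) \<Rightarrow> bool" where
  "whittaker_hom n G theta d rho T \<longleftrightarrow>
     (\<forall>v \<in> carrier_vec d. \<forall>w \<in> carrier_vec d. T (v + w) = (\<lambda>h. T v h + T w h)) \<and>
     (\<forall>c. \<forall>v \<in> carrier_vec d. T (c \<cdot>\<^sub>v v) = (\<lambda>h. c * T v h)) \<and>
     (\<forall>v \<in> carrier_vec d. (\<forall>h. h \<notin> G \<longrightarrow> T v h = 0) \<and>
                           (\<forall>u \<in> Uset n. \<forall>h \<in> G. T v (u * h) = theta u * T v h)) \<and>
     (\<forall>g \<in> G. \<forall>v \<in> carrier_vec d.
        T (rho g *\<^sub>v v) = (\<lambda>h. if h \<in> G then T v (h * g) else 0))"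

definition admits_whittaker :: "nat \<Rightarrow> 'r::comm_ring_1 mat set \<Rightarrow> ('r mat \<Rightarrow> complex) \<Rightarrow> nat
     \<Rightarrow> ('r mat \<Rightarrow> complex mat) \<Rightarrow> bool" where
  "admits_whittaker n G theta d rho \<longleftrightarrow>
     (\<exists>T. whittaker_hom n G theta d rho T \<and> (\<exists>v \<in> carrier_vec d. T v \<noteq> (\<lambda>h. 0)))"

definition at_most_one_whittaker :: "nat \<Rightarrow> 'r::comm_ring_1 mat set \<Rightarrow> ('r mat \<Rightarrow> complex) \<Rightarrow> nat
     \<Rightarrow> ('r mat \<Rightarrow> complex mat) \<Rightarrow> bool" where
  "at_most_one_whittaker n G theta d rho \<longleftrightarrow>
     (\<forall>T1 T2. whittaker_hom n G theta d rho T1 \<and> whittaker_hom n G theta d rho T2 \<longrightarrow>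
        (\<exists>a b :: complex. (a, b) \<noteq> (0, 0) \<and>
           (\<forall>v \<in> carrier_vec d. \<forall>h. a * T1 v h + b * T2 v h = 0)))"

text \<open>x (a lift to o_l of an element of g(F_q)) is regular mod unif: there is v such that the
 reductions of v, x v, ..., x^(n-1) v form a basis of F_q^n = (R / unif R)^n, written out with
 representatives.\<close>
definition lcomb :: "nat \<Rightarrow> 'r::comm_ring_1 mat \<Rightarrow> 'r vec \<Rightarrow> (nat \<Rightarrow> 'r) \<Rightarrow> nat \<Rightarrow> 'r" where
  "lcomb n x v c j = (\<Sum>i<n. c i * ((x ^\<^sub>m i) *\<^sub>v v) $ j)"

definition residue_regular :: "'r::comm_ring_1 \<Rightarrow> nat \<Rightarrow> 'r mat \<Rightarrow> bool" where
  "residue_regular unif n x \<longleftrightarrow>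
     (\<exists>v \<in> carrier_vec n.
        (\<forall>w \<in> carrier_vec n. \<exists>c. \<forall>j<n. in_uR unif (w $ j - lcomb n x v c j)) \<and>
        (\<forall>c. (\<forall>j<n. in_uR unif (lcomb n x v c j)) \<longrightarrow> (\<forall>i<n. in_uR unif (c i))))"

text \<open>The restriction of rho to K^(l-1) = {I + unif^(l-1) y} \<inter> G contains the character
 phi_x(I + unif^(l-1) y) = phi(unif^(l-1) tr(x y)).\<close>
definition contains_phi_x :: "'r::comm_ring_1 \<Rightarrow> nat \<Rightarrow> nat \<Rightarrow> 'r mat set \<Rightarrow> ('r \<Rightarrow> complex)
     \<Rightarrow> 'r mat \<Rightarrow> nat \<Rightarrow> ('r mat \<Rightarrow> complex mat) \<Rightarrow> bool" where
  "contains_phi_x unif l n G phi x d rho \<longleftrightarrow>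
     (\<exists>v \<in> carrier_vec d. v \<noteq> 0\<^sub>v d \<and>
        (\<forall>y \<in> carrier_mat n n. 1\<^sub>m n + unif ^ (l - 1) \<cdot>\<^sub>m y \<in> G \<longrightarrow>
           rho (1\<^sub>m n + unif ^ (l - 1) \<cdot>\<^sub>m y) *\<^sub>v v = phi (unif ^ (l - 1) * mtrace (x * y)) \<cdot>\<^sub>v v))"

definition regular_rep :: "'r::comm_ring_1 \<Rightarrow> nat \<Rightarrow> bool \<Rightarrow> nat \<Rightarrow> ('r \<Rightarrow> complex)
     \<Rightarrow> nat \<Rightarrow> ('r mat \<Rightarrow> complex mat) \<Rightarrow> bool" where
  "regular_rep unif l sl n phi d rho \<longleftrightarrow>
     (\<exists>x \<in> galg sl n. residue_regular unif n x \<and> contains_phi_x unif l n (Gset sl n) phi x d rho)"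

end

theory Submission
  imports Defs "HOL-Computational_Algebra.Fundamental_Theorem_Algebra"
begin

text \<open>Multiplicity one is Gelfand's trick. Let f be a subdiagonal matrix with unit entries that
 represents theta, and b the upper triangular matrices. The anti-involution \<open>tau a = Q^-1 a^T Q\<close>
 preserves U, theta and f, so it suffices that every function F on \<open>GL_n\<close> that transforms by theta
 under U on both sides satisfies \<open>F (tau g) = F g\<close>: then the operators \<open>P g P\<close>, P the projection
 onto theta, commute, and on an irreducible representation P has rank at most one. Decompose F by the
 characters of \<open>K^m\<close> with \<open>m = l - l div 2\<close>. A component can only be nonzero when it is carried
 by some x in \<open>f + b\<close>, and elements that intertwine two members of \<open>f + b\<close> modulo the conductor are
 products of an element of \<open>K^r\<close> with \<open>r = l div 2\<close>, a polynomial in x, and an element of U. On the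
 polynomials a conjugate of tau acts trivially; for the factor in \<open>K^r\<close>, average the component over
 \<open>K^r\<close> twisted with the anti-involution. Two evaluations give positive multiples of the component
 and of its image, so these agree up to a positive constant, which is 1 as tau is an involution.

 For part (1), a Whittaker vector decomposed by the characters of \<open>K^(l-1)\<close> yields a character in
 \<open>f + b\<close>, and such elements are regular. Conversely a regular x is conjugate under \<open>SL_n\<close> to an
 element of \<open>f + b\<close> for a suitable f, and Fourier analysis on \<open>K^m\<close> shows that an eigenvector for
 such an x has a nonzero theta-component under U.\<close>

section \<open>The ring of matrices\<close>

text \<open>The parity of l is the obstacle. For even l one has r = m, and a factor in
  \<open>K^r\<close> is absorbed by the character attached to x. For odd l the group
  \<open>K^r\<close> is not abelian modulo the kernel of that character: commutators land in
  \<open>K^(2r)\<close>, where the character is nontrivial. Since p = 2 is allowed for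
  \<open>GL_n\<close>, no splitting into symmetric and skew parts is available either. The twisted
  average is therefore evaluated by orthogonality of characters alone: translations by elements
  fixed under a twisted involution give one evaluation, translations by U intersected with
  \<open>K^r\<close> the other. In both, all surviving summands agree and only have to be counted,
  so the constant is a quotient of two cardinalities. The harmonic analysis takes place on
  \<open>GL_n\<close> throughout. A coefficient of \<open>P g P\<close> on \<open>SL_n\<close> is
  extended by zero, which keeps it equivariant because U lies in \<open>SL_n\<close>, and tau
  preserves determinants. In part (1) the condition on n makes n a unit of the ring, so that the
  trace form is perfect on trace zero matrices. For odd l an eigenvector of \<open>K^m\<close> has
  to be made theta-equivariant on U intersected with \<open>K^r\<close> before it is projected to
  theta under U.\<close>

definition linear_endo :: "((nat \<Rightarrow> 'r::comm_ring_1) \<Rightarrow> nat \<Rightarrow> 'r) \<Rightarrow> bool" where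
  "linear_endo f \<longleftrightarrow> (\<forall>v w. f (\<lambda>i. v i + w i) = (\<lambda>i. f v i + f w i)) \<and>
     (\<forall>c v. f (\<lambda>i. c * v i) = (\<lambda>i. c * f v i))"

text \<open>Operators on sequences replace \<open>mat\<close> because the type is an instance of
  \<open>ring_1\<close>: ring rewriting and powers apply without carrier conditions, and only
  membership in the set of n by n matrices has to be tracked.\<close>

typedef (overloaded) 'r endo = "{f :: (nat \<Rightarrow> 'r::comm_ring_1) \<Rightarrow> nat \<Rightarrow> 'r. linear_endo f}"
  morphisms app Endo
  by (rule exI[of _ "\<lambda>v. v"]) (simp add: linear_endo_def)

lemma app_linear: "linear_endo (app a)"
  using app[of a] by simp

lemma app_add: "app a (\<lambda>i. v i + w i) = (\<lambda>i. app a v i + app a w i)"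
  using app_linear[of a] by (simp add: linear_endo_def)

lemma app_smult: "app a (\<lambda>i. c * v i) = (\<lambda>i. c * app a v i)"
  using app_linear[of a] by (simp add: linear_endo_def)

lemma app_Endo: "linear_endo f \<Longrightarrow> app (Endo f) = f"
  by (simp add: Endo_inverse)

lemma endo_eqI: "(\<And>v i. app a v i = app b v i) \<Longrightarrow> a = b"
  by (metis app_inject ext)

instantiation endo :: (comm_ring_1) ring_1
begin

definition "0 = Endo (\<lambda>v i. 0)"
definition "1 = Endo (\<lambda>v. v)"
definition "a + b = Endo (\<lambda>v i. app a v i + app b v i)"
definition "- a = Endo (\<lambda>v i. - app a v i)"
definition "a - b = Endo (\<lambda>v i. app a v i - app b v i)"
definition "a * b = Endo (\<lambda>v. app a (app b v))"

lemma app_0: "app 0 v i = 0"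
  unfolding zero_endo_def by (subst app_Endo) (auto simp: linear_endo_def)
lemma app_1: "app 1 v = v"
  unfolding one_endo_def by (subst app_Endo) (auto simp: linear_endo_def)
lemma app_plus: "app (a + b) v i = app a v i + app b v i"
  unfolding plus_endo_def
  by (subst app_Endo) (auto simp: linear_endo_def app_add app_smult algebra_simps)
lemma app_uminus: "app (- a) v i = - app a v i"
  unfolding uminus_endo_def
  by (subst app_Endo) (auto simp: linear_endo_def app_add app_smult algebra_simps)
lemma app_minus: "app (a - b) v i = app a v i - app b v i"
  unfolding minus_endo_def
  by (subst app_Endo) (auto simp: linear_endo_def app_add app_smult algebra_simps)
lemma app_times: "app (a * b) v = app a (app b v)"
  unfolding times_endo_def
  by (subst app_Endo) (auto simp: linear_endo_def app_add app_smult)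

lemmas app_simps = app_0 app_1 app_plus app_uminus app_minus app_times

instance
proof
  fix a b c :: "'a endo"
  have d: "app a (\<lambda>i. app b v i + app c v i) = (\<lambda>i. app a (app b v) i + app a (app c v) i)" for v
    by (simp add: app_add)
  have *: "app (b + c) v = (\<lambda>i. app b v i + app c v i)" for v
    by (rule ext) (simp add: app_simps)
  show "a * (b + c) = a * b + a * c"
    by (rule endo_eqI) (simp add: app_times app_plus * d)
  show "(0::'a endo) \<noteq> 1"
  proof
    assume "(0::'a endo) = 1"
    then have "app (0::'a endo) (\<lambda>i. 1) 0 = app 1 (\<lambda>i. 1) 0" by simp
    then show False by (simp add: app_simps)
  qed
qed (rule endo_eqI, simp add: app_simps algebra_simps)+

end

definition sc :: "'r::comm_ring_1 \<Rightarrow> 'r endo" where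
  "sc c = Endo (\<lambda>v i. c * v i)"

lemma app_sc: "app (sc c) v i = c * v i"
  unfolding sc_def by (subst app_Endo) (auto simp: linear_endo_def algebra_simps)

lemma sc_0: "sc 0 = 0"
  by (rule endo_eqI) (simp add: app_sc app_simps)

lemma sc_1: "sc 1 = 1"
  and sc_mult: "sc (a * b) = sc a * sc b"
  by (rule endo_eqI, simp add: app_sc app_simps algebra_simps)+

lemma sc_central: "a * sc c = sc c * a"
proof -
  have *: "app (sc c) v = (\<lambda>i. c * v i)" for v by (rule ext) (simp add: app_sc)
  show ?thesis by (rule endo_eqI) (simp add: app_simps * app_smult)
qed

lemma sc_left_commute: "a * (sc c * b) = sc c * (a * b)"
  by (metis sc_central mult.assoc)

lemma sc_sc: "sc c * (sc d * a) = sc (c * d) * a"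
  by (simp add: sc_mult mult.assoc)

definition ent :: "'r::comm_ring_1 endo \<Rightarrow> nat \<Rightarrow> nat \<Rightarrow> 'r" where
  "ent a i j = app a (\<lambda>k. if k = j then 1 else 0) i"

lemma ent_add [simp]: "ent (a + b) i j = ent a i j + ent b i j"
  and ent_diff [simp]: "ent (a - b) i j = ent a i j - ent b i j"
  and ent_uminus [simp]: "ent (- a) i j = - ent a i j"
  and ent_0 [simp]: "ent 0 i j = 0"
  and ent_1: "ent 1 i j = (if i = j then 1 else 0)"
  by (simp_all add: ent_def app_simps)

lemma ent_sc_mult [simp]: "ent (sc c * a) i j = c * ent a i j"
  by (simp add: ent_def app_simps app_sc)

lemma ent_sc: "ent (sc c) i j = (if i = j then c else 0)"
  by (simp add: ent_def app_simps app_sc)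

lemma ent_sum [simp]: "ent (\<Sum>x\<in>S. f x) i j = (\<Sum>x\<in>S. ent (f x) i j)"
  by (induction S rule: infinite_finite_induct) simp_all

text \<open>The n by n matrices form a ring with the unit of a type that does not depend on n, by letting
 a matrix act on each of the consecutive blocks of length n of a sequence.\<close>

locale matrix_ring =
  fixes n :: nat
  assumes n_pos: "0 < n"
begin

definition mt :: "(nat \<Rightarrow> nat \<Rightarrow> 'r::comm_ring_1) \<Rightarrow> 'r endo" where
  "mt f = Endo (\<lambda>v k. \<Sum>j<n. f (k mod n) j * v (k - k mod n + j))"

definition M :: "'r::comm_ring_1 endo set" where
  "M = range mt"

lemma app_mt: "app (mt f) v k = (\<Sum>j<n. f (k mod n) j * v (k - k mod n + j))"
  unfolding mt_def
  by (subst app_Endo) (auto simp: linear_endo_def algebra_simps sum.distrib sum_distrib_left)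

lemma ent_mt: "i < n \<Longrightarrow> j < n \<Longrightarrow> ent (mt f) i j = f i j"
  by (simp add: ent_def app_mt if_distrib cong: if_cong)

lemma mt_cong: "(\<And>i j. i < n \<Longrightarrow> j < n \<Longrightarrow> f i j = g i j) \<Longrightarrow> mt f = mt g"
  using n_pos by (intro endo_eqI) (simp add: app_mt)

lemma mt_in_M [simp]: "mt f \<in> M"
  by (simp add: M_def)

lemma mt_ent: "a \<in> M \<Longrightarrow> mt (ent a) = a"
  by (auto simp: M_def ent_mt intro!: mt_cong)

lemma M_eqI: "a \<in> M \<Longrightarrow> b \<in> M \<Longrightarrow> (\<And>i j. i < n \<Longrightarrow> j < n \<Longrightarrow> ent a i j = ent b i j) \<Longrightarrow> a = b"
  by (metis mt_cong mt_ent)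

lemma mt_plus: "mt f + mt g = mt (\<lambda>i j. f i j + g i j)"
  by (rule endo_eqI) (simp add: app_mt app_simps algebra_simps sum.distrib)

lemma mt_minus: "mt f - mt g = mt (\<lambda>i j. f i j - g i j)"
  by (rule endo_eqI) (simp add: app_mt app_simps algebra_simps sum_subtractf)

lemma mt_uminus: "- mt f = mt (\<lambda>i j. - f i j)"
  by (rule endo_eqI) (simp add: app_mt app_simps sum_negf)

lemma mt_sc: "sc c = mt (\<lambda>i j. if i = j then c else 0)"
proof (rule endo_eqI)
  fix v :: "nat \<Rightarrow> 'a" and k
  have "app (mt (\<lambda>i j. if i = j then c else 0)) v k = (\<Sum>j<n. if j = k mod n then c * v (k - k mod n + j) else 0)"
    unfolding app_mt by (rule sum.cong) auto
  also have "\<dots> = c * v k" using n_pos by simp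
  finally show "app (sc c) v k = app (mt (\<lambda>i j. if i = j then c else 0)) v k" by (simp add: app_sc)
qed

lemma mt_times: "mt f * mt g = mt (\<lambda>i j. \<Sum>k<n. f i k * g k j)"
proof (rule endo_eqI)
  fix v :: "nat \<Rightarrow> 'a" and k
  \<comment> \<open>\<open>k - k mod n\<close> is the start of the block that contains k, so adding
    j stays in this block at position j.\<close>
  have *: "(k - k mod n + j) mod n = j" if "j < n" for j
    using that by (simp add: minus_mod_eq_mult_div)
  have "app (mt f * mt g) v k = (\<Sum>j<n. f (k mod n) j * (\<Sum>i<n. g j i * v (k - k mod n + i)))"
    unfolding app_times app_mt[of f]
  proof (rule sum.cong[OF refl])
    fix j assume "j \<in> {..<n}"
    then have j: "(k - k mod n + j) mod n = j" by (simp only: * lessThan_iff)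
    show "f (k mod n) j * app (mt g) v (k - k mod n + j) = f (k mod n) j * (\<Sum>i<n. g j i * v (k - k mod n + i))"
      unfolding app_mt j by simp
  qed
  also have "\<dots> = (\<Sum>j<n. \<Sum>i<n. f (k mod n) j * g j i * v (k - k mod n + i))"
    by (simp add: sum_distrib_left mult.assoc)
  also have "\<dots> = (\<Sum>i<n. \<Sum>j<n. f (k mod n) j * g j i * v (k - k mod n + i))"
    by (rule sum.swap)
  also have "\<dots> = app (mt (\<lambda>i j. \<Sum>k<n. f i k * g k j)) v k"
    by (simp add: app_mt sum_distrib_right)
  finally show "app (mt f * mt g) v k = app (mt (\<lambda>i j. \<Sum>k<n. f i k * g k j)) v k" .
qed

lemma M_sc [simp]: "sc c \<in> M"
  by (simp add: mt_sc)

lemma M_0 [simp]: "0 \<in> M" and M_1 [simp, intro]: "1 \<in> M"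
  using M_sc[of 0] M_sc[of 1] by (simp_all only: sc_0 sc_1)

lemma M_add [simp]: "a \<in> M \<Longrightarrow> b \<in> M \<Longrightarrow> a + b \<in> M"
  and M_diff [simp]: "a \<in> M \<Longrightarrow> b \<in> M \<Longrightarrow> a - b \<in> M"
  and M_uminus [simp]: "a \<in> M \<Longrightarrow> - a \<in> M"
  and M_mult [simp]: "a \<in> M \<Longrightarrow> b \<in> M \<Longrightarrow> a * b \<in> M"
  by (auto simp: M_def mt_plus mt_minus mt_uminus mt_times)

lemma M_power [simp]: "a \<in> M \<Longrightarrow> a ^ k \<in> M"
  by (induction k) auto

lemma M_sum [simp]: "(\<And>x. x \<in> S \<Longrightarrow> f x \<in> M) \<Longrightarrow> (\<Sum>x\<in>S. f x) \<in> M"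
  by (induction S rule: infinite_finite_induct) auto

lemma ent_mult: "a \<in> M \<Longrightarrow> b \<in> M \<Longrightarrow> i < n \<Longrightarrow> j < n \<Longrightarrow> ent (a * b) i j = (\<Sum>k<n. ent a i k * ent b k j)"
  by (auto simp: M_def mt_times ent_mt)

definition tr :: "'r::comm_ring_1 endo \<Rightarrow> 'r" where
  "tr a = (\<Sum>i<n. ent a i i)"

lemma tr_add: "tr (a + b) = tr a + tr b"
  and tr_diff: "tr (a - b) = tr a - tr b"
  and tr_uminus: "tr (- a) = - tr a"
  and tr_0: "tr 0 = 0"
  and tr_sc_mult: "tr (sc c * a) = c * tr a"
  by (simp_all add: tr_def sum.distrib sum_subtractf sum_negf sum_distrib_left)

lemma tr_sc: "tr (sc c) = of_nat n * c"
  by (simp add: tr_def ent_sc)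

lemma tr_comm: "a \<in> M \<Longrightarrow> b \<in> M \<Longrightarrow> tr (a * b) = tr (b * a)"
proof -
  assume ab: "a \<in> M" "b \<in> M"
  then have "tr (a * b) = (\<Sum>i<n. \<Sum>k<n. ent a i k * ent b k i)"
    by (simp add: tr_def ent_mult)
  also have "\<dots> = (\<Sum>k<n. \<Sum>i<n. ent a i k * ent b k i)" by (rule sum.swap)
  also have "\<dots> = tr (b * a)" using ab by (simp add: tr_def ent_mult mult.commute)
  finally show ?thesis .
qed

lemma tr_mult: "a \<in> M \<Longrightarrow> b \<in> M \<Longrightarrow> tr (a * b) = (\<Sum>i<n. \<Sum>j<n. ent a i j * ent b j i)"
  by (simp add: tr_def ent_mult)

section \<open>Passage to the matrices of the statement\<close>

definition ma :: "'r::comm_ring_1 endo \<Rightarrow> 'r mat" where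
  "ma a = mat n n (\<lambda>(i, j). ent a i j)"

definition em :: "'r::comm_ring_1 mat \<Rightarrow> 'r endo" where
  "em A = mt (\<lambda>i j. A $$ (i, j))"

lemma ma_carrier [simp]: "ma a \<in> carrier_mat n n"
  by (simp add: ma_def)

lemma ma_dim [simp]: "dim_row (ma a) = n" "dim_col (ma a) = n"
  by (simp_all add: ma_def)

lemma ma_index [simp]: "i < n \<Longrightarrow> j < n \<Longrightarrow> ma a $$ (i, j) = ent a i j"
  by (simp add: ma_def)

lemma em_in_M [simp]: "em A \<in> M"
  by (simp add: em_def)

lemma ma_em: "A \<in> carrier_mat n n \<Longrightarrow> ma (em A) = A"
  by (auto simp: ma_def em_def ent_mt)

lemma em_ma: "a \<in> M \<Longrightarrow> em (ma a) = a"
  by (rule M_eqI) (auto simp: em_def ent_mt)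

lemma ma_mult: "a \<in> M \<Longrightarrow> b \<in> M \<Longrightarrow> ma (a * b) = ma a * ma b"
  by (auto simp: ent_mult scalar_prod_def intro!: eq_matI sum.cong simp flip: lessThan_atLeast0)

lemma ma_1: "ma 1 = 1\<^sub>m n"
  by (auto simp: ent_1)

lemma ma_add: "ma (a + b) = ma a + ma b"
  by auto

lemma ma_sc_mult: "ma (sc c * a) = c \<cdot>\<^sub>m ma a"
  by auto

lemma ma_inj: "a \<in> M \<Longrightarrow> b \<in> M \<Longrightarrow> ma a = ma b \<Longrightarrow> a = b"
  by (metis em_ma)

lemma mtrace_ma: "mtrace (ma a) = tr a"
  by (simp add: mtrace_def tr_def)

text \<open>The type \<open>endo\<close> itself is infinite. All later sums over matrices rest on
  the fact that an element of \<open>M\<close> is determined by its n by n entries in a finite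
  ring.\<close>

lemma finite_M [simp]: "finite (M :: 'r::{comm_ring_1,finite} endo set)"
proof (rule finite_subset)
  show "M \<subseteq> (\<lambda>f. mt (\<lambda>i j. f (i, j))) ` (PiE ({..<n} \<times> {..<n}) (\<lambda>_. UNIV :: 'r set))"
  proof
    fix a :: "'r endo" assume a: "a \<in> M"
    let ?f = "restrict (\<lambda>(i, j). ent a i j) ({..<n} \<times> {..<n})"
    have "mt (\<lambda>i j. ?f (i, j)) = mt (ent a)" by (rule mt_cong) simp
    with a have a: "a = mt (\<lambda>i j. ?f (i, j))" by (simp add: mt_ent)
    show "a \<in> (\<lambda>f. mt (\<lambda>i j. f (i, j))) ` (PiE ({..<n} \<times> {..<n}) (\<lambda>_. UNIV))"
      by (subst a, rule image_eqI[where x = ?f], rule refl) simp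
  qed
  show "finite ((\<lambda>f. mt (\<lambda>i j. f (i, j))) ` (PiE ({..<n} \<times> {..<n}) (\<lambda>_. UNIV :: 'r set)))"
    by (rule finite_imageI, rule finite_PiE) simp_all
qed

end

section \<open>Matrices over a truncated valuation ring\<close>

lemma nilpotent_inverse:
  fixes b :: "'a::ring_1"
  assumes "b ^ k = 0"
  shows "(1 - b) * (\<Sum>i<k. b ^ i) = 1" "(\<Sum>i<k. b ^ i) * (1 - b) = 1"
proof -
  have l: "(1 - b) * (\<Sum>i<j. b ^ i) = 1 - b ^ j" for j
  proof (induction j)
    case (Suc j)
    have "(1 - b) * (\<Sum>i<Suc j. b ^ i) = (1 - b) * (\<Sum>i<j. b ^ i) + (1 - b) * b ^ j"
      by (simp add: distrib_left)
    then show ?case unfolding Suc.IH by (simp add: left_diff_distrib)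
  qed simp
  have c: "(\<Sum>i<k. b ^ i) * b = b * (\<Sum>i<k. b ^ i)"
    unfolding sum_distrib_left sum_distrib_right by (simp only: power_commutes)
  show "(1 - b) * (\<Sum>i<k. b ^ i) = 1" using l[of k] assms by simp
  then show "(\<Sum>i<k. b ^ i) * (1 - b) = 1" by (simp only: left_diff_distrib right_diff_distrib c mult_1_left mult_1_right)
qed

text \<open>Translation by a permutes H and multiplies the sum by \<open>chi a\<close>.\<close>

lemma character_sum_zero:
  fixes chi :: "'a::group_add \<Rightarrow> complex"
  assumes "finite H" and cl: "\<And>y. y \<in> H \<Longrightarrow> a + y \<in> H"
    and hom: "\<And>y. y \<in> H \<Longrightarrow> chi (a + y) = chi a * chi y" and ne: "chi a \<noteq> 1"
  shows "sum chi H = 0"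
proof -
  have inj: "inj_on ((+) a) H" by (rule inj_onI) simp
  have "(+) a ` H = H"
    by (rule endo_inj_surj[OF assms(1) _ inj]) (use cl in auto)
  then have "sum chi H = (\<Sum>y\<in>H. chi (a + y))"
    using sum.reindex[OF inj, of chi] by simp
  also have "\<dots> = chi a * sum chi H" by (simp add: hom sum_distrib_left)
  finally have "(1 - chi a) * sum chi H = 0" by (simp add: algebra_simps)
  with ne show ?thesis by simp
qed

lemma dvd_one_cancel:
  fixes c :: "'r::comm_ring_1"
  assumes "c dvd 1" "z * (c * a) = 0" shows "z * a = 0"
proof -
  obtain d where "1 = c * d" using assms(1) by (auto elim: dvdE)
  have "d * (z * (c * a)) = z * a * (c * d)" by (simp only: ac_simps)
  with assms(2) \<open>1 = c * d\<close> show ?thesis by simp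
qed

locale trunc = matrix_ring n for n +
  fixes t :: "'r::{comm_ring_1,finite}" and l p :: nat and phi :: "'r \<Rightarrow> complex"
  assumes l2: "2 \<le> l" and td: "trunc_dvr t l p" and prim: "primitive_char t l phi"
begin

lemma t_l: "t ^ l = 0" and t_l1: "t ^ (l - 1) \<noteq> 0"
  using td by (auto simp: trunc_dvr_def)

lemma t_pow_0: "l \<le> k \<Longrightarrow> t ^ k = 0"
  by (metis le_Suc_ex mult_zero_left power_add t_l)

lemma unit_or: "a dvd 1 \<or> (\<exists>b. a = t * b)"
  using td by (auto simp: trunc_dvr_def in_uR_def)

text \<open>The uniformizer is divided out repeatedly: each quotient is a unit or again a multiple
  of t, and after l divisions only 0 is left because \<open>t ^ l = 0\<close>.\<close>

lemma valuation: "a \<noteq> 0 \<Longrightarrow> \<exists>k<l. \<exists>u. u dvd 1 \<and> a = t ^ k * u"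
proof -
  have "(\<exists>k<j. \<exists>u. u dvd 1 \<and> a = t ^ k * u) \<or> (\<exists>b. a = t ^ j * b)" for j
  proof (induction j)
    case (Suc j)
    then show ?case
    proof (rule disjE[OF disj_commute[THEN iffD1]])
      assume "\<exists>b. a = t ^ j * b"
      then obtain b where b: "a = t ^ j * b" by blast
      have jj: "j < Suc j" by simp
      from unit_or[of b] show ?thesis
      proof
        assume "b dvd 1" with b jj show ?thesis by blast
      next
        assume "\<exists>d. b = t * d"
        then obtain d where "b = t * d" by blast
        with b have "a = t ^ Suc j * d" by (simp add: ac_simps)
        then show ?thesis by blast
      qed
    next
      assume "\<exists>k<j. \<exists>u. u dvd 1 \<and> a = t ^ k * u"
      then show ?thesis using less_SucI by blast
    qed
  qed simp
  from this[of l] show "a \<noteq> 0 \<Longrightarrow> \<exists>k<l. \<exists>u. u dvd 1 \<and> a = t ^ k * u"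
    by (auto simp: t_l)
qed

text \<open>With a written as \<open>t ^ k\<close> times a unit, \<open>t ^ (i + k) = 0\<close>
  forces \<open>l \<le> i + k\<close>, because \<open>t ^ (l - 1)\<close> is nonzero. This is what
  turns equations scaled by \<open>t ^ i\<close> into congruences modulo
  \<open>t ^ (l - i)\<close>.\<close>

lemma t_pow_mult_0:
  assumes "i \<le> l" "t ^ i * a = 0"
  shows "\<exists>b. a = t ^ (l - i) * b"
proof (cases "a = 0")
  case False
  then obtain k u where k: "k < l" "u dvd 1" "a = t ^ k * u" using valuation by blast
  have "t ^ (i + k) = 0"
  proof -
    have "1 * (u * t ^ (i + k)) = 0" using assms(2) k(3) by (simp add: power_add ac_simps)
    then show ?thesis using dvd_one_cancel[OF k(2), of 1] by simp
  qed
  then have "l \<le> i + k"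
  proof (rule contrapos_pp)
    assume "\<not> l \<le> i + k"
    then have "l - 1 = (i + k) + (l - 1 - (i + k))" by simp
    then have "t ^ (l - 1) = t ^ (i + k) * t ^ (l - 1 - (i + k))" by (metis power_add)
    then show "t ^ (i + k) \<noteq> 0" using t_l1 by (metis mult_zero_left)
  qed
  then have "k = (l - i) + (k - (l - i))" by simp
  then have "t ^ k = t ^ (l - i) * t ^ (k - (l - i))" by (metis power_add)
  with k(3) show ?thesis by (metis mult.assoc)
qed (metis mult_zero_right)

lemma phi_0: "phi 0 = 1" and phi_add: "phi (a + b) = phi a * phi b"
  using prim by (auto simp: primitive_char_def add_char_def)

lemma phi_sum: "finite S \<Longrightarrow> phi (\<Sum>i\<in>S. f i) = (\<Prod>i\<in>S. phi (f i))"
  by (induction S rule: finite_induct) (simp_all add: phi_0 phi_add)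

lemma phi_uminus_mult: "phi (- a) * phi a = 1" "phi a * phi (- a) = 1"
  using phi_add[of "- a" a] phi_add[of a "- a"] by (simp_all add: phi_0)

lemma phi_nz: "phi a \<noteq> 0"
  using phi_uminus_mult(2)[of a] by auto

lemma phi_diff: "phi (a - b) = phi a * phi (- b)"
  using phi_add[of a "- b"] by simp

lemma phi_diff_1: "phi (a - b) = 1 \<longleftrightarrow> phi a = phi b"
proof -
  have "phi (a - b) * phi b = phi a" by (simp flip: phi_add)
  then show ?thesis using phi_nz[of b] by (metis mult_cancel_right1)
qed

text \<open>A nonzero b divides \<open>t ^ (l - 1)\<close>, so its multiples include the elements on
  which a primitive character is nontrivial.\<close>

lemma phi_nondegenerate: assumes "\<And>a. phi (b * a) = 1" shows "b = 0"
proof (rule ccontr)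
  assume "b \<noteq> 0"
  then obtain k u where k: "k < l" "u dvd 1" "b = t ^ k * u" using valuation by blast
  obtain v where v: "1 = u * v" using k(2) by (auto elim: dvdE)
  obtain a where a: "phi (t ^ (l - 1) * a) \<noteq> 1" using prim by (auto simp: primitive_char_def)
  have "t ^ (l - 1) * a = t ^ k * t ^ (l - 1 - k) * a * (u * v)" using k(1) v by (simp flip: power_add)
  also have "\<dots> = b * (t ^ (l - 1 - k) * v * a)" unfolding k(3) by (simp add: ac_simps)
  finally show False using a assms by metis
qed

lemma primitive_char_phi: "c dvd 1 \<Longrightarrow> primitive_char t l (\<lambda>a. phi (c * a))"
proof -
  assume c: "c dvd 1"
  obtain d where d: "1 = c * d" using c by (auto elim: dvdE)
  obtain a where a: "phi (t ^ (l - 1) * a) \<noteq> 1" using prim by (auto simp: primitive_char_def)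
  have "c * (t ^ (l - 1) * (d * a)) = c * d * (t ^ (l - 1) * a)" by (simp only: ac_simps)
  then have "phi (c * (t ^ (l - 1) * (d * a))) \<noteq> 1" using a d by simp
  then show ?thesis by (auto simp: primitive_char_def add_char_def phi_0 phi_add distrib_left)
qed

text \<open>The additive group is its own dual through phi. If chi differed from every
  \<open>phi (c * a)\<close>, all its Fourier coefficients would vanish, whereas their sum over c is
  the cardinality of the ring times \<open>chi 0 = 1\<close>. Primitivity then makes c a unit, since
  a multiple of t would kill \<open>t ^ (l - 1)\<close>.\<close>

lemma primitive_char_eq:
  assumes "primitive_char t l chi"
  obtains c where "c dvd 1" "\<And>a. chi a = phi (c * a)"
proof -
  have ch: "chi 0 = 1" "chi (a + b) = chi a * chi b" for a b
    using assms by (auto simp: primitive_char_def add_char_def)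
  have "\<exists>c. \<forall>a. chi a = phi (c * a)"
  proof (rule ccontr)
    assume n: "\<nexists>c. \<forall>a. chi a = phi (c * a)"
    have z: "(\<Sum>a\<in>UNIV. chi a * phi (- (c * a))) = 0" for c
    proof -
      obtain a where "chi a \<noteq> phi (c * a)" using n by blast
      then have "chi a * phi (- (c * a)) \<noteq> 1"
        using phi_uminus_mult(1)[of "c * a"] by (metis mult.commute mult.right_neutral mult.assoc)
      then show ?thesis
        by (intro character_sum_zero[where a = a]) (auto simp: ch algebra_simps phi_diff phi_add)
    qed
    have "0 = (\<Sum>c\<in>UNIV. \<Sum>a\<in>UNIV. chi a * phi (- (c * a)))" by (simp add: z)
    also have "\<dots> = (\<Sum>a\<in>UNIV. \<Sum>c\<in>UNIV. chi a * phi (- (c * a)))" by (rule sum.swap)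
    also have "\<dots> = (\<Sum>a\<in>UNIV. chi a * (if a = 0 then of_nat (card (UNIV::'r set)) else 0))"
    proof (rule sum.cong[OF refl])
      fix a :: 'r
      have "(\<Sum>c\<in>UNIV. phi (- (c * a))) = 0" if a0: "a \<noteq> 0"
      proof -
        obtain b where b: "phi (a * b) \<noteq> 1" using phi_nondegenerate[of a] a0 by blast
        have "phi (- (- b * a)) \<noteq> 1" using b by (simp add: mult.commute)
        then show ?thesis
          by (intro character_sum_zero[where a = "- b"]) (auto simp: algebra_simps phi_add phi_diff)
      qed
      then show "(\<Sum>c\<in>UNIV. chi a * phi (- (c * a))) = chi a * (if a = 0 then of_nat (card (UNIV::'r set)) else 0)"
        unfolding sum_distrib_left[symmetric] by (cases "a = 0") (simp_all add: phi_0)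
    qed
    also have "\<dots> = of_nat (card (UNIV::'r set))" by (simp add: ch if_distrib cong: if_cong)
    finally show False by simp
  qed
  then obtain c where c: "\<And>a. chi a = phi (c * a)" by blast
  have "c dvd 1"
  proof (rule ccontr)
    assume "\<not> c dvd 1"
    then obtain d where "c = t * d" using unit_or by blast
    then have "chi (t ^ (l - 1) * a) = 1" for a
      using c[of "t ^ (l - 1) * a"] t_l l2 by (cases l) (auto simp: phi_0 ac_simps)
    then show False using assms by (auto simp: primitive_char_def)
  qed
  with c show ?thesis using that by blast
qed

section \<open>The unit group and the congruence subgroups\<close>

definition GL :: "'r endo set" where
  "GL = {a \<in> M. \<exists>b\<in>M. a * b = 1 \<and> b * a = 1}"

definition iv :: "'r endo \<Rightarrow> 'r endo" where
  "iv a = (THE b. a * b = 1 \<and> b * a = 1)"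

lemma iv_eq: "a * b = 1 \<Longrightarrow> b * a = 1 \<Longrightarrow> iv a = b"
  unfolding iv_def by (rule the_equality) (auto, metis mult.assoc mult.left_neutral mult.right_neutral)

lemma GL_iv: assumes "a \<in> GL"
  shows "a * iv a = 1" "iv a * a = 1" "iv a \<in> GL"
proof -
  obtain b where b: "a \<in> M" "b \<in> M" "a * b = 1" "b * a = 1" using assms by (auto simp: GL_def)
  then have "iv a = b" by (simp add: iv_eq)
  with b show "a * iv a = 1" "iv a * a = 1" "iv a \<in> GL" by (auto simp: GL_def)
qed

lemma GL_M [simp]: "a \<in> GL \<Longrightarrow> a \<in> M"
  by (simp add: GL_def)

lemma iv_GL [simp]: "a \<in> GL \<Longrightarrow> iv a \<in> GL"
  by (rule GL_iv)

lemma iv_M [simp]: "a \<in> GL \<Longrightarrow> iv a \<in> M"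
  by simp

lemma iv_cancel [simp]:
  assumes "a \<in> GL"
  shows "a * iv a = 1" "iv a * a = 1" "a * (iv a * b) = b" "iv a * (a * b) = b"
  using GL_iv[OF assms] by (simp_all flip: mult.assoc)

lemma GL_I: "a \<in> M \<Longrightarrow> b \<in> M \<Longrightarrow> a * b = 1 \<Longrightarrow> b * a = 1 \<Longrightarrow> a \<in> GL"
  unfolding GL_def by blast

lemma GL_mult [simp]: assumes "a \<in> GL" "b \<in> GL" shows "a * b \<in> GL"
  by (rule GL_I[where b = "iv b * iv a"]) (use assms in \<open>simp_all add: mult.assoc\<close>)

lemma iv_mult: "a \<in> GL \<Longrightarrow> b \<in> GL \<Longrightarrow> iv (a * b) = iv b * iv a"
  by (rule iv_eq) (simp_all add: mult.assoc)

lemma iv_iv [simp]: "a \<in> GL \<Longrightarrow> iv (iv a) = a"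
  by (rule iv_eq) simp_all

lemma iv_1 [simp]: "iv 1 = 1"
  by (rule iv_eq) simp_all

lemma nilpotent_GL:
  assumes "a \<in> M" "a ^ k = 0"
  shows "1 - a \<in> GL" "iv (1 - a) = (\<Sum>i<k. a ^ i)"
proof -
  have s: "(\<Sum>i<k. a ^ i) \<in> M" using assms by (intro M_sum M_power)
  show "1 - a \<in> GL"
    by (rule GL_I[OF _ s]) (use nilpotent_inverse[OF assms(2)] assms(1) in simp_all)
  show "iv (1 - a) = (\<Sum>i<k. a ^ i)"
    by (rule iv_eq) (rule nilpotent_inverse[OF assms(2)])+
qed

lemma sc_t_0: "l \<le> k \<Longrightarrow> sc (t ^ k) = 0"
  by (simp add: t_pow_0 sc_0)

lemma sc_mult_power: "(sc c * a) ^ k = sc (c ^ k) * a ^ k"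
proof (induction k)
  case (Suc k)
  have "(sc c * a) ^ Suc k = sc c * (a * (sc (c ^ k) * a ^ k))" by (simp add: Suc mult.assoc)
  also have "\<dots> = sc c * (sc (c ^ k) * (a * a ^ k))" by (simp only: sc_left_commute[of a])
  finally show ?case by (simp add: sc_mult mult.assoc)
qed (simp add: sc_1)

lemma K_GL [simp]: "1 \<le> i \<Longrightarrow> y \<in> M \<Longrightarrow> 1 + sc (t ^ i) * y \<in> GL"
proof -
  assume i: "1 \<le> i" "y \<in> M"
  have "(sc (t ^ i) * - y) ^ l = 0"
    unfolding sc_mult_power power_mult[symmetric] by (subst sc_t_0) (use i in simp_all)
  then have "1 - sc (t ^ i) * - y \<in> GL" by (rule nilpotent_GL(1)[rotated]) (use i in simp)
  then show ?thesis by simp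
qed

lemma sc_t_div:
  fixes w :: "'r endo"
  assumes "i \<le> l" "w \<in> M" "sc (t ^ i) * w = 0"
  shows "\<exists>y\<in>M. w = sc (t ^ (l - i)) * y"
proof -
  have "\<exists>b. ent w i' j = t ^ (l - i) * b" for i' j
    using assms(1) arg_cong[OF assms(3), of "\<lambda>a. ent a i' j"] by (intro t_pow_mult_0) simp_all
  then obtain b where b: "\<And>i' j. ent w i' j = t ^ (l - i) * b i' j" by metis
  show ?thesis
    using assms(2) by (intro bexI[of _ "mt b"] M_eqI) (auto simp: b ent_mt)
qed

definition Em :: "nat \<Rightarrow> nat \<Rightarrow> 'r endo" where
  "Em i j = mt (\<lambda>i' j'. if i' = i \<and> j' = j then 1 else 0)"

lemma Em_M [simp]: "Em i j \<in> M" by (simp add: Em_def)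

lemma ent_Em: "i' < n \<Longrightarrow> j' < n \<Longrightarrow> ent (Em i j) i' j' = (if i' = i \<and> j' = j then 1 else 0)"
  by (simp add: Em_def ent_mt)

lemma tr_mult_Em: "(w :: 'r endo) \<in> M \<Longrightarrow> i < n \<Longrightarrow> j < n \<Longrightarrow> tr (w * Em i j) = ent w j i"
proof -
  assume w: "w \<in> M" "i < n" "j < n"
  have "tr (w * Em i j) = (\<Sum>i'<n. \<Sum>j'<n. if i' = j then (if j' = i then ent w i' j' else 0) else 0)"
    using w by (subst tr_mult) (auto simp: ent_Em intro!: sum.cong)
  also have "\<dots> = (\<Sum>i'<n. if i' = j then ent w i' i else 0)"
    using w by (intro sum.cong) auto
  also have "\<dots> = ent w j i" using w by simp
  finally show ?thesis .
qed

lemma trace_nondegenerate: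
  fixes w :: "'r endo"
  assumes w: "w \<in> M" and "\<And>y. y \<in> M \<Longrightarrow> z * tr (w * y) = 0"
  shows "sc z * w = 0"
proof (rule M_eqI)
  fix i j assume ij: "i < n" "j < n"
  show "ent (sc z * w) i j = ent 0 i j"
    using assms(2)[of "Em j i"] ij w by (simp add: tr_mult_Em)
qed (use w in simp_all)

text \<open>Replacing y by its scalar multiples upgrades triviality of phi on the trace values to
  vanishing of these values.\<close>

lemma phi_trace_nondegenerate:
  fixes w :: "'r endo"
  assumes w: "w \<in> M" and "\<And>y. y \<in> M \<Longrightarrow> phi (z * tr (w * y)) = 1"
  shows "sc z * w = 0"
proof (rule trace_nondegenerate[OF w])
  fix y :: "'r endo" assume y: "y \<in> M"
  show "z * tr (w * y) = 0"
  proof (rule phi_nondegenerate)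
    fix a
    have "phi (z * tr (w * (sc a * y))) = 1" by (rule assms(2)) (use y in simp)
    then show "phi (z * tr (w * y) * a) = 1"
      by (simp add: sc_left_commute[of w] tr_sc_mult ac_simps)
  qed
qed

section \<open>Triangular and unipotent matrices\<close>

definition NN :: "'r endo set" where
  "NN = {a \<in> M. \<forall>i<n. \<forall>j<n. j \<le> i \<longrightarrow> ent a i j = 0}"

definition BB :: "'r endo set" where
  "BB = {a \<in> M. \<forall>i<n. \<forall>j<n. j < i \<longrightarrow> ent a i j = 0}"

definition UU :: "'r endo set" where
  "UU = {u \<in> M. u - 1 \<in> NN}"

lemma NN_I: "a \<in> M \<Longrightarrow> (\<And>i j. i < n \<Longrightarrow> j < n \<Longrightarrow> j \<le> i \<Longrightarrow> ent a i j = 0) \<Longrightarrow> a \<in> NN"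
  and NN_D: "a \<in> NN \<Longrightarrow> i < n \<Longrightarrow> j < n \<Longrightarrow> j \<le> i \<Longrightarrow> ent a i j = 0"
  and BB_I: "a \<in> M \<Longrightarrow> (\<And>i j. i < n \<Longrightarrow> j < n \<Longrightarrow> j < i \<Longrightarrow> ent a i j = 0) \<Longrightarrow> a \<in> BB"
  and BB_D: "a \<in> BB \<Longrightarrow> i < n \<Longrightarrow> j < n \<Longrightarrow> j < i \<Longrightarrow> ent a i j = 0"
  and UU_I: "u \<in> M \<Longrightarrow> u - 1 \<in> NN \<Longrightarrow> u \<in> UU"
  and UU_D: "u \<in> UU \<Longrightarrow> u - 1 \<in> NN"
  by (auto simp: NN_def BB_def UU_def)

lemma NN_M [simp]: "a \<in> NN \<Longrightarrow> a \<in> M" and BB_M [simp]: "a \<in> BB \<Longrightarrow> a \<in> M"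
  and UU_M [simp]: "u \<in> UU \<Longrightarrow> u \<in> M"
  by (auto simp: NN_def BB_def UU_def)

lemma NN_BB: "a \<in> NN \<Longrightarrow> a \<in> BB"
  by (rule BB_I) (simp_all add: NN_D)

lemma BB_1 [simp]: "1 \<in> BB" by (rule BB_I) (simp_all add: ent_1)

lemma BB_add [simp]: "a \<in> BB \<Longrightarrow> b \<in> BB \<Longrightarrow> a + b \<in> BB"
  by (rule BB_I) (simp_all add: BB_D)

lemma NN_0 [simp]: "0 \<in> NN"
  and NN_add [simp]: "a \<in> NN \<Longrightarrow> b \<in> NN \<Longrightarrow> a + b \<in> NN"
  and NN_uminus [simp]: "a \<in> NN \<Longrightarrow> - a \<in> NN"
  and NN_sc [simp]: "a \<in> NN \<Longrightarrow> sc c * a \<in> NN"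
  by (rule NN_I; simp add: NN_D)+

lemma BB_NN_mult [simp]: assumes "a \<in> BB" "b \<in> NN" shows "a * b \<in> NN"
proof (rule NN_I)
  fix i j assume ij: "i < n" "j < n" "j \<le> i"
  have "ent a i k * ent b k j = 0" if "k < n" for k
    using assms ij that by (cases "k < i") (simp_all add: BB_D NN_D)
  with assms ij show "ent (a * b) i j = 0" by (simp add: ent_mult)
qed (use assms in simp)

lemma NN_BB_mult [simp]: assumes "a \<in> NN" "b \<in> BB" shows "a * b \<in> NN"
proof (rule NN_I)
  fix i j assume ij: "i < n" "j < n" "j \<le> i"
  have "ent a i k * ent b k j = 0" if "k < n" for k
    using assms ij that by (cases "j < k") (simp_all add: BB_D NN_D)
  with assms ij show "ent (a * b) i j = 0" by (simp add: ent_mult)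
qed (use assms in simp)

lemma NN_power: "a \<in> NN \<Longrightarrow> i < n \<Longrightarrow> j < n \<Longrightarrow> j < i + k \<Longrightarrow> ent (a ^ k) i j = 0"
proof (induction k arbitrary: i)
  case (Suc k)
  have "ent a i q * ent (a ^ k) q j = 0" if "q < n" for q
    using Suc that by (cases "i < q") (simp_all add: NN_D)
  with Suc show ?case by (simp add: ent_mult)
qed (simp add: ent_1)

lemma NN_nilpotent: "a \<in> NN \<Longrightarrow> a ^ n = 0"
  by (rule M_eqI) (auto intro: NN_power)

lemma one_plus_NN [simp]: "a \<in> NN \<Longrightarrow> 1 + a \<in> UU"
  by (rule UU_I) simp_all

lemma UU_E: assumes "u \<in> UU" obtains a where "a \<in> NN" "u = 1 + a"
proof
  show "u - 1 \<in> NN" using assms by (rule UU_D)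
  show "u = 1 + (u - 1)" by simp
qed

lemma UU_BB: "u \<in> UU \<Longrightarrow> u \<in> BB"
  by (erule UU_E) (simp add: NN_BB)

lemma UU_1 [simp]: "1 \<in> UU" by (rule UU_I) simp_all

lemma UU_mult [simp]: "u \<in> UU \<Longrightarrow> v \<in> UU \<Longrightarrow> u * v \<in> UU"
proof -
  assume uv: "u \<in> UU" "v \<in> UU"
  have "u * v - 1 = u * (v - 1) + (u - 1)" by (simp add: algebra_simps)
  also have "\<dots> \<in> NN" using uv UU_BB[of u] by (simp add: UU_D)
  finally show ?thesis using uv by (simp add: UU_I)
qed

lemma UU_GL_iv: assumes "u \<in> UU" shows "u \<in> GL" "iv u \<in> UU"
proof -
  define a where "a = 1 - u"
  have "- a \<in> NN" using assms by (simp add: a_def UU_D)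
  then have a: "a \<in> NN" using NN_uminus by fastforce
  have u: "u = 1 - a" by (simp add: a_def)
  show "u \<in> GL" using nilpotent_GL(1)[OF NN_M[OF a] NN_nilpotent[OF a]] u by simp
  have N: "a ^ Suc k \<in> NN" for k
    by (induction k) (use a NN_BB[OF a] in auto)
  have "(\<Sum>i<Suc k. a ^ i) \<in> UU" for k
  proof (induction k)
    case (Suc k)
    have "(\<Sum>i<Suc (Suc k). a ^ i) - 1 = ((\<Sum>i<Suc k. a ^ i) - 1) + a ^ Suc k"
      by (simp only: sum.lessThan_Suc algebra_simps)
    also have "\<dots> \<in> NN" using Suc N by (intro NN_add UU_D)
    finally have "(\<Sum>i<Suc (Suc k). a ^ i) - 1 \<in> NN" .
    moreover have "(\<Sum>i<Suc (Suc k). a ^ i) \<in> M" using a by (intro M_sum M_power) simp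
    ultimately show ?case by (rule UU_I[rotated])
  qed simp
  from this[of "n - 1"] n_pos have "(\<Sum>i<n. a ^ i) \<in> UU" by simp
  then show "iv u \<in> UU" using nilpotent_GL(2)[OF NN_M[OF a] NN_nilpotent[OF a]] u by simp
qed

lemma UU_GL [simp]: "u \<in> UU \<Longrightarrow> u \<in> GL" and UU_iv [simp]: "u \<in> UU \<Longrightarrow> iv u \<in> UU"
  using UU_GL_iv by simp_all

lemma UU_conj_NN [simp]: "u \<in> UU \<Longrightarrow> a \<in> NN \<Longrightarrow> u * a * iv u \<in> NN" "u \<in> UU \<Longrightarrow> a \<in> NN \<Longrightarrow> iv u * a * u \<in> NN"
  using UU_BB[of u] UU_BB[of "iv u"] by auto

lemma finite_UU [simp]: "finite UU" and finite_NN [simp]: "finite NN"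
  by (rule finite_subset[OF _ finite_M], simp add: subset_iff)+

end

section \<open>The affine space of regular elements\<close>

text \<open>Scaled congruence: for \<open>z = t ^ m\<close> in a truncated valuation ring of length l it is
 congruence modulo \<open>t ^ (l - m)\<close>.\<close>

definition cg :: "'r::comm_ring_1 \<Rightarrow> 'r endo \<Rightarrow> 'r endo \<Rightarrow> bool" where
  "cg z a b \<longleftrightarrow> sc z * a = sc z * b"

lemma cg_refl [simp]: "cg z a a" by (simp add: cg_def)
lemma cg_sym: "cg z a b \<Longrightarrow> cg z b a" by (simp add: cg_def)
lemma cg_trans [trans]: "cg z a b \<Longrightarrow> cg z b d \<Longrightarrow> cg z a d" by (simp add: cg_def)
lemma cg_eq_trans [trans]: "cg z a b \<Longrightarrow> b = d \<Longrightarrow> cg z a d" "a = b \<Longrightarrow> cg z b d \<Longrightarrow> cg z a d" by simp_all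
lemma cg_add: "cg z a b \<Longrightarrow> cg z a' b' \<Longrightarrow> cg z (a + a') (b + b')"
  and cg_diff: "cg z a b \<Longrightarrow> cg z a' b' \<Longrightarrow> cg z (a - a') (b - b')"
  by (simp_all add: cg_def distrib_left right_diff_distrib)
lemma cg_mult: assumes "cg z a b" "cg z a' b'" shows "cg z (a * a') (b * b')"
proof -
  have "sc z * (a * a') = sc z * b * a'"
    using assms(1) by (simp add: cg_def flip: mult.assoc)
  also have "\<dots> = b * (sc z * a')" by (simp only: mult.assoc sc_left_commute[of b])
  also have "\<dots> = sc z * (b * b')" using assms(2) by (simp only: cg_def sc_left_commute[of b])
  finally show ?thesis by (simp add: cg_def)
qed
lemma cg_sc: "cg z a b \<Longrightarrow> cg z (sc d * a) (sc d * b)" by (rule cg_mult) simp_all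
lemma cg_ent: "cg z a b \<Longrightarrow> z * ent a i j = z * ent b i j"
  unfolding cg_def by (metis ent_sc_mult)
lemma cg_diff_0: "cg z a b \<longleftrightarrow> cg z (a - b) 0"
  by (simp add: cg_def right_diff_distrib)

lemma cg_power: "cg z a b \<Longrightarrow> cg z (a ^ k) (b ^ k)"
  by (induction k) (simp_all add: cg_mult)

context matrix_ring begin

lemma cg_I: "a \<in> M \<Longrightarrow> b \<in> M \<Longrightarrow> (\<And>i j. i < n \<Longrightarrow> j < n \<Longrightarrow> z * ent a i j = z * ent b i j) \<Longrightarrow> cg z a b"
  unfolding cg_def by (rule M_eqI) simp_all

lemma cg_tr: "cg z a b \<Longrightarrow> z * tr a = z * tr b"
  unfolding cg_def by (metis tr_sc_mult)

end

definition pol :: "'r::comm_ring_1 endo \<Rightarrow> nat \<Rightarrow> (nat \<Rightarrow> 'r) \<Rightarrow> 'r endo" where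
  "pol x k a = (\<Sum>i<k. sc (a i) * x ^ i)"

lemma pol_commute: assumes "y * x = x * y" shows "y * pol x k a = pol x k a * y"
proof -
  have c: "y * x ^ i = x ^ i * y" for i
  proof (induction i)
    case (Suc i)
    have "y * x ^ Suc i = x * (y * x ^ i)" using assms by (simp flip: mult.assoc)
    then show ?case by (simp add: Suc mult.assoc)
  qed simp
  show ?thesis unfolding pol_def sum_distrib_left sum_distrib_right
    by (rule sum.cong) (simp_all add: sc_left_commute[of y] c mult.assoc)
qed

context trunc begin

lemma cg_0_div: "i \<le> l \<Longrightarrow> a \<in> M \<Longrightarrow> b \<in> M \<Longrightarrow> cg (t ^ i) a b \<Longrightarrow> \<exists>y\<in>M. a = b + sc (t ^ (l - i)) * y"
proof -
  assume "i \<le> l" "a \<in> M" "b \<in> M" "cg (t ^ i) a b"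
  then obtain y where "y \<in> M" "a - b = sc (t ^ (l - i)) * y"
    using sc_t_div[of i "a - b"] by (auto simp: cg_def right_diff_distrib)
  then show ?thesis by (intro bexI[of _ y]) (simp_all add: algebra_simps)
qed

lemma cg_plus_t: "l \<le> i + k \<Longrightarrow> cg (t ^ i) (a + sc (t ^ k) * y) a"
  by (simp add: cg_def distrib_left sc_sc sc_t_0 flip: power_add)

lemma cg_iv: assumes "cg z (a * b) (b' * a)" "a \<in> GL" shows "cg z (iv a * b') (b * iv a)"
proof -
  have "iv a * b' = iv a * (b' * a) * iv a" using assms(2) by (simp add: mult.assoc)
  also have "cg z \<dots> (iv a * (a * b) * iv a)" by (rule cg_mult[OF cg_mult[OF cg_refl cg_sym[OF assms(1)]] cg_refl])
  also have "\<dots> = b * iv a" using assms(2) by (simp add: mult.assoc)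
  finally show ?thesis .
qed

lemma K_iv: assumes "1 \<le> i" "y \<in> M"
  obtains y' where "y' \<in> M" "iv (1 + sc (t ^ i) * y) = 1 + sc (t ^ i) * y'"
proof
  let ?k = "1 + sc (t ^ i) * y"
  have k: "?k \<in> GL" using assms by simp
  show "- (y * iv ?k) \<in> M" using assms k by simp
  have "?k * iv ?k = 1" using k by (rule iv_cancel)
  then show "iv ?k = 1 + sc (t ^ i) * - (y * iv ?k)"
    by (simp add: distrib_right mult.assoc algebra_simps)
qed

lemma BB_NN_tr: "b \<in> BB \<Longrightarrow> a \<in> NN \<Longrightarrow> tr (b * a) = 0"
  using BB_NN_mult[of b a] by (simp add: tr_def NN_D)

text \<open>Under the trace form the annihilator of the strictly upper triangular matrices consists
  of the upper triangular ones, as the matrices \<open>Em j i\<close> with j < i show. In this way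
  equivariance under U becomes membership in f + b.\<close>

lemma NN_orthogonal:
  assumes w: "w \<in> M" and "\<And>a. a \<in> NN \<Longrightarrow> phi (z * tr (w * a)) = 1" and ij: "i < n" "j < n" "j < i"
  shows "z * ent w i j = 0"
proof (rule phi_nondegenerate)
  fix a
  have "sc a * Em j i \<in> NN" by (rule NN_I) (use ij in \<open>auto simp: ent_Em\<close>)
  from assms(2)[OF this] have "phi (z * (a * ent w i j)) = 1"
    using w ij by (simp add: sc_left_commute[of w] tr_sc_mult tr_mult_Em)
  then show "phi (z * ent w i j * a) = 1" by (simp add: ac_simps)
qed

end

locale trunc_c = trunc n t l p phi for n and t :: "'r::{comm_ring_1,finite}" and l p phi +
  fixes c :: "nat \<Rightarrow> 'r"
  assumes c_unit: "c i dvd 1"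
begin

definition ff :: "'r endo" where
  "ff = mt (\<lambda>i j. if i = Suc j then c j else 0)"

definition XX :: "'r endo set" where
  "XX = {x \<in> M. x - ff \<in> BB}"

text \<open>The trace form gives theta the same shape as the characters \<open>phi_x\<close>, so
  that the two can be compared on congruence subgroups. Only the superdiagonal of u meets the
  subdiagonal of \<open>ff\<close>.\<close>

definition theta :: "'r endo \<Rightarrow> complex" where
  "theta u = phi (tr (ff * u))"

lemma ff_M [simp]: "ff \<in> M" by (simp add: ff_def)

lemma ent_ff: "i < n \<Longrightarrow> j < n \<Longrightarrow> ent ff i j = (if i = Suc j then c j else 0)"
  by (simp add: ff_def ent_mt)

lemma ent_mult_ff: "a \<in> M \<Longrightarrow> i < n \<Longrightarrow> j < n \<Longrightarrow> ent (a * ff) i j = (if Suc j < n then ent a i (Suc j) * c j else 0)"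
  by (simp add: ent_mult ent_ff if_distrib cong: if_cong)

lemma ent_ff_mult: "a \<in> M \<Longrightarrow> i < n \<Longrightarrow> j < n \<Longrightarrow> ent (ff * a) i j = (case i of 0 \<Rightarrow> 0 | Suc k \<Rightarrow> c k * ent a k j)"
  by (cases i) (auto simp add: ent_mult ent_ff if_distrib if_distribR cong: if_cong)

lemma XX_I: "x \<in> M \<Longrightarrow> x - ff \<in> BB \<Longrightarrow> x \<in> XX"
  and XX_D: "x \<in> XX \<Longrightarrow> x - ff \<in> BB"
  by (auto simp: XX_def)

lemma XX_M [simp]: "x \<in> XX \<Longrightarrow> x \<in> M"
  by (auto simp: XX_def)

lemma theta_phi: "theta u = phi (\<Sum>i<n - 1. c i * ent u i (Suc i))" if "u \<in> M"
proof -
  have "tr (ff * u) = (\<Sum>i<n. case i of 0 \<Rightarrow> 0 | Suc k \<Rightarrow> c k * ent u k i)"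
    using that by (simp add: tr_def ent_ff_mult)
  also have "\<dots> = (\<Sum>i<Suc (n - 1). case i of 0 \<Rightarrow> 0 | Suc k \<Rightarrow> c k * ent u k i)"
    using n_pos by simp
  also have "\<dots> = (\<Sum>i<n - 1. c i * ent u i (Suc i))"
    by (subst sum.lessThan_Suc_shift) simp
  finally show ?thesis by (simp add: theta_def)
qed

lemma tr_ff: "tr ff = 0"
  by (simp add: tr_def ent_ff)

lemma NN_ff [simp]: "a \<in> NN \<Longrightarrow> a * ff \<in> BB" "a \<in> NN \<Longrightarrow> ff * a \<in> BB"
  by (rule BB_I; auto simp: ent_mult_ff ent_ff_mult NN_D split: nat.split)+

lemma tr_XX_NN: "x \<in> XX \<Longrightarrow> a \<in> NN \<Longrightarrow> tr (x * a) = tr (ff * a)"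
  using BB_NN_tr[OF XX_D, of x a] by (simp add: left_diff_distrib tr_diff)

lemma theta_one_plus: "theta (1 + a) = phi (tr (ff * a))"
  by (simp add: theta_def distrib_left tr_add tr_ff)

lemma theta_mult: assumes "u \<in> UU" "v \<in> UU" shows "theta (u * v) = theta u * theta v"
proof -
  obtain a b where ab: "a \<in> NN" "u = 1 + a" "b \<in> NN" "v = 1 + b"
    using assms by (elim UU_E)
  have "ff * (u * v) = ff * u + ff * v + ff * a * b - ff"
    unfolding ab by (simp add: algebra_simps)
  moreover have "tr (ff * a * b) = 0" using ab by (intro BB_NN_tr) simp_all
  ultimately show ?thesis by (simp add: theta_def tr_add tr_diff tr_ff phi_add)
qed

lemma theta_1: "theta 1 = 1" by (simp add: theta_def tr_ff phi_0)

lemma theta_iv: "u \<in> UU \<Longrightarrow> theta (iv u) * theta u = 1" "u \<in> UU \<Longrightarrow> theta u * theta (iv u) = 1"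
  using theta_mult[of "iv u" u] theta_mult[of u "iv u"] by (simp_all add: theta_1)

lemma ent_mult_XX:
  assumes "x \<in> XX" "a \<in> M" "i < n" "Suc j < n"
  shows "ent (a * x) i j = ent a i (Suc j) * c j + (\<Sum>k<n. ent a i k * ent (x - ff) k j)"
proof -
  have "a * x = a * ff + a * (x - ff)" by (simp add: algebra_simps)
  then have "ent (a * x) i j = ent (a * ff) i j + ent (a * (x - ff)) i j" by simp
  then show ?thesis using assms XX_D[OF assms(1)] by (simp add: ent_mult_ff ent_mult[of a "x - ff"])
qed

lemma ent_XX_mult:
  assumes "x \<in> XX" "a \<in> M" "Suc i < n" "j < n"
  shows "ent (x * a) (Suc i) j = c i * ent a i j + (\<Sum>k<n. ent (x - ff) (Suc i) k * ent a k j)"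
proof -
  have "x * a = ff * a + (x - ff) * a" by (simp add: algebra_simps)
  then have "ent (x * a) (Suc i) j = ent (ff * a) (Suc i) j + ent ((x - ff) * a) (Suc i) j" by simp
  then show ?thesis using assms XX_D[OF assms(1)] by (simp add: ent_ff_mult ent_mult[of "x - ff" a])
qed

text \<open>Comparing the entries (i, j - 1) of \<open>a * x\<close> and \<open>x' * a\<close>
  relates \<open>c (j - 1)\<close> times the entry (i, j) of a to \<open>c (i - 1)\<close> times the
  entry (i - 1, j - 1); all other contributions are entries already known to vanish. So the first
  column decides the lower triangle. The relation is assumed only below the diagonal because it is
  later applied to a matrix whose commutator with x is merely upper triangular. With d = z the
  result is unitriangular, with d = 0 strictly upper triangular, up to the scaling.\<close>

lemma triangular_intertwiner:
  assumes x: "x \<in> XX" "x' \<in> XX" and a: "a \<in> M"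
    and ax: "\<And>i j. i < n \<Longrightarrow> j < i \<Longrightarrow> z * ent (a * x) i j = z * ent (x' * a) i j"
    and a0: "\<And>i. i < n \<Longrightarrow> z * ent a i 0 = (if i = 0 then d else 0)"
  shows "i < n \<Longrightarrow> j < n \<Longrightarrow> j \<le> i \<Longrightarrow> z * ent a i j = (if i = j then d else 0)"
proof (induction j arbitrary: i rule: less_induct)
  case (less j)
  show ?case
  proof (cases j)
    case 0 with a0 less show ?thesis by simp
  next
    case (Suc j')
    obtain i' where i: "i = Suc i'" using less.prems Suc by (cases i) simp_all
    have s1: "z * (\<Sum>k<n. ent a i k * ent (x - ff) k j') = 0"
      unfolding sum_distrib_left
    proof (rule sum.neutral, safe)
      fix k assume k: "k < n"
      show "z * (ent a i k * ent (x - ff) k j') = 0"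
      proof (cases "k \<le> j'")
        case True
        then have "z * ent a i k = 0" using less.IH[of k i] less.prems Suc k by simp
        then show ?thesis by (simp only: mult.assoc[symmetric] mult_zero_left)
      next
        case False
        then have "ent (x - ff) k j' = 0" using less.prems Suc k by (intro BB_D[OF XX_D[OF x(1)]]) simp_all
        then show ?thesis by (simp only: mult_zero_right)
      qed
    qed
    have s2: "z * (\<Sum>k<n. ent (x' - ff) i k * ent a k j') = 0"
      unfolding sum_distrib_left
    proof (rule sum.neutral, safe)
      fix k assume k: "k < n"
      show "z * (ent (x' - ff) i k * ent a k j') = 0"
      proof (cases "k < i")
        case False
        then have "z * ent a k j' = 0" using less.IH[of j' k] less.prems Suc k by simp
        then show ?thesis by (metis mult.left_commute mult_zero_right)
      next
        case True
        then have "ent (x' - ff) i k = 0" using less.prems k by (intro BB_D[OF XX_D[OF x(2)]]) simp_all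
        then show ?thesis by (simp only: mult_zero_left mult_zero_right)
      qed
    qed
    have "z * ent (a * x) i j' = z * ent (x' * a) i j'" using less.prems Suc by (intro ax) simp_all
    then have e: "z * (c j' * ent a i j) = z * (c i' * ent a i' j')"
      using ent_mult_XX[OF x(1) a, of i j'] ent_XX_mult[OF x(2) a, of i' j'] less.prems Suc i s1 s2
      by (simp add: distrib_left mult.commute)
    have d: "z * ent a i' j' = (if i' = j' then d else 0)" using less.IH[of j' i'] less.prems Suc i by simp
    have "1 * (c j' * (z * ent a i j - (if i = j then d else 0))) = 0"
      using e d i Suc by (auto simp: right_diff_distrib mult.left_commute[of z])
    from dvd_one_cancel[OF c_unit this] show ?thesis by simp
  qed
qed

text \<open>The first basis vector is cyclic for x, so whatever commutes with x is determined by its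
  first column: each further column of a is recovered from the previous ones through
  \<open>a * x = x * a\<close>.\<close>

lemma commutant_XX:
  assumes x: "x \<in> XX" and a: "a \<in> M" "cg z (a * x) (x * a)"
    and a0: "\<And>i. i < n \<Longrightarrow> z * ent a i 0 = 0"
  shows "cg z a 0"
proof (rule cg_I)
  have "j < n \<Longrightarrow> i < n \<Longrightarrow> z * ent a i j = 0" for i j
  proof (induction j arbitrary: i rule: less_induct)
    case (less j)
    show ?case
    proof (cases j)
      case 0 with a0 less show ?thesis by simp
    next
      case (Suc j')
      have s1: "z * (\<Sum>k<n. ent a i k * ent (x - ff) k j') = 0"
        unfolding sum_distrib_left
      proof (rule sum.neutral, safe)
        fix k assume k: "k < n"
        show "z * (ent a i k * ent (x - ff) k j') = 0"
        proof (cases "k \<le> j'")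
          case True
          then have "z * ent a i k = 0" using less.IH[of k i] less.prems Suc k by simp
          then show ?thesis by (simp only: mult.assoc[symmetric] mult_zero_left)
        next
          case False
          then have "ent (x - ff) k j' = 0" using less.prems Suc k by (intro BB_D[OF XX_D[OF x]]) simp_all
          then show ?thesis by (simp only: mult_zero_right)
        qed
      qed
      have "z * ent (x * a) i j' = (\<Sum>k<n. ent x i k * (z * ent a k j'))"
        using x a less.prems Suc by (simp add: ent_mult sum_distrib_left mult.left_commute)
      also have "\<dots> = 0" using less.IH[of j'] less.prems Suc by simp
      finally have "z * ent (a * x) i j' = 0" using cg_ent[OF a(2)] by simp
      then have "z * (c j' * ent a i j) = 0"
        using ent_mult_XX[OF x a(1), of i j'] less.prems Suc s1
        by (simp add: distrib_left mult.commute)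
      then show ?thesis by (rule dvd_one_cancel[OF c_unit])
    qed
  qed
  then show "z * ent a i j = z * ent 0 i j" if "i < n" "j < n" for i j using that by simp
qed (use a in simp_all)

text \<open>Each factor x moves the lowest nonzero entry of the column one row down and multiplies
  it by a unit. The powers of x applied to the first basis vector thus form a triangular
  basis.\<close>

lemma XX_power_col:
  assumes x: "x \<in> XX"
  shows "k < n \<Longrightarrow> ent (x ^ k) k 0 dvd 1 \<and> (\<forall>i<n. k < i \<longrightarrow> ent (x ^ k) i 0 = 0)"
proof (induction k)
  case (Suc k)
  have IH: "ent (x ^ k) k 0 dvd 1" "\<And>i. i < n \<Longrightarrow> k < i \<Longrightarrow> ent (x ^ k) i 0 = 0"
    using Suc by auto
  have *: "ent (x ^ Suc k) (Suc i) 0 = c i * ent (x ^ k) i 0" if "Suc i < n" "k \<le> i" for i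
  proof -
    have "ent (x - ff) (Suc i) q * ent (x ^ k) q 0 = 0" if q: "q < n" for q
    proof (cases "q < Suc i")
      case True
      then show ?thesis using BB_D[OF XX_D[OF x] \<open>Suc i < n\<close> q] by simp
    next
      case False
      then show ?thesis using IH(2)[OF q] \<open>k \<le> i\<close> by simp
    qed
    then have "(\<Sum>q<n. ent (x - ff) (Suc i) q * ent (x ^ k) q 0) = 0" by (simp del: ent_diff)
    then show ?thesis using ent_XX_mult[OF x M_power[OF XX_M[OF x]] that(1) n_pos, of k] by simp
  qed
  have "ent (x ^ Suc k) (Suc k) 0 dvd 1"
    using *[of k] Suc.prems IH(1) c_unit[of k] by (simp add: is_unit_mult_iff)
  moreover have "ent (x ^ Suc k) i 0 = 0" if "i < n" "Suc k < i" for i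
    using *[of "i - 1"] that IH(2)[of "i - 1"] by (cases i) simp_all
  ultimately show ?case by blast
qed (simp add: ent_1)

lemma pol_col:
  assumes x: "x \<in> XX"
  shows "k \<le> n \<Longrightarrow> (\<And>i. i < n \<Longrightarrow> k \<le> i \<Longrightarrow> v i = 0) \<Longrightarrow> \<exists>a. \<forall>i<n. ent (pol x k a) i 0 = v i"
proof (induction k arbitrary: v)
  case (Suc k)
  have k: "k < n" using Suc.prems by simp
  from XX_power_col[OF x k] obtain d where d: "1 = ent (x ^ k) k 0 * d"
    and z: "\<And>i. i < n \<Longrightarrow> k < i \<Longrightarrow> ent (x ^ k) i 0 = 0" by (auto elim: dvdE)
  \<comment> \<open>What remains of v once the coefficient of \<open>x ^ k\<close> is chosen to
    match row k; d inverts the unit found there.\<close>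
  define v' where "v' i = v i - d * v k * ent (x ^ k) i 0" for i
  have "v' i = 0" if "i < n" "k \<le> i" for i
  proof (cases "i = k")
    case True
    have "d * v k * ent (x ^ k) k 0 = v k * (ent (x ^ k) k 0 * d)" by (simp only: ac_simps)
    then show ?thesis using d True by (simp add: v'_def)
  next
    case False
    with that Suc.prems z show ?thesis by (simp add: v'_def)
  qed
  then obtain a where a: "\<And>i. i < n \<Longrightarrow> ent (pol x k a) i 0 = v' i" using Suc.IH[of v'] k by auto
  have "pol x (Suc k) (a(k := d * v k)) = pol x k a + sc (d * v k) * x ^ k"
    by (simp add: pol_def)
  then have "\<forall>i<n. ent (pol x (Suc k) (a(k := d * v k))) i 0 = v i"
    using a by (simp add: v'_def)
  then show ?case by blast
qed (simp add: pol_def)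

definition RX :: "'r endo \<Rightarrow> 'r endo set" where
  "RX x = range (pol x n)"

lemma RX_col: "x \<in> XX \<Longrightarrow> \<exists>q\<in>RX x. \<forall>i<n. ent q i 0 = v i"
  using pol_col[of x n v] by (auto simp: RX_def)

lemma RX_M [simp]: "q \<in> RX x \<Longrightarrow> x \<in> XX \<Longrightarrow> q \<in> M"
  by (auto simp: RX_def pol_def)

lemma RX_commute: "q \<in> RX x \<Longrightarrow> y * x = x * y \<Longrightarrow> y * q = q * y"
  by (auto simp: RX_def pol_commute)

lemma RX_commute_self: "q \<in> RX x \<Longrightarrow> x * q = q * x"
  by (rule RX_commute) simp_all

text \<open>If the polynomial q in x has the same first column as g, then \<open>iv g * q\<close> intertwines and fixes
 the first basis vector, so it is unitriangular modulo \<open>t ^ (l - i)\<close>.\<close>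

lemma intertwiner_decomposition:
  assumes x: "x \<in> XX" "x' \<in> XX" and g: "g \<in> GL" and i: "i < l" and c: "cg (t ^ i) (x * g) (g * x')"
  obtains q u y where "q \<in> RX x" "q \<in> GL" "u \<in> UU" "y \<in> M"
    "g = (1 + sc (t ^ (l - i)) * y) * q * u" "cg (t ^ i) (u * x') (x * u)"
proof -
  let ?z = "t ^ i" and ?K = "t ^ (l - i)"
  obtain q where q: "q \<in> RX x" "\<forall>i<n. ent q i 0 = ent g i 0"
    using RX_col[OF x(1), of "\<lambda>i. ent g i 0"] by blast
  have qM: "q \<in> M" using q x by simp
  define a where "a = iv g * q"
  have aM: "a \<in> M" using qM g by (simp add: a_def)
  have c': "cg ?z (iv g * x) (x' * iv g)" by (rule cg_iv[OF cg_sym[OF c] g])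
  have "a * x = iv g * x * q" using RX_commute_self[OF q(1)] by (simp add: a_def mult.assoc)
  also have "cg ?z \<dots> (x' * iv g * q)" by (rule cg_mult[OF c' cg_refl])
  also have "\<dots> = x' * a" by (simp add: a_def mult.assoc)
  finally have ax: "cg ?z (a * x) (x' * a)" .
  have a0: "ent a k 0 = (if k = 0 then 1 else 0)" if "k < n" for k
  proof -
    have "ent a k 0 = ent (iv g * g) k 0"
      unfolding a_def using that q g qM n_pos by (subst (1 2) ent_mult) simp_all
    then show ?thesis using g by (simp add: ent_1)
  qed
  have tri: "?z * ent a k j = (if k = j then ?z else 0)" if "k < n" "j < n" "j \<le> k" for k j
    by (rule triangular_intertwiner[OF x aM cg_ent[OF ax] _ that]) (simp add: a0)
  define v where "v = mt (\<lambda>k j. if j \<le> k then (if k = j then 1 else 0) else ent a k j)"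
  have v: "v \<in> UU" by (rule UU_I) (auto simp: v_def intro!: NN_I simp: ent_mt ent_1)
  have av: "cg ?z a v" by (rule cg_I) (use aM tri in \<open>auto simp: v_def ent_mt\<close>)
  obtain y where y: "y \<in> M" "a = v + sc ?K * y"
    using cg_0_div[OF less_imp_le[OF i] aM UU_M[OF v] av] by blast
  have K1: "1 \<le> l - i" using i by simp
  have a_fact: "a = v * (1 + sc ?K * (iv v * y))"
    using v y by (simp add: distrib_left sc_left_commute[of v])
  have kM: "iv v * y \<in> M" using v y by simp
  have kG: "1 + sc ?K * (iv v * y) \<in> GL" using K1 kM by simp
  obtain y' where y': "y' \<in> M" "iv (1 + sc ?K * (iv v * y)) = 1 + sc ?K * y'"
    using K_iv[OF K1 kM] by blast
  have aG: "a \<in> GL" using a_fact kG v by simp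
  have iva: "iv a = (1 + sc ?K * y') * iv v" using a_fact kG v y' by (simp add: iv_mult)
  have qg: "q = g * a" using g by (simp add: a_def)
  then have qG: "q \<in> GL" using g aG by simp
  have "g = q * iv a" using qg aG by (simp add: mult.assoc)
  also have "\<dots> = (1 + sc ?K * (q * y' * iv q)) * q * iv v"
    using qG by (simp add: iva distrib_left distrib_right mult.assoc sc_left_commute[of q])
  finally have ge: "g = (1 + sc ?K * (q * y' * iv q)) * q * iv v" .
  have "cg ?z (v * x) (x' * v)"
    using cg_trans[OF cg_mult[OF cg_sym[OF av] cg_refl] cg_trans[OF ax cg_mult[OF cg_refl av]]] .
  then have "cg ?z (iv v * x') (x * iv v)" by (rule cg_iv) (use v in simp)
  with q(1) qG v y'(1) ge that[of q "iv v" "q * y' * iv q"] show ?thesis by simp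
qed

end

section \<open>Twisted averages over congruence subgroups\<close>

text \<open>S has one expression for every s in H. Adding these and exchanging the sums,
  orthogonality removes each y whose character of H is nontrivial. In the applications s comes from
  a change of variables in a sum over \<open>K^r\<close>, so S does not depend on it.\<close>

lemma average_over_characters:
  fixes psi :: "'y \<Rightarrow> complex" and chi :: "'y \<Rightarrow> 'a::group_add \<Rightarrow> complex"
  assumes fin: "finite H" "finite Y" and ne: "H \<noteq> {}"
    and add: "\<And>s s'. s \<in> H \<Longrightarrow> s' \<in> H \<Longrightarrow> s + s' \<in> H"
    and hom: "\<And>y s s'. y \<in> Y \<Longrightarrow> s \<in> H \<Longrightarrow> s' \<in> H \<Longrightarrow> chi y (s + s') = chi y s * chi y s'"
    and S: "\<And>s. s \<in> H \<Longrightarrow> S = (\<Sum>y\<in>Y. psi y * chi y s)"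
  shows "S = (\<Sum>y\<in>{y\<in>Y. \<forall>s\<in>H. chi y s = 1}. psi y)"
proof -
  have "of_nat (card H) * S = (\<Sum>s\<in>H. S)" by simp
  also have "\<dots> = (\<Sum>s\<in>H. \<Sum>y\<in>Y. psi y * chi y s)"
    using S by (rule sum.cong[OF refl])
  also have "\<dots> = (\<Sum>y\<in>Y. \<Sum>s\<in>H. psi y * chi y s)" by (rule sum.swap)
  also have "\<dots> = (\<Sum>y\<in>Y. if \<forall>s\<in>H. chi y s = 1 then of_nat (card H) * psi y else 0)"
  proof (rule sum.cong[OF refl])
    fix y assume y: "y \<in> Y"
    show "(\<Sum>s\<in>H. psi y * chi y s) = (if \<forall>s\<in>H. chi y s = 1 then of_nat (card H) * psi y else 0)"
    proof (cases "\<forall>s\<in>H. chi y s = 1")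
      case False
      then obtain s where s: "s \<in> H" "chi y s \<noteq> 1" by blast
      have "(\<Sum>s\<in>H. chi y s) = 0"
        by (rule character_sum_zero[of H s]) (use fin s add hom[OF y] in auto)
      then show ?thesis unfolding if_not_P[OF False] by (simp flip: sum_distrib_left)
    qed simp
  qed
  also have "\<dots> = (\<Sum>y\<in>{y\<in>Y. \<forall>s\<in>H. chi y s = 1}. of_nat (card H) * psi y)"
    by (rule sum.inter_filter[symmetric, OF fin(2)])
  also have "\<dots> = of_nat (card H) * (\<Sum>y\<in>{y\<in>Y. \<forall>s\<in>H. chi y s = 1}. psi y)"
    by (simp add: sum_distrib_left)
  finally show ?thesis using fin(1) ne by simp
qed

text \<open>With r the lower and m the upper half of l: \<open>l \<le> 2 * m\<close> makes
  \<open>K^m\<close> abelian, \<open>m \<le> 2 * r\<close> places the commutators of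
  \<open>K^r\<close> in \<open>K^m\<close>, and \<open>l \<le> 3 * r\<close> makes them central in
  \<open>K^r\<close>.\<close>

lemma half_bounds:
  assumes "2 \<le> (l::nat)"
  shows "1 \<le> l div 2" "1 \<le> l - l div 2" "(l - l div 2) + l div 2 = l" "l div 2 + (l - l div 2) = l"
    "l \<le> 2 * (l - l div 2)" "l \<le> 2 * (l div 2) + l div 2" "l - l div 2 \<le> 2 * (l div 2)"
    "2 * (l div 2) \<le> l" "l div 2 \<le> l - l div 2" "l - (l - l div 2) = l div 2" "l - l div 2 \<le> l"
  using assms by auto

context trunc begin

definition rr :: nat where "rr = l div 2"
definition mm :: nat where "mm = l - l div 2"

lemmas rm = half_bounds[OF l2, folded rr_def mm_def]

abbreviation KK :: "'r endo \<Rightarrow> 'r endo" where "KK y \<equiv> 1 + sc (t ^ rr) * y"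
abbreviation LL :: "'r endo \<Rightarrow> 'r endo" where "LL y \<equiv> 1 + sc (t ^ mm) * y"
text \<open>The factor carried by commutators of \<open>K^r\<close>. It is 0 for even l and
  \<open>t ^ (l - 1)\<close> for odd l, so \<open>cg zz\<close> is an empty condition in the first
  case and congruence modulo t in the second.\<close>

abbreviation zz :: 'r where "zz \<equiv> t ^ (2 * rr)"

lemma KK_GL [simp]: "y \<in> M \<Longrightarrow> KK y \<in> GL" and LL_GL [simp]: "y \<in> M \<Longrightarrow> LL y \<in> GL"
  using rm by simp_all

lemma KK_iv: "y \<in> M \<Longrightarrow> \<exists>y'\<in>M. iv (KK y) = KK y'"
  using K_iv[OF rm(1), of y] by metis

lemma KK_mult: "KK y * KK z = KK (y * KK z + z)"
  by (simp add: algebra_simps sc_left_commute[of y] sc_sc)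

text \<open>Distinct parameters may give the same group element, so the translation is carried out
  on parameters, where \<open>y * KK z + z\<close> is a bijection of \<open>M\<close>.\<close>

lemma sum_KK:
  assumes "z \<in> M"
  shows "(\<Sum>y\<in>M. G (KK y)) = (\<Sum>y\<in>M. G (KK y * KK z))"
proof -
  have k: "KK z \<in> GL" using assms by simp
  have "(\<Sum>y\<in>M. G (KK (y * KK z + z))) = (\<Sum>y\<in>M. G (KK y))"
  proof (rule sum.reindex_bij_witness[of _ "\<lambda>y. (y - z) * iv (KK z)" "\<lambda>y. y * KK z + z"])
    fix y :: "'r endo" assume y: "y \<in> M"
    have "(y - z) * iv (KK z) * KK z + z = y" using k by (simp only: mult.assoc iv_cancel) simp
    then show "(y - z) * iv (KK z) * KK z + z = y" .
    have "(y * KK z + z - z) * iv (KK z) = y * (KK z * iv (KK z))" by (simp only: add_diff_cancel mult.assoc)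
    then show "(y * KK z + z - z) * iv (KK z) = y" using k by simp
    show "(y - z) * iv (KK z) \<in> M" using y assms k by (intro M_mult M_diff iv_M)
    show "y * KK z + z \<in> M" using y assms by simp
  qed simp
  then show ?thesis by (simp only: KK_mult)
qed

lemma conj_K: "q \<in> GL \<Longrightarrow> q * (1 + sc d * y) = (1 + sc d * (q * y * iv q)) * q"
  by (simp add: distrib_left distrib_right mult.assoc sc_left_commute[of q])

lemma K_conj: "q \<in> GL \<Longrightarrow> (1 + sc d * y) * q = q * (1 + sc d * (iv q * y * q))"
  by (simp add: distrib_left distrib_right mult.assoc sc_left_commute[of q])

lemma sc_zz_rr: "sc zz * (a * (sc (t ^ rr) * b)) = 0"
proof -
  have "sc zz * (a * (sc (t ^ rr) * b)) = sc (t ^ (2 * rr + rr)) * (a * b)"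
    by (simp only: sc_left_commute[of a] sc_sc power_add)
  then show ?thesis using rm by (simp add: sc_t_0)
qed

lemma zz_commute: "(1 + sc zz * e) * KK y = KK y * (1 + sc zz * e)"
  using sc_zz_rr[of e y] sc_zz_rr[of y e]
  by (simp add: algebra_simps sc_left_commute[of y] sc_sc sc_left_commute[of e] mult.commute)

text \<open>The commutator of two elements of \<open>K^r\<close>, obtained without inverses: terms
  with \<open>t ^ (3 * r)\<close> vanish, so multiplying \<open>KK z * KK y\<close> by the
  commutator only adds the bracket.\<close>

lemma KK_swap: "KK y * KK z = (1 + sc zz * (y * z - z * y)) * (KK z * KK y)"
proof -
  have e: "KK z * KK y = 1 + sc (t ^ rr) * (z + y + sc (t ^ rr) * (z * y))" for y z :: "'r endo"
    by (simp add: algebra_simps sc_left_commute[of z])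
  have "(1 + sc zz * (y * z - z * y)) * (KK z * KK y) = KK z * KK y + sc zz * (y * z - z * y)"
    unfolding e by (simp add: distrib_right distrib_left mult.assoc sc_zz_rr)
  also have "\<dots> = KK y * KK z"
    by (simp add: algebra_simps sc_left_commute[of y] sc_left_commute[of z] sc_sc power_mult power2_eq_square power_mult_distrib mult_2 power_add)
  finally show ?thesis by simp
qed

lemma zz_mm: "zz = t ^ mm * t ^ (2 * rr - mm)"
  using rm by (simp flip: power_add)

lemma GL_add_factor: "g \<in> GL \<Longrightarrow> g + sc d * u = g * (1 + sc d * (iv g * u))"
  by (simp add: distrib_left sc_left_commute[of g])

lemma iv_commute: assumes "g \<in> GL" "g * b = b * g" shows "b * iv g = iv g * b"
proof -
  have "b * iv g = iv g * (g * b) * iv g" using assms(1) by (simp add: mult.assoc)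
  also have "\<dots> = iv g * (b * g) * iv g" by (simp only: assms(2))
  also have "\<dots> = iv g * b" using assms(1) by (simp add: mult.assoc)
  finally show ?thesis .
qed

text \<open>For odd l the hypothesis makes w divisible by t, and r + 1 = m; for even l it is empty,
  and r = m.\<close>

lemma zz_mult_sc_div: fixes w :: "'r endo" assumes "w \<in> M" "cg zz w 0"
  obtains v where "v \<in> M" "sc (t ^ rr) * w = sc (t ^ mm) * v"
proof -
  obtain v where v: "v \<in> M" "w = sc (t ^ (l - 2 * rr)) * v"
    using cg_0_div[OF rm(8) assms(1) M_0 assms(2)] by auto
  have "rr + (l - 2 * rr) = mm" using rm by linarith
  then have "t ^ rr * t ^ (l - 2 * rr) = t ^ mm" by (simp only: power_add[symmetric])
  then have "sc (t ^ rr) * w = sc (t ^ mm) * v" by (simp only: v(2) sc_sc)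
  with v(1) show ?thesis using that by blast
qed

end

text \<open>\<open>Psi\<close> abstracts the component of a bi-equivariant function at the pair (x,
  x), and \<open>sg\<close> a conjugate of tau that fixes x. \<open>Psi_N\<close> is equivariance
  under U intersected with \<open>K^r\<close>; it is consistent with a fixed x because conjugation
  by \<open>K^r\<close> does not move x modulo the conductor. \<open>sg_Em\<close> supplies the rank
  one elements used for testing.\<close>

locale core = trunc_c n t l p phi c for n and t :: "'r::{comm_ring_1,finite}" and l p phi c +
  fixes x :: "'r endo" and sg :: "'r endo \<Rightarrow> 'r endo" and Psi :: "'r endo \<Rightarrow> complex"
  assumes x: "x \<in> XX"
    and sg_M [simp]: "a \<in> M \<Longrightarrow> sg a \<in> M"
    and sg_mult: "a \<in> M \<Longrightarrow> b \<in> M \<Longrightarrow> sg (a * b) = sg b * sg a"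
    and sg_add: "sg (a + b) = sg a + sg b"
    and sg_sc_mult: "sg (sc d * a) = sc d * sg a"
    and sg_1 [simp]: "sg 1 = 1"
    and sg_sg [simp]: "a \<in> M \<Longrightarrow> sg (sg a) = a"
    and sg_tr: "a \<in> M \<Longrightarrow> tr (sg a) = tr a"
    and sg_NN [simp]: "a \<in> NN \<Longrightarrow> sg a \<in> NN"
    and sg_x: "sg x = x"
    and sg_Em: "sg (Em 0 (n - 1)) = Em 0 (n - 1)"
    and Psi_L: "g \<in> GL \<Longrightarrow> y \<in> M \<Longrightarrow> Psi (LL y * g) = phi (t ^ mm * tr (x * y)) * Psi g"
    and Psi_L': "g \<in> GL \<Longrightarrow> y \<in> M \<Longrightarrow> Psi (g * LL y) = phi (t ^ mm * tr (x * y)) * Psi g"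
    and Psi_N: "g \<in> GL \<Longrightarrow> a \<in> NN \<Longrightarrow> Psi (KK a * g) = phi (t ^ rr * tr (ff * a)) * Psi g"
    and Psi_N': "g \<in> GL \<Longrightarrow> a \<in> NN \<Longrightarrow> Psi (g * KK a) = phi (t ^ rr * tr (ff * a)) * Psi g"
begin

lemma x_M [simp]: "x \<in> M" using x by simp

lemma sg_0: "sg 0 = 0"
  using sg_add[of 0 0] by simp

lemma sg_uminus: "sg (- a) = - sg a"
  using sg_add[of a "- a"] by (simp add: sg_0 eq_neg_iff_add_eq_0 add.commute)

lemma sg_K: "sg (1 + sc d * y) = 1 + sc d * sg y"
  by (simp add: sg_add sg_sc_mult)

lemma sg_GL [simp]: "a \<in> GL \<Longrightarrow> sg a \<in> GL" and sg_iv: "a \<in> GL \<Longrightarrow> sg (iv a) = iv (sg a)"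
proof -
  assume a: "a \<in> GL"
  have e: "sg a * sg (iv a) = 1" "sg (iv a) * sg a = 1"
    using a by (simp_all flip: sg_mult)
  show "sg a \<in> GL" by (rule GL_I[OF _ _ e]) (use a in simp_all)
  show "sg (iv a) = iv (sg a)" using iv_eq[OF e] by simp
qed

lemma sg_power: "a \<in> M \<Longrightarrow> sg (a ^ k) = sg a ^ k"
  by (induction k) (simp_all add: sg_mult power_commutes)

lemma sg_pol: "a \<in> M \<Longrightarrow> sg (pol a k d) = pol (sg a) k d"
proof -
  assume a: "a \<in> M"
  have "sg (\<Sum>i\<in>S. sc (d i) * a ^ i) = (\<Sum>i\<in>S. sc (d i) * sg a ^ i)" if "finite S" for S :: "nat set"
    using that by (induction S rule: finite_induct) (simp_all add: sg_0 sg_add sg_sc_mult sg_power a)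
  then show ?thesis by (simp add: pol_def)
qed

lemma sg_RX: "q \<in> RX x \<Longrightarrow> sg q = q"
  by (auto simp: RX_def sg_pol sg_x)

lemma tr_x_sg: "y \<in> M \<Longrightarrow> tr (x * sg y) = tr (x * y)"
proof -
  assume y: "y \<in> M"
  have "tr (x * sg y) = tr (sg (y * x))" using y by (simp add: sg_mult sg_x)
  also have "\<dots> = tr (x * y)" using y by (simp add: sg_tr tr_comm[of y x])
  finally show ?thesis .
qed

lemma Psi_iv_L: "g \<in> GL \<Longrightarrow> y \<in> M \<Longrightarrow> Psi (g * iv (LL y)) = phi (- (t ^ mm * tr (x * y))) * Psi g"
proof -
  assume g: "g \<in> GL" "y \<in> M"
  have "Psi g = phi (t ^ mm * tr (x * y)) * Psi (g * iv (LL y))"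
    using Psi_L'[of "g * iv (LL y)" y] g by (simp add: mult.assoc)
  then have "phi (- (t ^ mm * tr (x * y))) * Psi g =
      phi (- (t ^ mm * tr (x * y))) * phi (t ^ mm * tr (x * y)) * Psi (g * iv (LL y))" by simp
  then show ?thesis by (simp add: phi_uminus_mult)
qed

lemma Psi_iv_N: "g \<in> GL \<Longrightarrow> a \<in> NN \<Longrightarrow> Psi (g * iv (KK a)) = phi (- (t ^ rr * tr (ff * a))) * Psi g"
proof -
  assume g: "g \<in> GL" "a \<in> NN"
  have "Psi g = phi (t ^ rr * tr (ff * a)) * Psi (g * iv (KK a))"
    using Psi_N'[of "g * iv (KK a)" a] g by (simp add: mult.assoc)
  then have "phi (- (t ^ rr * tr (ff * a))) * Psi g =
      phi (- (t ^ rr * tr (ff * a))) * phi (t ^ rr * tr (ff * a)) * Psi (g * iv (KK a))" by simp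
  then show ?thesis by (simp add: phi_uminus_mult)
qed

lemma Psi_zz:
  assumes "g \<in> GL" "e \<in> M"
  shows "Psi ((1 + sc zz * e) * g) = phi (zz * tr (x * e)) * Psi g"
    "Psi (g * (1 + sc zz * e)) = phi (zz * tr (x * e)) * Psi g"
proof -
  have e: "sc zz * e = sc (t ^ mm) * (sc (t ^ (2 * rr - mm)) * e)" by (simp only: zz_mm sc_sc)
  have t: "t ^ mm * tr (x * (sc (t ^ (2 * rr - mm)) * e)) = zz * tr (x * e)"
    by (simp only: sc_left_commute[of x] tr_sc_mult zz_mm mult.assoc)
  show "Psi ((1 + sc zz * e) * g) = phi (zz * tr (x * e)) * Psi g"
    using Psi_L[OF assms(1), of "sc (t ^ (2 * rr - mm)) * e"] assms(2) unfolding e t by simp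
  show "Psi (g * (1 + sc zz * e)) = phi (zz * tr (x * e)) * Psi g"
    using Psi_L'[OF assms(1), of "sc (t ^ (2 * rr - mm)) * e"] assms(2) unfolding e t by simp
qed

text \<open>Dual to cyclicity of the first column. In row i + 1 of x times a matrix, the entry of
  row i occurs with a unit coefficient, next to entries of lower rows only; so the rows are cleared
  from the bottom upwards.\<close>

lemma last_row_cocyclic:
  assumes b: "b \<in> M" and h: "\<And>k. z * ent (x ^ k * b) (n - 1) 0 = 0"
  shows "i < n \<Longrightarrow> z * ent (x ^ k * b) i 0 = 0"
proof (induction "n - 1 - i" arbitrary: i k rule: less_induct)
  case less
  show ?case
  proof (cases "Suc i < n")
    case False
    then have "i = n - 1" using less.prems by simp
    then show ?thesis using h by simp
  next
    case True
    let ?a = "x ^ k * b"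
    have aM: "?a \<in> M" using b by simp
    have "z * ent (x ^ Suc k * b) (Suc i) 0 = 0" using less.hyps[of "Suc i" "Suc k"] True by simp
    then have e: "z * ent (x * ?a) (Suc i) 0 = 0" by (simp add: mult.assoc)
    have "z * (\<Sum>q<n. ent (x - ff) (Suc i) q * ent ?a q 0) = 0"
      unfolding sum_distrib_left
    proof (rule sum.neutral, safe)
      fix q assume q: "q < n"
      show "z * (ent (x - ff) (Suc i) q * ent ?a q 0) = 0"
      proof (cases "q < Suc i")
        case False
        then have "z * ent ?a q 0 = 0" using less.hyps[of q k] q True by simp
        then show ?thesis by (simp only: mult.left_commute[of z] mult_zero_right)
      next
        case True
        then have "ent (x - ff) (Suc i) q = 0" using \<open>Suc i < n\<close> q by (intro BB_D[OF XX_D[OF x]])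
        then show ?thesis by (simp only: mult_zero_left mult_zero_right)
      qed
    qed
    then have "z * (c i * ent ?a i 0) = 0"
      using e ent_XX_mult[OF x aM True n_pos] by (simp add: distrib_left)
    then show ?thesis by (rule dvd_one_cancel[OF c_unit])
  qed
qed

context
  fixes q assumes q: "q \<in> RX x" "q \<in> GL"
begin

text \<open>The involution for which \<open>k * q * iv (sg k)\<close> becomes
  \<open>q * k' * iv (s1 k')\<close> with \<open>k' = iv q * k * q\<close>, so that the two twisted
  factors become adjacent.\<close>

definition s1 where "s1 y = iv q * sg y * q"

lemma sg_q: "sg q = q" "sg (iv q) = iv q"
  using q sg_RX[OF q(1)] by (simp_all add: sg_iv)

lemma xq: "x * q = q * x" "x * iv q = iv q * x"
proof -
  show *: "x * q = q * x" by (rule RX_commute_self[OF q(1)])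
  have "x * iv q = iv q * (q * x) * iv q" using q by (simp add: mult.assoc)
  then show "x * iv q = iv q * x" using q by (simp flip: *) (simp add: mult.assoc q)
qed

lemma s1_M [simp]: "y \<in> M \<Longrightarrow> s1 y \<in> M"
  using q by (simp add: s1_def)

lemma s1_mult: "a \<in> M \<Longrightarrow> b \<in> M \<Longrightarrow> s1 (a * b) = s1 b * s1 a"
  using q by (simp add: s1_def sg_mult mult.assoc)

lemma s1_add: "s1 (a + b) = s1 a + s1 b"
  by (simp add: s1_def sg_add algebra_simps)

lemma s1_uminus: "s1 (- a) = - s1 a"
  by (simp add: s1_def sg_uminus)

lemma s1_K: "s1 (1 + sc d * y) = 1 + sc d * s1 y"
  using q by (simp add: s1_def sg_K distrib_left distrib_right mult.assoc sc_left_commute[of "iv q"])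

lemma s1_x: "s1 x = x"
  using q xq by (simp add: s1_def sg_x mult.assoc)

lemma s1_s1: "a \<in> M \<Longrightarrow> s1 (s1 a) = a"
  using q by (simp add: s1_def sg_mult sg_q mult.assoc)

lemma s1_tr: "a \<in> M \<Longrightarrow> tr (s1 a) = tr a"
  using q tr_comm[of "iv q" "sg a * q"] by (simp add: s1_def sg_tr mult.assoc)

definition Sy where "Sy = {s \<in> M. s1 s = s}"

lemma Sy_D: "s \<in> Sy \<Longrightarrow> s \<in> M" "s \<in> Sy \<Longrightarrow> s1 s = s"
  by (auto simp: Sy_def)

lemma Sy_I: "s \<in> M \<Longrightarrow> s1 s = s \<Longrightarrow> s \<in> Sy"
  by (auto simp: Sy_def)

text \<open>\<open>y - s1 y\<close> is alternating and not merely skew: its pairing with a fixed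
  element is zero even where 2 is not invertible.\<close>

lemma tr_s1_s: assumes y: "y \<in> M" and s: "s \<in> Sy" shows "tr ((y - s1 y) * s) = 0"
proof -
  have "tr (s1 y * s) = tr (s1 (s * y))" using y s by (simp add: s1_mult Sy_D)
  also have "\<dots> = tr (y * s)" using y s by (simp add: s1_tr Sy_D tr_comm[of y s])
  finally show ?thesis by (simp add: left_diff_distrib tr_diff)
qed

text \<open>Moving \<open>KK s\<close> past \<open>KK (s1 y)\<close> produces the exponent on the
  left; the right side shows that it depends on y only through the alternating element, which is
  what orthogonality is to detect.\<close>

lemma tr_commutator_s1:
  assumes y: "y \<in> M" and s: "s \<in> Sy"
  shows "tr (x * (s1 y * s - s * s1 y)) = tr ((y - s1 y) * x * s)"
proof -
  have sM: "s \<in> M" using s by (rule Sy_D)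
  have "tr (x * (s1 y * s)) = tr (s1 (s * (y * x)))"
    using y sM by (simp add: s1_mult s1_x Sy_D(2)[OF s] mult.assoc)
  also have "\<dots> = tr (y * x * s)" using y sM by (simp add: s1_tr tr_comm[of s "y * x"])
  finally have 1: "tr (x * (s1 y * s)) = tr (y * x * s)" .
  have 2: "tr (x * (s * s1 y)) = tr (s1 y * x * s)"
    using y sM tr_comm[of "x * s" "s1 y"] by (simp add: mult.assoc)
  show ?thesis unfolding right_diff_distrib left_diff_distrib tr_diff 1 2 ..
qed

text \<open>The alternating element \<open>w = y - s1 y\<close> commutes with x, and the rank one symmetric elements
 \<open>x^j E x^j q\<close> separate it from zero.\<close>

lemma alternating_zero:
  assumes y: "y \<in> M" and h: "\<And>s. s \<in> Sy \<Longrightarrow> zz * tr ((y - s1 y) * x * s) = 0"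
  shows "cg zz (y - s1 y) 0"
proof -
  define w where "w = y - s1 y"
  have wM: "w \<in> M" using y by (simp add: w_def)
  have s1w: "s1 w = - w" using y s1_add[of y "- s1 y"] by (simp add: w_def s1_s1 s1_uminus)
  have comm: "cg zz (w * x) (x * w)"
  proof -
    have "sc zz * (w * x - x * w) = 0"
    proof (rule trace_nondegenerate)
      fix v :: "'r endo" assume v: "v \<in> M"
      \<comment> \<open>Testing against a symmetrised v produces two traces, and since
        \<open>s1 w = - w\<close> they combine to the trace of v against the commutator of w and
        x.\<close>
      have "v + s1 v \<in> Sy" by (rule Sy_I) (use v in \<open>simp_all add: s1_add s1_s1 add.commute\<close>)
      from h[OF this] have e: "zz * (tr (w * x * v) + tr (w * x * s1 v)) = 0"
        by (simp add: w_def distrib_left tr_add)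
      have "tr (w * x * s1 v) = tr (s1 (v * (x * s1 w)))"
        using v wM by (simp add: s1_mult s1_x s1_s1 mult.assoc)
      also have "\<dots> = - tr (v * (x * w))" using v wM by (simp add: s1_tr s1w tr_uminus)
      also have "\<dots> = - tr (x * w * v)" using v wM by (simp add: tr_comm[of v "x * w"])
      finally show "zz * tr ((w * x - x * w) * v) = 0"
        using e by (simp add: left_diff_distrib tr_diff)
    qed (use wM in simp)
    then show ?thesis by (simp add: cg_def right_diff_distrib)
  qed
  have comm_pow: "cg zz (w * x ^ k) (x ^ k * w)" for k
  proof (induction k)
    case (Suc k)
    have "w * x ^ Suc k = w * x * x ^ k" by (simp add: mult.assoc)
    also have "cg zz \<dots> (x * w * x ^ k)" by (rule cg_mult[OF comm cg_refl])
    also have "x * w * x ^ k = x * (w * x ^ k)" by (simp add: mult.assoc)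
    also have "cg zz \<dots> (x * (x ^ k * w))" by (rule cg_mult[OF cg_refl Suc])
    also have "\<dots> = x ^ Suc k * w" by (simp add: mult.assoc)
    finally show ?case .
  qed simp
  let ?E = "Em 0 (n - 1)"
  have qpow: "x ^ k * q = q * x ^ k" for k
  proof (induction k)
    case (Suc k)
    have "x ^ Suc k * q = x * (x ^ k * q)" by (simp add: mult.assoc)
    also have "\<dots> = x * q * x ^ k" by (simp only: Suc mult.assoc)
    finally show ?case by (simp add: xq(1) mult.assoc)
  qed simp
  have sE: "x ^ j * ?E * x ^ j * q \<in> Sy" for j
  proof (rule Sy_I)
    show "s1 (x ^ j * ?E * x ^ j * q) = x ^ j * ?E * x ^ j * q"
      using q by (simp add: s1_def sg_mult sg_q sg_power sg_x sg_Em[unfolded One_nat_def] mult.assoc)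
  qed (use q in simp)
  have key: "zz * tr (w * x ^ i * (x ^ j * ?E * x ^ j * q)) = zz * tr (x ^ (2 * j + i) * (q * w) * ?E)" for i j
  proof -
    have "tr (w * x ^ i * (x ^ j * ?E * x ^ j * q)) = tr (x ^ j * q * w * x ^ i * x ^ j * ?E)"
      using wM q tr_comm[of "w * x ^ i * x ^ j * ?E" "x ^ j * q"] by (simp add: mult.assoc)
    moreover have "zz * tr (x ^ j * q * w * x ^ i * x ^ j * ?E) = zz * tr (x ^ (2 * j + i) * (q * w) * ?E)"
    proof (rule cg_tr, rule cg_mult[OF _ cg_refl])
      have "x ^ j * q * w * x ^ i * x ^ j = x ^ j * q * (w * x ^ (i + j))" by (simp add: mult.assoc power_add)
      also have "cg zz \<dots> (x ^ j * q * (x ^ (i + j) * w))" by (rule cg_mult[OF cg_refl comm_pow])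
      also have "x ^ j * q * (x ^ (i + j) * w) = x ^ (2 * j + i) * (q * w)"
      proof -
        have "x ^ j * q * (x ^ (i + j) * w) = x ^ j * (q * x ^ (i + j)) * w" by (simp only: mult.assoc)
        also have "\<dots> = x ^ j * x ^ (i + j) * q * w" by (simp only: qpow[symmetric] mult.assoc)
        also have "x ^ j * x ^ (i + j) = x ^ (2 * j + i)"
        proof -
          have "2 * j + i = j + (i + j)" by simp
          then show ?thesis by (simp only: power_add[symmetric])
        qed
        finally show ?thesis by (simp only: mult.assoc)
      qed
      finally show "cg zz (x ^ j * q * w * x ^ i * x ^ j) (x ^ (2 * j + i) * (q * w))" .
    qed
    ultimately show ?thesis by simp
  qed
  \<comment> \<open>Even powers of x vanish because w is alternating, odd ones by the hypothesis,
    whose additional factor x shifts the parity.\<close>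
  have all: "zz * tr (x ^ k * (q * w) * ?E) = 0" for k
  proof (cases "even k")
    case True
    then obtain j where k: "k = 2 * j" by (auto elim: evenE)
    have "tr (w * (x ^ j * ?E * x ^ j * q)) = 0" unfolding w_def by (rule tr_s1_s[OF y sE])
    then show ?thesis using key[of 0 j] k by simp
  next
    case False
    then obtain j where k: "k = 2 * j + 1" by (auto elim: oddE)
    have "zz * tr (w * x * (x ^ j * ?E * x ^ j * q)) = 0" unfolding w_def by (rule h[OF sE])
    then show ?thesis using key[of 1 j] k by simp
  qed
  have qwM: "q * w \<in> M" using q wM by simp
  have "zz * ent (x ^ k * (q * w)) (n - 1) 0 = 0" for k
    using all[of k] n_pos qwM tr_mult_Em[of "x ^ k * (q * w)" 0 "n - 1"] by simp
  then have col: "zz * ent (q * w) i 0 = 0" if "i < n" for i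
    using last_row_cocyclic[OF qwM _ that, where k = 0] by simp
  have "q * w * x = q * (w * x)" by (simp add: mult.assoc)
  also have "cg zz \<dots> (q * (x * w))" by (rule cg_mult[OF cg_refl comm])
  also have "\<dots> = x * (q * w)" using xq by (metis mult.assoc)
  finally have "cg zz (q * w) 0" by (intro commutant_XX[OF x qwM]) (use col in auto)
  then have "cg zz (iv q * (q * w)) (iv q * 0)" by (rule cg_mult[OF cg_refl])
  then show ?thesis using q by (simp add: w_def)
qed

end

end

section \<open>The two evaluations of the twisted average\<close>

context core begin

text \<open>Counts the summands that survive translation by all symmetric elements. What matters
  later is that it is positive and independent of the factor in \<open>K^r\<close>.\<close>

definition kap :: "'r endo \<Rightarrow> nat" where
  "kap q = card {y \<in> M. \<forall>s\<in>Sy q. phi (zz * tr ((y - s1 q y) * x * s)) = 1}"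

lemma kap_pos: assumes q: "q \<in> RX x" "q \<in> GL" shows "0 < kap q"
proof -
  have "0 \<in> {y \<in> M. \<forall>s\<in>Sy q. phi (zz * tr ((y - s1 q y) * x * s)) = 1}"
    by (simp add: s1_def[OF q] sg_0 tr_0 phi_0)
  moreover have "finite {y \<in> M. \<forall>s\<in>Sy q. phi (zz * tr ((y - s1 q y) * x * s)) = 1}" by simp
  ultimately show ?thesis unfolding kap_def card_gt_0_iff by (intro conjI) (rule notI, simp only: empty_iff)
qed

text \<open>Translating by \<open>KK s\<close> with s symmetric multiplies a summand by the
  character \<open>phi (zz * tr ((y - s1 y) * x * s))\<close> of s. Where it is trivial on all s,
  \<open>alternating_zero\<close> makes y symmetric up to \<open>cg zz\<close>, so
  \<open>KK y\<close> and its image under s1 differ by an element of \<open>K^m\<close>. That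
  element acts through the character of x, and its value is 1 by a trace computation.\<close>

lemma twisted_average_commutant:
  assumes q: "q \<in> RX x" "q \<in> GL" and y1: "y1 \<in> M"
  shows "(\<Sum>y\<in>M. Psi (KK y * q * iv (sg (KK y)) * KK y1)) = of_nat (kap q) * Psi (q * KK y1)"
proof -
  let ?h = "KK y1"
  let ?s = "s1 q"
  note s1 = s1_M[OF q] s1_mult[OF q] s1_K[OF q] s1_s1[OF q]
  define G where "G k = Psi (q * k * iv (?s k) * ?h)" for k
  have hG: "?h \<in> GL" using y1 by simp
  have "(\<Sum>y\<in>M. Psi (KK y * q * iv (sg (KK y)) * ?h)) = (\<Sum>y\<in>M. G (KK y))"
  proof (rule sum.reindex_bij_witness[of _ "\<lambda>y. q * y * iv q" "\<lambda>y. iv q * y * q"])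
    fix y :: "'r endo" assume y: "y \<in> M"
    have k: "KK (iv q * y * q) = iv q * KK y * q"
      using K_conj[OF q(2), of "t ^ rr" y] q by (simp add: mult.assoc)
    have "?s (iv q * KK y * q) = sg (KK y)"
      using q y by (simp add: s1_def[OF q] sg_mult sg_q[OF q] mult.assoc)
    then show "G (KK (iv q * y * q)) = Psi (KK y * q * iv (sg (KK y)) * ?h)"
      unfolding k G_def using q by (simp add: mult.assoc)
  qed (use q in \<open>simp_all add: mult.assoc\<close>)
  also have "\<dots> = (\<Sum>y\<in>{y \<in> M. \<forall>s\<in>Sy q. phi (zz * tr ((y - ?s y) * x * s)) = 1}. G (KK y))"
  proof (rule average_over_characters)
    show "finite (Sy q)" by (rule finite_subset[OF _ finite_M]) (auto dest: Sy_D(1)[OF q])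
    show "Sy q \<noteq> {}" using Sy_I[OF q, of x] s1_x[OF q] by auto
    show "s + s' \<in> Sy q" if "s \<in> Sy q" "s' \<in> Sy q" for s s'
      using that by (intro Sy_I[OF q]) (simp_all add: Sy_D[OF q] s1_add[OF q])
    show "phi (zz * tr ((y - ?s y) * x * (s + s'))) = phi (zz * tr ((y - ?s y) * x * s)) * phi (zz * tr ((y - ?s y) * x * s'))" for y s s'
      by (simp only: distrib_left tr_add phi_add)
    fix s assume s: "s \<in> Sy q"
    have sM: "s \<in> M" by (rule Sy_D(1)[OF q s])
    have "(\<Sum>y\<in>M. G (KK y)) = (\<Sum>y\<in>M. G (KK y * KK s))" by (rule sum_KK[OF sM])
    also have "\<dots> = (\<Sum>y\<in>M. G (KK y) * phi (zz * tr ((y - ?s y) * x * s)))"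
    proof (rule sum.cong[OF refl])
      fix y :: "'r endo" assume y: "y \<in> M"
      let ?b = "?s y"
      let ?k = "1 + sc zz * (?b * s - s * ?b)"
      have b: "?b \<in> M" using y by (rule s1)
      have m1: "?s (KK y * KK s) = KK s * KK ?b"
        using y sM by (simp add: s1(2) s1(3) Sy_D(2)[OF q s])
      have kG: "KK s \<in> GL" "KK ?b \<in> GL" "KK y \<in> GL" using sM b y by simp_all
      have "KK ?b * (KK s * iv (KK ?b) * iv (KK s)) = ?k * (KK s * KK ?b) * iv (KK ?b) * iv (KK s)"
        unfolding KK_swap[of ?b s, symmetric] by (simp only: mult.assoc)
      also have "\<dots> = ?k" using kG by (simp add: mult.assoc)
      finally have "KK s * iv (KK ?b) * iv (KK s) = iv (KK ?b) * ?k"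
        using kG iv_cancel(4)[of "KK ?b"] by metis
      then have "q * (KK y * KK s) * iv (?s (KK y * KK s)) * ?h = q * KK y * iv (KK ?b) * (?k * ?h)"
        using kG unfolding m1 by (simp add: iv_mult mult.assoc)
      also have "\<dots> = q * KK y * iv (?s (KK y)) * ?h * ?k"
        by (simp only: zz_commute mult.assoc s1(3))
      finally have "G (KK y * KK s) = Psi (q * KK y * iv (?s (KK y)) * ?h * ?k)" by (simp add: G_def)
      also have "\<dots> = phi (zz * tr (x * (?b * s - s * ?b))) * G (KK y)"
        unfolding G_def by (rule Psi_zz) (use q kG b sM hG in \<open>simp_all add: s1(3)\<close>)
      finally show "G (KK y * KK s) = G (KK y) * phi (zz * tr ((y - ?s y) * x * s))"
        by (simp only: tr_commutator_s1[OF q y s] mult.commute)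
    qed
    finally show "(\<Sum>y\<in>M. G (KK y)) = (\<Sum>y\<in>M. G (KK y) * phi (zz * tr ((y - ?s y) * x * s)))" .
  qed simp_all
  also have "\<dots> = (\<Sum>y\<in>{y \<in> M. \<forall>s\<in>Sy q. phi (zz * tr ((y - ?s y) * x * s)) = 1}. Psi (q * ?h))"
  proof (rule sum.cong[OF refl])
    fix y assume "y \<in> {y \<in> M. \<forall>s\<in>Sy q. phi (zz * tr ((y - ?s y) * x * s)) = 1}"
    then have y: "y \<in> M" and h: "\<And>s. s \<in> Sy q \<Longrightarrow> phi (zz * tr ((y - ?s y) * x * s)) = 1" by auto
    let ?b = "?s y"
    define w where "w = y - ?b"
    have b: "?b \<in> M" using y by (rule s1)
    have wM: "w \<in> M" using y b by (simp add: w_def)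
    have w0: "cg zz w 0" unfolding w_def
    proof (rule alternating_zero[OF q y])
      fix s assume s: "s \<in> Sy q"
      show "zz * tr ((y - ?s y) * x * s) = 0"
      proof (rule phi_nondegenerate)
        fix a
        have "?s (sc a * s) = sc a * ?s s"
          by (simp add: s1_def[OF q] sg_sc_mult sc_left_commute[of "iv q"] mult.assoc)
        then have "sc a * s \<in> Sy q"
          using s by (intro Sy_I[OF q]) (simp_all add: Sy_D[OF q])
        from h[OF this] have "phi (zz * (a * tr ((y - ?s y) * x * s))) = 1"
          by (simp only: sc_left_commute[of "(y - ?s y) * x"] tr_sc_mult)
        then show "phi (zz * tr ((y - ?s y) * x * s) * a) = 1"
          by (simp only: mult.commute[of a] mult.assoc[of zz])
      qed
    qed
    obtain v where v: "v \<in> M" "sc (t ^ rr) * w = sc (t ^ mm) * v" using zz_mult_sc_div[OF wM w0] .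
    have bG: "KK ?b \<in> GL" using b by simp
    obtain b' where b': "b' \<in> M" "iv (KK ?b) = KK b'" using KK_iv[OF b] by blast
    let ?e = "v * iv (KK ?b)"
    have eM: "?e \<in> M" using v bG by simp
    have "KK y = KK ?b + sc (t ^ rr) * w" by (simp add: w_def algebra_simps)
    then have "KK y * iv (KK ?b) = KK ?b * iv (KK ?b) + sc (t ^ rr) * w * iv (KK ?b)"
      by (simp only: distrib_right)
    also have "\<dots> = LL ?e" by (simp only: iv_cancel(1)[OF bG] v(2) mult.assoc)
    finally have "KK y * iv (KK ?b) = LL ?e" .
    then have "q * KK y * iv (?s (KK y)) * ?h = LL (q * ?e * iv q) * (q * ?h)"
      using conj_K[OF q(2), of "t ^ mm" ?e] by (simp only: s1(3) mult.assoc)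
    then have "G (KK y) = phi (t ^ mm * tr (x * (q * ?e * iv q))) * Psi (q * ?h)"
      unfolding G_def using q eM hG by (simp add: Psi_L)
    \<comment> \<open>The exponent reduces to \<open>t ^ rr * tr (x * w)\<close>, since the
      correction coming from \<open>iv (KK ?b)\<close> carries the factor zz times w, which is 0.
      The remaining trace vanishes because s1 fixes x and preserves traces.\<close>
    moreover have "t ^ mm * tr (x * (q * ?e * iv q)) = 0"
    proof -
      have "tr (x * (q * ?e * iv q)) = tr (q * (x * ?e * iv q))"
        using xq(1)[OF q] by (simp only: mult.assoc[symmetric])
      also have "\<dots> = tr (x * ?e * iv q * q)" using q eM by (intro tr_comm) simp_all
      also have "\<dots> = tr (x * ?e)" using q by (simp add: mult.assoc)
      finally have "t ^ mm * tr (x * (q * ?e * iv q)) = tr (sc (t ^ mm) * (x * ?e))" by (simp only: tr_sc_mult)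
      also have "sc (t ^ mm) * (x * ?e) = x * (sc (t ^ mm) * v) * iv (KK ?b)"
        by (simp only: mult.assoc sc_left_commute[of x])
      also have "\<dots> = sc (t ^ rr) * (x * w) + sc zz * (x * w * b')"
        unfolding v(2)[symmetric] b'(2)
        by (simp add: distrib_left mult.assoc sc_left_commute[of x] sc_left_commute[of w] sc_sc mult_2 power_add)
      also have "tr \<dots> = t ^ rr * tr (x * w)"
      proof -
        have "cg zz (x * w * b') (x * 0 * b')" by (intro cg_mult w0) simp_all
        then have "sc zz * (x * w * b') = 0" by (simp add: cg_def)
        then show ?thesis by (simp add: tr_add tr_sc_mult tr_0)
      qed
      also have "tr (x * w) = 0"
      proof -
        have "tr (x * ?b) = tr (?s (y * x))" using y by (simp add: s1(2) s1_x[OF q])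
        also have "\<dots> = tr (x * y)" using y by (simp add: s1_tr[OF q] tr_comm[of y x])
        finally show ?thesis by (simp add: w_def right_diff_distrib tr_diff)
      qed
      finally show ?thesis by simp
    qed
    ultimately show "G (KK y) = Psi (q * ?h)" by (simp add: phi_0)
  qed
  also have "\<dots> = of_nat (kap q) * Psi (q * ?h)" by (simp add: kap_def)
  finally show ?thesis .
qed

definition Y2 :: "'r endo set" where
  "Y2 = {y \<in> M. \<forall>a\<in>NN. phi (zz * tr ((x * y - y * x) * a)) = 1}"

text \<open>Orthogonality to \<open>NN\<close> leaves the commutator of x and y without entries
  below the diagonal, scaled by zz. Subtracting the polynomial p in x with the same first column as
  y gives a matrix to which \<open>triangular_intertwiner\<close> applies with d = 0; its strictly
  upper triangular part is a, and \<open>KK a * KK p\<close> misses \<open>KK y\<close> by an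
  element of \<open>K^m\<close> only.\<close>

lemma Y2_decompose:
  assumes "y \<in> Y2"
  obtains a pp v where "a \<in> NN" "pp \<in> RX x" "v \<in> M" "KK y = KK a * KK pp * LL v"
proof -
  have y: "y \<in> M" and h: "\<And>a. a \<in> NN \<Longrightarrow> phi (zz * tr ((x * y - y * x) * a)) = 1"
    using assms by (auto simp: Y2_def)
  have dM: "x * y - y * x \<in> M" using y by simp
  have low: "zz * ent (x * y - y * x) i j = 0" if "i < n" "j < i" for i j
    by (rule NN_orthogonal[OF dM h]) (use that in simp_all)
  obtain p where p: "p \<in> RX x" "\<forall>i<n. ent p i 0 = ent y i 0" using RX_col[OF x, of "\<lambda>i. ent y i 0"] by blast
  have pM: "p \<in> M" using p x by simp
  define d where "d = y - p"
  have d: "d \<in> M" using y pM by (simp add: d_def)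
  have xp: "x * p = p * x" by (rule RX_commute_self[OF p(1)])
  have dz: "zz * ent d i j = (if i = j then 0 else 0)" if "i < n" "j < n" "j \<le> i" for i j
  proof (rule triangular_intertwiner[OF x x d _ _ that])
    fix i j assume "i < n" "j < i"
    have "d * x - x * d = - (x * y - y * x)" using xp by (simp add: d_def algebra_simps)
    then have "zz * ent (d * x - x * d) i j = - (zz * ent (x * y - y * x) i j)" by (simp only: ent_uminus mult_minus_right)
    then have "zz * ent (d * x - x * d) i j = 0" using low[OF \<open>i < n\<close> \<open>j < i\<close>] by simp
    then show "zz * ent (d * x) i j = zz * ent (x * d) i j" by (simp add: right_diff_distrib)
  next
    fix i assume "i < n"
    then show "zz * ent d i 0 = (if i = 0 then 0 else 0)" using p(2) by (simp add: d_def)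
  qed
  define a where "a = mt (\<lambda>i j. if j \<le> i then 0 else ent d i j)"
  have a: "a \<in> NN" by (rule NN_I) (simp_all add: a_def ent_mt)
  have "cg zz d a" by (rule cg_I) (use d dz in \<open>auto simp: a_def ent_mt\<close>)
  then have "cg zz (d - a) 0" by (simp add: cg_diff_0[symmetric])
  then obtain v where v: "v \<in> M" "sc (t ^ rr) * (d - a) = sc (t ^ mm) * v"
    using zz_mult_sc_div[of "d - a"] d a by auto
  \<comment> \<open>The product \<open>KK a * KK p\<close> contains the extra term
    \<open>a * p\<close> of order 2r. It is pushed into the factor in \<open>K^m\<close>, which is
    possible as \<open>mm \<le> 2 * rr\<close>.\<close>
  define u where "u = v - sc (t ^ (2 * rr - mm)) * (a * p)"
  have uM: "u \<in> M" using v a pM by (simp add: u_def)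
  have kG: "KK a * KK p \<in> GL" using a pM by simp
  have "KK y = KK a + sc (t ^ rr) * p + sc (t ^ rr) * (d - a)"
    by (simp add: d_def algebra_simps)
  also have "\<dots> = KK a * KK p + sc (t ^ mm) * u"
  proof -
    have "sc (t ^ rr) * (a * (sc (t ^ rr) * p)) = sc (t ^ mm) * (sc (t ^ (2 * rr - mm)) * (a * p))"
    proof -
      have "t ^ rr * t ^ rr = t ^ mm * t ^ (2 * rr - mm)"
        by (rule trans[OF _ zz_mm]) (simp only: mult_2 power_add)
      then show ?thesis by (simp only: sc_left_commute[of a] sc_sc)
    qed
    then show ?thesis unfolding v(2) u_def
      by (simp add: algebra_simps)
  qed
  also have "\<dots> = KK a * KK p * LL (iv (KK a * KK p) * u)"
    by (rule GL_add_factor[OF kG])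
  finally show ?thesis using that[OF a p(1), of "iv (KK a * KK p) * u"] uM kG by simp
qed

text \<open>Under translation by \<open>KK a\<close> the theta-factors on the two sides cancel,
  since sg preserves \<open>tr (ff * a)\<close>, and only a character in the commutator of x and y
  remains. For the survivors \<open>Y2_decompose\<close> applies: the factors in U and in
  \<open>K^m\<close> cancel against their images under sg, and the polynomial factor drops out
  because sg fixes it and it commutes with x and q.\<close>

lemma twisted_average_unipotent:
  assumes q: "q \<in> RX x" "q \<in> GL" and y0: "y0 \<in> M"
  shows "(\<Sum>y\<in>M. Psi (KK y * (KK y0 * q) * iv (sg (KK y)))) = of_nat (card Y2) * Psi (KK y0 * q)"
proof -
  let ?h = "KK y0 * q"
  have hG: "?h \<in> GL" using q y0 by simp
  define G where "G k = Psi (k * ?h * iv (sg k))" for k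
  have "(\<Sum>y\<in>M. G (KK y)) = (\<Sum>y\<in>{y \<in> M. \<forall>a\<in>NN. phi (zz * tr ((x * y - y * x) * a)) = 1}. G (KK y))"
  proof (rule average_over_characters)
    show "NN \<noteq> {}" using NN_0 by blast
    show "phi (zz * tr ((x * y - y * x) * (s + s'))) = phi (zz * tr ((x * y - y * x) * s)) * phi (zz * tr ((x * y - y * x) * s'))" for y s s'
      by (simp only: distrib_left tr_add phi_add)
    fix a assume a: "a \<in> NN"
    have "(\<Sum>y\<in>M. G (KK y)) = (\<Sum>y\<in>M. G (KK y * KK a))" by (rule sum_KK) (use a in simp)
    also have "\<dots> = (\<Sum>y\<in>M. G (KK y) * phi (zz * tr ((x * y - y * x) * a)))"
    proof (rule sum.cong[OF refl])
      fix y :: "'r endo" assume y: "y \<in> M"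
      let ?k = "1 + sc zz * (y * a - a * y)"
      have kG: "KK y \<in> GL" "KK a \<in> GL" "KK (sg a) \<in> GL" "sg (KK y) \<in> GL" using y a by simp_all
      have eM: "y * a - a * y \<in> M" using y a by simp
      have 1: "KK y * KK a = KK a * (?k * KK y)"
      proof -
        have "KK y * KK a = ?k * KK a * KK y" unfolding KK_swap[of y a] by (simp only: mult.assoc)
        then show ?thesis by (simp only: zz_commute mult.assoc)
      qed
      have "sg (KK y * KK a) = KK (sg a) * sg (KK y)" using y a by (simp add: sg_mult sg_K)
      then have "KK y * KK a * ?h * iv (sg (KK y * KK a)) = KK a * (?k * (KK y * ?h * iv (sg (KK y)))) * iv (KK (sg a))"
        using kG unfolding 1 by (simp add: iv_mult mult.assoc)
      moreover have "KK y * ?h * iv (sg (KK y)) \<in> GL" "?k * (KK y * ?h * iv (sg (KK y))) \<in> GL"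
        using kG hG eM rm(1) by (auto intro!: GL_mult iv_GL K_GL)
      ultimately have "G (KK y * KK a) = phi (- (t ^ rr * tr (ff * sg a))) * (phi (t ^ rr * tr (ff * a)) *
          (phi (zz * tr (x * (y * a - a * y))) * G (KK y)))"
        unfolding G_def using a kG eM by (simp only: Psi_iv_N Psi_N Psi_zz GL_mult sg_NN)
      moreover have "tr (ff * sg a) = tr (ff * a)"
        using tr_XX_NN[OF x, of a] tr_XX_NN[OF x, of "sg a"] a tr_x_sg[of a] by simp
      moreover have "tr (x * (y * a - a * y)) = tr ((x * y - y * x) * a)"
        using tr_comm[of "x * a" y] y a by (simp add: algebra_simps tr_diff tr_add mult.assoc)
      ultimately have "G (KK y * KK a) = phi (- (t ^ rr * tr (ff * a))) * phi (t ^ rr * tr (ff * a)) *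
          phi (zz * tr ((x * y - y * x) * a)) * G (KK y)" by simp
      then show "G (KK y * KK a) = G (KK y) * phi (zz * tr ((x * y - y * x) * a))"
        by (simp add: phi_uminus_mult)
    qed
    finally show "(\<Sum>y\<in>M. G (KK y)) = (\<Sum>y\<in>M. G (KK y) * phi (zz * tr ((x * y - y * x) * a)))" .
  qed simp_all
  also have "\<dots> = (\<Sum>y\<in>Y2. G (KK y))" by (simp add: Y2_def)
  also have "\<dots> = (\<Sum>y\<in>Y2. Psi ?h)"
  proof (rule sum.cong[OF refl])
    fix y assume "y \<in> Y2"
    then obtain a p v where d: "a \<in> NN" "p \<in> RX x" "v \<in> M" "KK y = KK a * KK p * LL v"
      by (rule Y2_decompose)
    have pM: "p \<in> M" using d x by simp
    have G: "KK a \<in> GL" "KK p \<in> GL" "LL v \<in> GL" "KK (sg a) \<in> GL" "LL (sg v) \<in> GL"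
      using d pM by simp_all
    have xp: "x * p = p * x" by (rule RX_commute_self[OF d(2)])
    have pq: "p * q = q * p" by (rule RX_commute[OF q(1)]) (simp add: xp)
    have sgy: "sg (KK y) = LL (sg v) * (KK p * KK (sg a))"
      unfolding d(4) using d(1,3) pM by (simp add: sg_mult sg_K sg_RX[OF d(2)] mult.assoc)
    let ?g = "?h * iv (KK (sg a))"
    have gG: "?g \<in> GL" using hG G by simp
    have "KK y * ?h * iv (sg (KK y)) = KK a * (LL (KK p * v * iv (KK p)) * (KK p * ?g * iv (KK p))) * iv (LL (sg v))"
    proof -
      have "KK p * LL v = LL (KK p * v * iv (KK p)) * KK p" by (rule conj_K[OF G(2)])
      then have c: "KK a * KK p * LL v = KK a * (LL (KK p * v * iv (KK p)) * KK p)"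
        by (simp only: mult.assoc)
      have i: "iv (sg (KK y)) = iv (KK (sg a)) * iv (KK p) * iv (LL (sg v))"
        unfolding sgy using G by (simp only: iv_mult GL_mult)
      show ?thesis unfolding i unfolding d(4) c by (simp only: mult.assoc)
    qed
    then have "G (KK y) = phi (- (t ^ mm * tr (x * sg v))) * (phi (t ^ rr * tr (ff * a)) *
        (phi (t ^ mm * tr (x * (KK p * v * iv (KK p)))) * Psi (KK p * ?g * iv (KK p))))"
      unfolding G_def using G gG d by (simp add: Psi_iv_L Psi_N Psi_L)
    moreover have "tr (x * (KK p * v * iv (KK p))) = tr (x * v)"
    proof -
      have "x * KK p = KK p * x" by (simp add: distrib_left distrib_right sc_left_commute[of x] mult.assoc xp)
      then have "tr (x * (KK p * v * iv (KK p))) = tr (KK p * (x * v * iv (KK p)))"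
        by (simp only: mult.assoc[symmetric])
      also have "\<dots> = tr (x * v * iv (KK p) * KK p)" using G d by (intro tr_comm) simp_all
      finally show ?thesis using G by (simp add: mult.assoc)
    qed
    moreover have "Psi (KK p * ?g * iv (KK p)) = Psi ?g"
    proof -
      obtain y2 where y2: "y2 \<in> M" "?g = KK y2 * q"
      proof -
        obtain a' where a': "a' \<in> M" "iv (KK (sg a)) = KK a'" using KK_iv[of "sg a"] d by auto
        have "q * KK a' = KK (q * a' * iv q) * q" by (rule conj_K[OF q(2)])
        then have "?g = KK y0 * KK (q * a' * iv q) * q" by (simp only: a'(2) mult.assoc)
        also have "\<dots> = KK (y0 * KK (q * a' * iv q) + q * a' * iv q) * q" by (simp only: KK_mult)
        finally show ?thesis using that[of "y0 * KK (q * a' * iv q) + q * a' * iv q"] y0 a' q by simp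
      qed
      let ?e = "p * y2 - y2 * p"
      have "KK p * q = q * KK p" by (simp add: distrib_left distrib_right sc_left_commute[of q] mult.assoc pq)
      then have qp: "q * iv (KK p) = iv (KK p) * q" by (rule iv_commute[OF G(2)])
      have "KK p * ?g * iv (KK p) = KK p * KK y2 * iv (KK p) * q"
        unfolding y2(2) by (simp only: mult.assoc qp)
      also have "\<dots> = (1 + sc zz * ?e) * (KK y2 * q)"
        unfolding KK_swap[of p y2] using G by (simp add: mult.assoc)
      finally have "Psi (KK p * ?g * iv (KK p)) = phi (zz * tr (x * ?e)) * Psi ?g"
        unfolding y2(2) using y2(1) q pM by (simp add: Psi_zz)
      moreover have "tr (x * ?e) = 0"
      proof -
        have "tr (x * (y2 * p)) = tr (x * (p * y2))"
          using tr_comm[of "x * y2" p] y2(1) pM xp by (simp add: mult.assoc[symmetric])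
        then show ?thesis by (simp add: right_diff_distrib tr_diff)
      qed
      ultimately show ?thesis by (simp add: phi_0)
    qed
    moreover have "Psi ?g = phi (- (t ^ rr * tr (ff * sg a))) * Psi ?h"
      using hG d by (intro Psi_iv_N) simp_all
    moreover have "tr (ff * sg a) = tr (ff * a)"
      using tr_XX_NN[OF x, of a] tr_XX_NN[OF x, of "sg a"] d(1) tr_x_sg[of a] by simp
    ultimately have "G (KK y) = (phi (- (t ^ mm * tr (x * v))) * phi (t ^ mm * tr (x * v))) *
       (phi (- (t ^ rr * tr (ff * a))) * phi (t ^ rr * tr (ff * a))) * Psi ?h"
      using tr_x_sg[OF d(3)] by (simp only: ac_simps)
    then show "G (KK y) = Psi ?h" by (simp add: phi_uminus_mult)
  qed
  finally show ?thesis by (simp add: G_def)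
qed

text \<open>Comparing the two evaluations of the twisted average gives \<open>Psi (sg g) = c * Psi g\<close> with
 a positive constant c depending only on q; as sg is an involution, c is 1.\<close>

theorem Psi_sg:
  assumes q: "q \<in> RX x" "q \<in> GL" and y0: "y0 \<in> M"
  shows "Psi (sg (KK y0 * q)) = Psi (KK y0 * q)"
proof -
  have step: "of_nat (card Y2) * Psi (KK y0 * q) = of_nat (kap q) * Psi (sg (KK y0 * q))"
    if y0: "y0 \<in> M" for y0
  proof -
    have e: "sg (KK y0 * q) = q * KK (sg y0)"
      using y0 q by (simp add: sg_mult sg_K sg_q[OF q])
    have "of_nat (card Y2) * Psi (KK y0 * q) = (\<Sum>y\<in>M. Psi (KK y * (KK y0 * q) * iv (sg (KK y))))"
      by (rule twisted_average_unipotent[OF q y0, symmetric])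
    \<comment> \<open>Writing each summand in terms of \<open>KK y * KK y0\<close> moves
      \<open>KK y0\<close> to the far right as \<open>sg (KK y0)\<close>; a translation of the sum
      then removes it from the twisted part.\<close>
    also have "\<dots> = (\<Sum>y\<in>M. Psi (KK y * KK y0 * q * iv (sg (KK y * KK y0)) * sg (KK y0)))"
    proof (rule sum.cong[OF refl])
      fix y :: "'r endo" assume y: "y \<in> M"
      have "iv (sg (KK y * KK y0)) * sg (KK y0) = iv (sg (KK y))"
        using y y0 by (simp add: sg_mult iv_mult mult.assoc)
      then show "Psi (KK y * (KK y0 * q) * iv (sg (KK y))) = Psi (KK y * KK y0 * q * iv (sg (KK y * KK y0)) * sg (KK y0))"
        by (simp only: mult.assoc)
    qed
    also have "\<dots> = (\<Sum>y\<in>M. Psi (KK y * q * iv (sg (KK y)) * sg (KK y0)))"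
      by (rule sum_KK[OF y0, of "\<lambda>k. Psi (k * q * iv (sg k) * sg (KK y0))", symmetric])
    also have "\<dots> = of_nat (kap q) * Psi (q * KK (sg y0))"
      unfolding sg_K by (rule twisted_average_commutant[OF q, unfolded sg_K]) (use y0 in simp)
    finally show ?thesis unfolding e .
  qed
  let ?y = "q * sg y0 * iv q"
  have yM: "?y \<in> M" using q y0 by simp
  have e: "sg (KK y0 * q) = KK ?y * q"
    using y0 q conj_K[OF q(2), of "t ^ rr" "sg y0"] by (simp add: sg_mult sg_K sg_q[OF q])
  then have e': "sg (KK ?y * q) = KK y0 * q"
    using sg_sg[of "KK y0 * q"] y0 q by simp
  let ?a = "of_nat (card Y2) :: complex" and ?b = "of_nat (kap q) :: complex"
  have 1: "?a * Psi (KK y0 * q) = ?b * Psi (KK ?y * q)" using step[OF y0] unfolding e .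
  have 2: "?a * Psi (KK ?y * q) = ?b * Psi (KK y0 * q)" using step[OF yM] unfolding e' .
  have b: "?b \<noteq> 0" using kap_pos[OF q] by simp
  have "?a * ?a * Psi (KK y0 * q) = ?a * (?b * Psi (KK ?y * q))" by (simp only: 1 mult.assoc)
  also have "\<dots> = ?b * (?a * Psi (KK ?y * q))" by (rule mult.left_commute)
  also have "\<dots> = ?b * ?b * Psi (KK y0 * q)" unfolding 2 by (rule mult.assoc[symmetric])
  finally have "?a * ?a * Psi (KK y0 * q) = ?b * ?b * Psi (KK y0 * q)" .
  then have "Psi (KK y0 * q) = 0 \<or> ?a * ?a = ?b * ?b" by (simp only: mult_cancel_right)
  then have "Psi (KK ?y * q) = Psi (KK y0 * q)"
  proof
    assume "Psi (KK y0 * q) = 0"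
    then show ?thesis using 1 b by simp
  next
    assume "?a * ?a = ?b * ?b"
    then have "of_nat (card Y2 * card Y2) = (of_nat (kap q * kap q) :: complex)" by (simp only: of_nat_mult)
    then have "(card Y2)\<^sup>2 = (kap q)\<^sup>2" by (simp only: of_nat_eq_iff power2_eq_square)
    then have "card Y2 = kap q" by simp
    then show ?thesis using 1 b by simp
  qed
  then show ?thesis unfolding e .
qed

end

section \<open>The anti-involution\<close>

lemma is_unit_prod: "finite S \<Longrightarrow> (\<And>i. i \<in> S \<Longrightarrow> c i dvd (1::'r::comm_ring_1)) \<Longrightarrow> prod c S dvd 1"
  by (induction S rule: finite_induct) (simp_all add: is_unit_mult_iff)

context trunc_c begin

text \<open>For tau to fix \<open>ff\<close>, the quotient of \<open>qd i\<close> by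
  \<open>qd (i + 1)\<close> has to equal that of \<open>c i\<close> by \<open>c (n - 2 - i)\<close>.
  The product \<open>qd\<close> of the two partial products solves this. It is symmetric under i to
  n - 1 - i, which makes Q symmetric and tau an involution.\<close>

definition hh :: "nat \<Rightarrow> 'r" where "hh i = (\<Prod>j\<in>{i..<n - 1}. c j)"
definition qd :: "nat \<Rightarrow> 'r" where "qd i = hh i * hh (n - 1 - i)"
text \<open>Choosing the inverse from the value \<open>qd i\<close> alone lets it inherit the
  symmetry of \<open>qd\<close>.\<close>

definition qi :: "nat \<Rightarrow> 'r" where "qi i = (SOME d. qd i * d = 1)"

lemma hh_unit: "hh i dvd 1"
  unfolding hh_def by (rule is_unit_prod) (simp_all add: c_unit)

lemma qd_qi: "qd i * qi i = 1"
proof -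
  have "qd i dvd 1" by (simp add: qd_def hh_unit is_unit_mult_iff)
  then have "\<exists>d. qd i * d = 1" by (metis dvdE)
  then show ?thesis unfolding qi_def by (rule someI_ex)
qed

lemma qd_flip: "i < n \<Longrightarrow> qd (n - 1 - i) = qd i"
  by (simp add: qd_def mult.commute)

lemma qi_flip: "i < n \<Longrightarrow> qi (n - 1 - i) = qi i"
  by (simp add: qi_def qd_flip[simplified])

lemma hh_step: "Suc i < n \<Longrightarrow> hh i = c i * hh (Suc i)"
  unfolding hh_def by (rule prod.atLeast_Suc_lessThan) simp

text \<open>The anti-involution \<open>a \<mapsto> Q^-1 a^T Q\<close> for the antidiagonal matrix Q with entries qd, which
 are chosen so that ff is fixed.\<close>

definition tau :: "'r endo \<Rightarrow> 'r endo" where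
  "tau a = mt (\<lambda>i j. qi i * qd j * ent a (n - 1 - j) (n - 1 - i))"

lemma tau_M [simp]: "tau a \<in> M" by (simp add: tau_def)

lemma ent_tau: "i < n \<Longrightarrow> j < n \<Longrightarrow> ent (tau a) i j = qi i * qd j * ent a (n - 1 - j) (n - 1 - i)"
  by (simp add: tau_def ent_mt)

lemma tau_add: "tau (a + b) = tau a + tau b"
  by (rule M_eqI) (simp_all add: ent_tau distrib_left)

lemma tau_sc_mult: "tau (sc d * a) = sc d * tau a"
  by (rule M_eqI) (simp_all add: ent_tau mult.left_commute)

lemma tau_0: "tau 0 = 0"
  using tau_add[of 0 0] by simp

lemma tau_sum: "finite S \<Longrightarrow> tau (\<Sum>i\<in>S. f i) = (\<Sum>i\<in>S. tau (f i))"
  by (induction S rule: finite_induct) (simp_all add: tau_0 tau_add)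

lemma tau_mult: assumes "a \<in> M" "b \<in> M" shows "tau (a * b) = tau b * tau a"
proof (rule M_eqI)
  fix i j assume ij: "i < n" "j < n"
  have "ent (tau b * tau a) i j = (\<Sum>k<n. qi i * qd k * ent b (n - 1 - k) (n - 1 - i) * (qi k * qd j * ent a (n - 1 - j) (n - 1 - k)))"
    using ij by (simp add: ent_mult ent_tau)
  also have "\<dots> = (\<Sum>k<n. qi i * qd j * (ent a (n - 1 - j) k * ent b k (n - 1 - i)))"
  proof (rule sum.reindex_bij_witness[of _ "\<lambda>k. n - 1 - k" "\<lambda>k. n - 1 - k"])
    fix k assume "k \<in> {..<n}"
    have "qi i * qd k * ent b (n - 1 - k) (n - 1 - i) * (qi k * qd j * ent a (n - 1 - j) (n - 1 - k)) =
       (qd k * qi k) * (qi i * qd j * (ent a (n - 1 - j) (n - 1 - k) * ent b (n - 1 - k) (n - 1 - i)))"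
      by (simp only: ac_simps)
    then show "qi i * qd j * (ent a (n - 1 - j) (n - 1 - k) * ent b (n - 1 - k) (n - 1 - i)) =
        qi i * qd k * ent b (n - 1 - k) (n - 1 - i) * (qi k * qd j * ent a (n - 1 - j) (n - 1 - k))"
      by (simp only: qd_qi mult_1_left)
  qed (use n_pos in auto)
  also have "\<dots> = ent (tau (a * b)) i j"
    using ij assms n_pos by (simp add: ent_tau ent_mult sum_distrib_left)
  finally show "ent (tau (a * b)) i j = ent (tau b * tau a) i j" ..
qed simp_all

lemma tau_tau [simp]: "a \<in> M \<Longrightarrow> tau (tau a) = a"
proof (rule M_eqI)
  fix i j assume a: "a \<in> M" and ij: "i < n" "j < n"
  have "ent (tau (tau a)) i j = (qd i * qi i) * (qd j * qi j) * ent a i j"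
    using ij n_pos qd_flip[of i] qi_flip[of j] by (simp add: ent_tau ac_simps)
  then show "ent (tau (tau a)) i j = ent a i j" by (simp add: qd_qi)
qed simp_all

lemma tau_1 [simp]: "tau 1 = 1"
proof (rule M_eqI)
  fix i j assume ij: "i < n" "j < n"
  show "ent (tau 1) i j = ent 1 i j"
  proof (cases "i = j")
    case True
    then show ?thesis using ij qd_qi[of j] by (simp add: ent_tau ent_1 mult.commute)
  next
    case False
    then have "n - 1 - j \<noteq> n - 1 - i" using ij by linarith
    then show ?thesis using ij False by (simp add: ent_tau ent_1)
  qed
qed simp_all

lemma tau_uminus: "tau (- a) = - tau a"
  using tau_add[of a "- a"] by (simp add: tau_0 eq_neg_iff_add_eq_0 add.commute)

lemma tau_diff: "tau (a - b) = tau a - tau b"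
  using tau_add[of a "- b"] by (simp add: tau_uminus)

lemma tr_tau: "tr (tau a) = tr a"
proof -
  have "tr (tau a) = (\<Sum>i<n. ent a (n - 1 - i) (n - 1 - i))"
    unfolding tr_def
  proof (rule sum.cong[OF refl])
    fix i assume "i \<in> {..<n}"
    then show "ent (tau a) i i = ent a (n - 1 - i) (n - 1 - i)"
      using qd_qi[of i] by (simp add: ent_tau mult.commute[of "qi i"])
  qed
  also have "\<dots> = tr a"
    unfolding tr_def
    by (rule sum.reindex_bij_witness[of _ "\<lambda>k. n - 1 - k" "\<lambda>k. n - 1 - k"]) auto
  finally show ?thesis .
qed

lemma tau_NN [simp]: "a \<in> NN \<Longrightarrow> tau a \<in> NN"
  by (rule NN_I) (simp_all add: ent_tau NN_D)

lemma tau_BB [simp]: "a \<in> BB \<Longrightarrow> tau a \<in> BB"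
  by (rule BB_I) (simp_all add: ent_tau BB_D)

lemma tau_ff: "tau ff = ff"
proof (rule M_eqI)
  fix i j assume ij: "i < n" "j < n"
  show "ent (tau ff) i j = ent ff i j"
  proof (cases "i = Suc j")
    case True
    have f: "n - 1 - j = Suc (n - 1 - i)" using ij True by simp
    have "ent (tau ff) i j = qi i * qd j * c (n - 1 - i)"
      using ij f by (simp add: ent_tau ent_ff)
    moreover have "qd j * c (n - 1 - i) = qd i * c j"
    proof -
      have "hh j = c j * hh i" using hh_step[of j] True ij by simp
      moreover have "hh (n - 1 - i) = c (n - 1 - i) * hh (n - 1 - j)"
        using hh_step[of "n - 1 - i"] f ij by simp
      ultimately show ?thesis by (simp add: qd_def ac_simps)
    qed
    ultimately have "ent (tau ff) i j = qi i * (qd i * c j)" by (simp only: mult.assoc)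
    then have "ent (tau ff) i j = (qd i * qi i) * c j" by (simp only: ac_simps)
    then show ?thesis using ij True by (simp add: qd_qi ent_ff)
  next
    case False
    then have "n - 1 - j \<noteq> Suc (n - 1 - i)" using ij by linarith
    then show ?thesis using ij False by (simp add: ent_tau ent_ff)
  qed
qed simp_all

lemma tau_XX [simp]: "x \<in> XX \<Longrightarrow> tau x \<in> XX"
  using tau_BB[OF XX_D, of x] by (intro XX_I) (simp_all add: tau_diff tau_ff)

lemma tau_Em: "tau (Em 0 (n - 1)) = Em 0 (n - 1)"
proof (rule M_eqI)
  fix i j assume ij: "i < n" "j < n"
  have e: "qi 0 * qd (n - 1) = 1" using qd_flip[OF n_pos] qd_qi[of 0] by (simp add: mult.commute)
  show "ent (tau (Em 0 (n - 1))) i j = ent (Em 0 (n - 1)) i j"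
  proof (cases "i = 0 \<and> j = n - 1")
    case True
    then show ?thesis using ij e by (simp add: ent_tau ent_Em)
  next
    case False
    then have "\<not> (n - 1 - j = 0 \<and> n - 1 - i = n - 1)" using ij by linarith
    then show ?thesis using ij False by (auto simp add: ent_tau ent_Em)
  qed
qed simp_all

text \<open>Strictly upper triangular matrices annihilate the corner matrix from both sides. Hence
  conjugates of tau by elements of U fix it just as tau does.\<close>

lemma UU_Em: assumes "u \<in> UU" shows "u * Em 0 (n - 1) = Em 0 (n - 1)" "Em 0 (n - 1) * u = Em 0 (n - 1)"
proof -
  obtain a where a: "a \<in> NN" "u = 1 + a" using assms by (rule UU_E)
  have "a * Em 0 (n - 1) = 0"
    by (rule M_eqI) (use a NN_D[OF a(1), of _ 0] n_pos in \<open>auto simp: ent_mult ent_Em intro!: sum.neutral\<close>)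
  moreover have "Em 0 (n - 1) * a = 0"
    by (rule M_eqI) (use a NN_D[OF a(1), of "n - 1"] n_pos in \<open>auto simp: ent_mult ent_Em intro!: sum.neutral\<close>)
  ultimately show "u * Em 0 (n - 1) = Em 0 (n - 1)" "Em 0 (n - 1) * u = Em 0 (n - 1)"
    unfolding a(2) by (simp_all only: distrib_left distrib_right mult_1_left mult_1_right add_0_right)
qed

lemma tau_GL [simp]: "a \<in> GL \<Longrightarrow> tau a \<in> GL" and tau_iv: "a \<in> GL \<Longrightarrow> tau (iv a) = iv (tau a)"
proof -
  assume a: "a \<in> GL"
  have e: "tau a * tau (iv a) = 1" "tau (iv a) * tau a = 1"
    using a by (simp_all flip: tau_mult)
  show "tau a \<in> GL" by (rule GL_I[OF _ _ e]) (use a in simp_all)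
  show "tau (iv a) = iv (tau a)" using iv_eq[OF e] by simp
qed

lemma tau_UU [simp]: "u \<in> UU \<Longrightarrow> tau u \<in> UU"
  by (erule UU_E) (simp add: tau_add)

lemma theta_tau: "u \<in> M \<Longrightarrow> theta (tau u) = theta u"
proof -
  assume u: "u \<in> M"
  have "tr (ff * tau u) = tr (tau (u * ff))" using u by (simp add: tau_mult tau_ff)
  then show ?thesis using u by (simp add: theta_def tr_tau tr_comm[of u ff])
qed

lemma cg_tau: "cg z a b \<Longrightarrow> cg z (tau a) (tau b)"
  unfolding cg_def by (metis tau_sc_mult)

text \<open>Lets tau act on \<open>SL_n\<close>. The determinants of the two antidiagonal factors
  cancel since \<open>Q' * Q = 1\<close>, and T is the transpose.\<close>

lemma det_tau: assumes "a \<in> M" shows "det (ma (tau a)) = det (ma a)"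
proof -
  define Q where "Q = (mt (\<lambda>k j. if k = n - 1 - j then qd j else 0) :: 'r endo)"
  define Q' where "Q' = (mt (\<lambda>i k. if k = n - 1 - i then qi i else 0) :: 'r endo)"
  define T where "T = (mt (\<lambda>i j. ent a j i) :: 'r endo)"
  have MQ: "Q \<in> M" "Q' \<in> M" "T \<in> M" by (simp_all add: Q_def Q'_def T_def)
  have flip: "n - 1 - i < n" for i using n_pos by simp
  have Q: "ent (b * Q) i j = ent b i (n - 1 - j) * qd j" if "b \<in> M" "i < n" "j < n" for b i j
  proof -
    have "ent (b * Q) i j = (\<Sum>k<n. if k = n - 1 - j then ent b i k * qd j else 0)"
      using that MQ by (simp add: ent_mult Q_def ent_mt if_distrib cong: if_cong)
    then show ?thesis using flip by simp
  qed
  have Q': "ent (Q' * b) i j = qi i * ent b (n - 1 - i) j" if "b \<in> M" "i < n" "j < n" for b i j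
  proof -
    have "ent (Q' * b) i j = (\<Sum>k<n. if k = n - 1 - i then qi i * ent b k j else 0)"
      using that MQ by (simp add: ent_mult Q'_def ent_mt if_distrib if_distribR cong: if_cong)
    then show ?thesis using flip by simp
  qed
  have "tau a = Q' * (T * Q)"
    by (rule M_eqI) (use MQ flip in \<open>simp_all add: Q' Q ent_tau T_def ent_mt ac_simps\<close>)
  then have "det (ma (tau a)) = det (ma Q') * (det (ma T) * det (ma Q))"
    using MQ by (simp add: ma_mult det_mult[OF ma_carrier ma_carrier] det_mult[OF ma_carrier mult_carrier_mat[OF ma_carrier ma_carrier]])
  also have "\<dots> = det (ma T) * det (ma (Q' * Q))"
    using MQ by (simp add: ma_mult det_mult[OF ma_carrier ma_carrier] ac_simps)
  also have "Q' * Q = 1"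
  proof (rule M_eqI)
    fix i j assume ij: "i < n" "j < n"
    have "ent (Q' * Q) i j = qi i * (if n - 1 - i = n - 1 - j then qd j else 0)"
      using MQ ij flip by (simp add: Q') (simp add: Q_def ent_mt)
    also have "(n - 1 - i = n - 1 - j) = (i = j)" using ij by linarith
    finally show "ent (Q' * Q) i j = ent 1 i j" using qd_qi[of j] by (simp add: ent_1 mult.commute)
  qed (use MQ in simp_all)
  also have "ma T = transpose_mat (ma a)"
    by (auto simp: T_def ent_mt)
  finally show ?thesis by (simp add: ma_1 det_transpose[OF ma_carrier])
qed

text \<open>An explicit form of the similarity of a matrix to its transpose. Let e be the first
  basis vector. Elements y of the commutant of x are determined by \<open>y e\<close>, so
  \<open>y e\<close> to \<open>tau y e\<close> defines a linear map u. Applying it to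
  \<open>x * P j\<close>, where \<open>P j\<close> is the polynomial in x whose first column is the
  j-th basis vector, gives \<open>u * x = tau x * u\<close>. As u fixes e,
  \<open>triangular_intertwiner\<close> makes it unitriangular.\<close>

lemma tau_conj:
  assumes x: "x \<in> XX"
  obtains u where "u \<in> UU" "tau x = u * x * iv u"
proof -
  have "\<exists>P. \<forall>j. P j \<in> RX x \<and> (\<forall>i<n. ent (P j) i 0 = (if i = j then 1 else 0))"
    using RX_col[OF x, of "\<lambda>i. if i = j then 1 else 0" for j] by (intro choice) blast
  then obtain P where P: "\<And>j. P j \<in> RX x" "\<And>i j. i < n \<Longrightarrow> ent (P j) i 0 = (if i = j then 1 else 0)"
    by blast
  have PM: "P j \<in> M" for j by (rule RX_M[OF P(1) x])
  have xP: "x * P j = P j * x" for j by (rule RX_commute_self[OF P(1)])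
  define u where "u = mt (\<lambda>i j. ent (tau (P j)) i 0)"
  have uM: "u \<in> M" by (simp add: u_def)
  have commutant: "y = (\<Sum>j<n. sc (ent y j 0) * P j)" if y: "y \<in> M" "x * y = y * x" for y
  proof -
    let ?d = "y - (\<Sum>j<n. sc (ent y j 0) * P j)"
    have "cg 1 ?d 0"
    proof (rule commutant_XX[OF x])
      show "?d \<in> M" using y PM by simp
      have "x * (\<Sum>j<n. sc (ent y j 0) * P j) = (\<Sum>j<n. sc (ent y j 0) * P j) * x"
        unfolding sum_distrib_left sum_distrib_right
        by (rule sum.cong) (simp_all add: sc_left_commute[of x] xP mult.assoc)
      then show "cg 1 (?d * x) (x * ?d)" using y by (simp add: cg_def algebra_simps)
      show "1 * ent ?d i 0 = 0" if "i < n" for i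
      proof -
        have e: "ent (P j) i 0 = (if i = j then 1 else 0)" for j using P(2) that by simp
        show ?thesis using that by (simp add: e if_distrib cong: if_cong)
      qed
    qed
    then show ?thesis by (simp add: cg_def sc_1)
  qed
  have col: "ent (tau y) i 0 = (\<Sum>j<n. ent u i j * ent y j 0)" if y: "y \<in> M" "x * y = y * x" and i: "i < n" for y i
  proof -
    have "tau y = (\<Sum>j<n. sc (ent y j 0) * tau (P j))"
      by (subst commutant[OF y]) (simp add: tau_sum tau_sc_mult)
    then have "ent (tau y) i 0 = (\<Sum>j<n. ent y j 0 * ent (tau (P j)) i 0)" by simp
    also have "\<dots> = (\<Sum>j<n. ent u i j * ent y j 0)"
      using i by (simp add: u_def ent_mt mult.commute)
    finally show ?thesis .
  qed
  have ux: "u * x = tau x * u"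
  proof (rule M_eqI)
    fix i j assume ij: "i < n" "j < n"
    have xc: "ent (x * P j) k 0 = ent x k j" if "k < n" for k
    proof -
      have "ent (x * P j) k 0 = (\<Sum>q<n. ent x k q * ent (P j) q 0)"
        using that x PM n_pos by (simp add: ent_mult)
      also have "\<dots> = (\<Sum>q<n. if q = j then ent x k j else 0)"
        by (rule sum.cong) (use P(2) in auto)
      finally show ?thesis using ij by simp
    qed
    have "ent (u * x) i j = (\<Sum>k<n. ent u i k * ent (x * P j) k 0)"
      using uM x ij by (simp add: ent_mult xc)
    also have "\<dots> = ent (tau (x * P j)) i 0"
    proof (rule col[symmetric])
      show "x * (x * P j) = x * P j * x" by (simp only: xP[symmetric] mult.assoc)
    qed (use PM x ij in simp_all)
    also have "tau (x * P j) = tau x * tau (P j)" using PM x by (simp add: xP tau_mult)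
    also have "ent (tau x * tau (P j)) i 0 = ent (tau x * u) i j"
      using ij n_pos uM by (simp add: ent_mult u_def ent_mt)
    finally show "ent (u * x) i j = ent (tau x * u) i j" .
  qed (use uM x in simp_all)
  have u0: "ent u i 0 = (if i = 0 then 1 else 0)" if "i < n" for i
  proof -
    have "(\<Sum>j<n. ent u i j * ent 1 j 0) = (\<Sum>j<n. if j = 0 then ent u i 0 else 0)"
      by (rule sum.cong) (simp_all add: ent_1)
    then show ?thesis using col[of 1 i] that n_pos by (simp add: ent_1)
  qed
  have tri: "1 * ent u i j = (if i = j then 1 else 0)" if "i < n" "j < n" "j \<le> i" for i j
    by (rule triangular_intertwiner[OF x tau_XX[OF x] uM _ _ that]) (use ux u0 in simp_all)
  have u: "u \<in> UU" by (rule UU_I[OF uM], rule NN_I) (use tri uM in \<open>simp_all add: ent_1\<close>)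
  have "u * x * iv u = tau x" unfolding ux using u by (simp add: mult.assoc)
  with u that show ?thesis by metis
qed

end

section \<open>Bi-equivariant functions\<close>

context trunc begin

text \<open>Unnormalised Fourier coefficient on \<open>K^m\<close> at the character of x. The sum
  runs over parameters, each group element occurring equally often.\<close>

definition AA :: "'r endo \<Rightarrow> ('r endo \<Rightarrow> complex) \<Rightarrow> complex" where
  "AA x G = (\<Sum>y\<in>M. phi (- (t ^ mm * tr (x * y))) * G (LL y))"

lemma LL_mult: "LL y * LL z = LL (y + z)"
proof -
  have "sc (t ^ mm) * (y * (sc (t ^ mm) * z)) = 0"
    using rm by (simp add: sc_left_commute[of y] sc_sc sc_t_0 flip: power_add)
  then show ?thesis by (simp add: distrib_left distrib_right mult.assoc add.assoc)
qed

lemma AA_cong: "(\<And>y. y \<in> M \<Longrightarrow> G (LL y) = H (LL y)) \<Longrightarrow> AA x G = AA x H"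
  unfolding AA_def by (rule sum.cong) simp_all

lemma AA_mult: "AA x (\<lambda>k. d * G k) = d * AA x G"
  by (simp add: AA_def sum_distrib_left mult.left_commute)

lemma AA_sum: "AA x (\<lambda>k. \<Sum>i\<in>S. G i k) = (\<Sum>i\<in>S. AA x (G i))"
  unfolding AA_def sum_distrib_left by (rule sum.swap)

lemma AA_cg: "cg (t ^ mm) x x' \<Longrightarrow> AA x = AA x'"
  by (rule ext) (simp add: AA_def cg_tr[OF cg_mult[OF _ cg_refl]])

lemma AA_shift:
  assumes y0: "y0 \<in> M"
  shows "AA x (\<lambda>k. G (k * LL y0)) = phi (t ^ mm * tr (x * y0)) * AA x G"
    "AA x (\<lambda>k. G (LL y0 * k)) = phi (t ^ mm * tr (x * y0)) * AA x G"
proof -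
  have "phi (t ^ mm * tr (x * y0)) * AA x G = (\<Sum>y\<in>M. phi (t ^ mm * tr (x * y0)) * (phi (- (t ^ mm * tr (x * y))) * G (LL y)))"
    by (simp add: AA_def sum_distrib_left)
  also have "\<dots> = (\<Sum>y\<in>M. phi (- (t ^ mm * tr (x * y))) * G (LL (y + y0)))"
  proof (rule sum.reindex_bij_witness[of _ "\<lambda>y. y + y0" "\<lambda>y. y - y0"])
    fix y :: "'r endo" assume "y \<in> M"
    have "t ^ mm * tr (x * (y - y0)) = t ^ mm * tr (x * y) - t ^ mm * tr (x * y0)"
      by (simp add: right_diff_distrib tr_diff)
    then have "- (t ^ mm * tr (x * (y - y0))) = t ^ mm * tr (x * y0) + - (t ^ mm * tr (x * y))" by simp
    then show "phi (- (t ^ mm * tr (x * (y - y0)))) * G (LL (y - y0 + y0)) =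
        phi (t ^ mm * tr (x * y0)) * (phi (- (t ^ mm * tr (x * y))) * G (LL y))"
      by (simp only: phi_add mult.assoc diff_add_cancel)
  qed (use y0 in simp_all)
  finally have e: "(\<Sum>y\<in>M. phi (- (t ^ mm * tr (x * y))) * G (LL (y + y0))) = phi (t ^ mm * tr (x * y0)) * AA x G" ..
  show "AA x (\<lambda>k. G (k * LL y0)) = phi (t ^ mm * tr (x * y0)) * AA x G"
    unfolding AA_def[of x "\<lambda>k. G (k * LL y0)"] LL_mult by (rule e)
  show "AA x (\<lambda>k. G (LL y0 * k)) = phi (t ^ mm * tr (x * y0)) * AA x G"
    unfolding AA_def[of x "\<lambda>k. G (LL y0 * k)"] LL_mult add.commute[of y0] by (rule e)
qed

lemma AA_conj:
  assumes u: "u \<in> GL" and x: "x \<in> M"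
  shows "AA x (\<lambda>k. G (iv u * k * u)) = AA (iv u * x * u) G"
  unfolding AA_def
proof (rule sum.reindex_bij_witness[of _ "\<lambda>y. u * y * iv u" "\<lambda>y. iv u * y * u"])
  fix y :: "'r endo" assume y: "y \<in> M"
  have e: "iv u * LL y * u = LL (iv u * y * u)"
    using K_conj[OF u, of "t ^ mm" y] u by (simp add: mult.assoc)
  have "tr (iv u * x * u * (iv u * y * u)) = tr (iv u * (x * y * u))" using u by (simp add: mult.assoc)
  also have "\<dots> = tr (x * y)" using u x y tr_comm[of "iv u" "x * y * u"] by (simp add: mult.assoc)
  finally show "phi (- (t ^ mm * tr (iv u * x * u * (iv u * y * u)))) * G (LL (iv u * y * u)) =
      phi (- (t ^ mm * tr (x * y))) * G (iv u * LL y * u)"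
    unfolding e by simp
qed (use u in \<open>simp_all add: mult.assoc\<close>)

text \<open>Fourier inversion at the identity. The constant is the number of characters counted by
  parameters times the number of parameters y with \<open>LL y = 1\<close>.\<close>

lemma AA_total:
  obtains N :: complex where "N \<noteq> 0" "\<And>G. (\<Sum>x\<in>M. AA x G) = N * G 1"
proof -
  let ?Z = "{y \<in> M. sc (t ^ mm) * y = 0}"
  have fz: "finite ?Z" by simp
  have "0 \<in> ?Z" by simp
  then have cz: "card ?Z \<noteq> 0" using fz by (metis card_0_eq empty_iff)
  have cm: "card (M :: 'r endo set) \<noteq> 0" using finite_M M_0 by (metis card_0_eq empty_iff)
  have "(\<Sum>x\<in>M. AA x G) = of_nat (card (M :: 'r endo set)) * of_nat (card ?Z) * G 1" for G
  proof -
    have "(\<Sum>x\<in>M. AA x G) = (\<Sum>y\<in>M. \<Sum>x\<in>M. phi (- (t ^ mm * tr (x * y))) * G (LL y))"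
      unfolding AA_def by (rule sum.swap)
    also have "\<dots> = (\<Sum>y\<in>M. if sc (t ^ mm) * y = 0 then of_nat (card (M :: 'r endo set)) * G 1 else 0)"
    proof (rule sum.cong[OF refl])
      fix y :: "'r endo" assume y: "y \<in> M"
      show "(\<Sum>x\<in>M. phi (- (t ^ mm * tr (x * y))) * G (LL y)) =
          (if sc (t ^ mm) * y = 0 then of_nat (card (M :: 'r endo set)) * G 1 else 0)"
      proof (cases "sc (t ^ mm) * y = 0")
        case True
        have "phi (- (t ^ mm * tr (x * y))) = 1" for x
        proof -
          have "t ^ mm * tr (x * y) = tr (x * (sc (t ^ mm) * y))"
            by (simp only: sc_left_commute[of x] tr_sc_mult)
          then show ?thesis by (simp add: True tr_0 phi_0)
        qed
        then show ?thesis using True by simp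
      next
        case False
        have "\<exists>x\<in>M. phi (t ^ mm * tr (y * x)) \<noteq> 1"
          using phi_trace_nondegenerate[OF y, of "t ^ mm"] False by blast
        then obtain x where x: "x \<in> M" "phi (t ^ mm * tr (y * x)) \<noteq> 1" by blast
        have "(\<Sum>x\<in>M. phi (- (t ^ mm * tr (x * y)))) = 0"
        proof (rule character_sum_zero[where a = "- x"])
          show "phi (- (t ^ mm * tr (- x * y))) \<noteq> 1"
            using x y by (simp add: tr_uminus tr_comm[of x y])
          fix w :: "'r endo" assume "w \<in> M"
          show "phi (- (t ^ mm * tr ((- x + w) * y))) = phi (- (t ^ mm * tr (- x * y))) * phi (- (t ^ mm * tr (w * y)))"
            by (simp only: distrib_right tr_add distrib_left minus_add_distrib phi_add)
        qed (use x in simp_all)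
        then show ?thesis using False by (simp add: sum_distrib_right[symmetric])
      qed
    qed
    also have "\<dots> = (\<Sum>y\<in>?Z. of_nat (card (M :: 'r endo set)) * G 1)"
      by (rule sum.inter_filter[symmetric]) simp
    finally show ?thesis by simp
  qed
  then show ?thesis using that[of "of_nat (card (M :: 'r endo set)) * of_nat (card ?Z)"] cz cm by simp
qed

end

context trunc_c begin

lemma K_conj_cg:
  assumes y: "y \<in> M" and i: "1 \<le> i" "l \<le> mm + i"
  shows "cg (t ^ mm) (iv (1 + sc (t ^ i) * y) * x * (1 + sc (t ^ i) * y)) x"
    "cg (t ^ mm) ((1 + sc (t ^ i) * y) * x * iv (1 + sc (t ^ i) * y)) x"
proof -
  obtain y' where y': "iv (1 + sc (t ^ i) * y) = 1 + sc (t ^ i) * y'" using K_iv[OF i(1) y] by metis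
  have "cg (t ^ mm) ((1 + sc (t ^ i) * b) * x * (1 + sc (t ^ i) * d)) (1 * x * 1)" for b d
    by (intro cg_mult cg_refl cg_plus_t i(2))
  then show "cg (t ^ mm) (iv (1 + sc (t ^ i) * y) * x * (1 + sc (t ^ i) * y)) x"
    "cg (t ^ mm) ((1 + sc (t ^ i) * y) * x * iv (1 + sc (t ^ i) * y)) x"
    unfolding y' by simp_all
qed

lemma cg_XX:
  assumes x: "x \<in> M" and h: "\<And>a. a \<in> NN \<Longrightarrow> phi (z * tr (x * a)) = phi (z * tr (ff * a))"
  shows "\<exists>xh\<in>XX. cg z x xh"
proof -
  have low: "z * ent (x - ff) i j = 0" if "i < n" "j < n" "j < i" for i j
  proof (rule NN_orthogonal)
    fix a assume "a \<in> NN"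
    then have "phi (z * tr (x * a) - z * tr (ff * a)) = 1" by (simp add: phi_diff_1 h)
    then show "phi (z * tr ((x - ff) * a)) = 1" by (simp add: left_diff_distrib tr_diff right_diff_distrib)
  qed (use x that in simp_all)
  define b where "b = mt (\<lambda>i j. if j < i then 0 else ent (x - ff) i j)"
  have b: "b \<in> BB" by (rule BB_I) (simp_all add: b_def ent_mt)
  have "cg z (x - ff) b" by (rule cg_I) (use x low in \<open>simp_all add: b_def ent_mt\<close>)
  then have "cg z (x - ff + ff) (b + ff)" by (rule cg_add) simp
  moreover have "b + ff \<in> XX" by (rule XX_I) (use b in simp_all)
  ultimately show ?thesis by auto
qed

end

section \<open>Fourier components on both sides under K^m\<close>

locale whittaker_function = trunc_c n t l p phi c for n and t :: "'r::{comm_ring_1,finite}" and l p phi c +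
  fixes F :: "'r endo \<Rightarrow> complex"
  assumes F_left: "g \<in> GL \<Longrightarrow> u \<in> UU \<Longrightarrow> F (u * g) = theta u * F g"
    and F_right: "g \<in> GL \<Longrightarrow> u \<in> UU \<Longrightarrow> F (g * u) = theta u * F g"
begin

definition DD :: "'r endo \<Rightarrow> 'r endo \<Rightarrow> 'r endo \<Rightarrow> complex" where
  "DD x x' g = AA x (\<lambda>k. AA x' (\<lambda>k'. F (k * g * k')))"

lemma DD_cg: "cg (t ^ mm) x y \<Longrightarrow> cg (t ^ mm) x' y' \<Longrightarrow> DD x x' = DD y y'"
  by (rule ext) (simp add: DD_def AA_cg)

lemma DD_L: assumes "y \<in> M" shows "DD x x' (LL y * g) = phi (t ^ mm * tr (x * y)) * DD x x' g"
  unfolding DD_def mult.assoc[symmetric, of _ "LL y" g]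
  by (rule AA_shift(1)[OF assms, of x "\<lambda>k. AA x' (\<lambda>k'. F (k * g * k'))"])

lemma DD_L': assumes "y \<in> M" shows "DD x x' (g * LL y) = phi (t ^ mm * tr (x' * y)) * DD x x' g"
proof -
  have "DD x x' (g * LL y) = AA x (\<lambda>k. phi (t ^ mm * tr (x' * y)) * AA x' (\<lambda>k'. F (k * g * k')))"
    unfolding DD_def
  proof (rule AA_cong)
    fix y' :: "'r endo"
    show "AA x' (\<lambda>k'. F (LL y' * (g * LL y) * k')) = phi (t ^ mm * tr (x' * y)) * AA x' (\<lambda>k'. F (LL y' * g * k'))"
      using AA_shift(2)[OF assms, of x' "\<lambda>k'. F (LL y' * g * k')"] by (simp only: mult.assoc)
  qed
  then show ?thesis by (simp only: AA_mult DD_def)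
qed

lemma DD_U:
  assumes u: "u \<in> UU" and g: "g \<in> GL" and x: "x \<in> M"
  shows "DD x x' (u * g) = theta u * DD (iv u * x * u) x' g"
proof -
  have uG: "u \<in> GL" using u by simp
  have "DD x x' (u * g) = AA x (\<lambda>k. theta u * AA x' (\<lambda>k'. F (iv u * k * u * g * k')))"
    unfolding DD_def
  proof (rule AA_cong)
    fix y :: "'r endo" assume y: "y \<in> M"
    have "AA x' (\<lambda>k'. F (LL y * (u * g) * k')) = AA x' (\<lambda>k'. theta u * F (iv u * LL y * u * g * k'))"
    proof (rule AA_cong)
      fix y' :: "'r endo" assume y': "y' \<in> M"
      have "LL y * (u * g) * LL y' = u * (iv u * LL y * u * g * LL y')"
        by (simp only: mult.assoc iv_cancel(3)[OF uG])
      moreover have "iv u * LL y * u * g * LL y' \<in> GL"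
        using y y' uG g by (intro GL_mult iv_GL LL_GL)
      ultimately show "F (LL y * (u * g) * LL y') = theta u * F (iv u * LL y * u * g * LL y')"
        using F_left u by simp
    qed
    then show "AA x' (\<lambda>k'. F (LL y * (u * g) * k')) = theta u * AA x' (\<lambda>k'. F (iv u * LL y * u * g * k'))"
      by (simp only: AA_mult)
  qed
  also have "\<dots> = theta u * AA x (\<lambda>k. AA x' (\<lambda>k'. F (iv u * k * u * g * k')))" by (rule AA_mult)
  also have "AA x (\<lambda>k. AA x' (\<lambda>k'. F (iv u * k * u * g * k'))) = DD (iv u * x * u) x' g"
    unfolding DD_def by (rule AA_conj[OF uG x, of "\<lambda>k. AA x' (\<lambda>k'. F (k * g * k'))"])
  finally show ?thesis .
qed

lemma DD_U':
  assumes u: "u \<in> UU" and g: "g \<in> GL" and x': "x' \<in> M"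
  shows "DD x x' (g * u) = theta u * DD x (u * x' * iv u) g"
proof -
  have uG: "u \<in> GL" "iv u \<in> GL" using u by simp_all
  have "DD x x' (g * u) = AA x (\<lambda>k. theta u * AA (u * x' * iv u) (\<lambda>k'. F (k * g * k')))"
    unfolding DD_def
  proof (rule AA_cong)
    fix y :: "'r endo" assume y: "y \<in> M"
    have "AA x' (\<lambda>k'. F (LL y * (g * u) * k')) = AA x' (\<lambda>k'. theta u * F (LL y * g * (iv (iv u) * k' * iv u)))"
    proof (rule AA_cong)
      fix y' :: "'r endo" assume y': "y' \<in> M"
      have "LL y * (g * u) * LL y' = LL y * g * (iv (iv u) * LL y' * iv u) * u"
        by (simp only: mult.assoc iv_iv[OF uG(1)] iv_cancel(2)[OF uG(1)] mult_1_right)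
      moreover have "LL y * g * (iv (iv u) * LL y' * iv u) \<in> GL"
        using y y' uG g by (intro GL_mult iv_GL LL_GL)
      ultimately show "F (LL y * (g * u) * LL y') = theta u * F (LL y * g * (iv (iv u) * LL y' * iv u))"
        using F_right u by simp
    qed
    also have "\<dots> = theta u * AA (iv (iv u) * x' * iv u) (\<lambda>k'. F (LL y * g * k'))"
      unfolding AA_mult AA_conj[OF uG(2) x', of "\<lambda>k'. F (LL y * g * k')"] ..
    finally show "AA x' (\<lambda>k'. F (LL y * (g * u) * k')) = theta u * AA (u * x' * iv u) (\<lambda>k'. F (LL y * g * k'))"
      using uG by simp
  qed
  then show ?thesis by (simp only: AA_mult DD_def)
qed

text \<open>An element of \<open>K^m\<close> to the left of g can be conjugated to its right. The
  two resulting factors must agree where the component is nonzero, and nondegeneracy of the trace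
  form turns this into a congruence.\<close>

lemma DD_intertwine:
  assumes x: "x \<in> M" "x' \<in> M" and g: "g \<in> GL" and nz: "DD x x' g \<noteq> 0"
  shows "cg (t ^ mm) (x * g) (g * x')"
proof -
  have "sc (t ^ mm) * (x - g * x' * iv g) = 0"
  proof (rule phi_trace_nondegenerate)
    fix y :: "'r endo" assume y: "y \<in> M"
    have yM: "iv g * y * g \<in> M" using y g by simp
    have "phi (t ^ mm * tr (x * y)) * DD x x' g = DD x x' (LL y * g)" by (rule DD_L[OF y, symmetric])
    also have "LL y * g = g * LL (iv g * y * g)" by (rule K_conj[OF g])
    also have "DD x x' (g * LL (iv g * y * g)) = phi (t ^ mm * tr (x' * (iv g * y * g))) * DD x x' g"
      by (rule DD_L'[OF yM])
    finally have "phi (t ^ mm * tr (x * y)) * DD x x' g = phi (t ^ mm * tr (x' * (iv g * y * g))) * DD x x' g" .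
    then have "phi (t ^ mm * tr (x * y)) = phi (t ^ mm * tr (x' * (iv g * y * g)))" using nz by simp
    moreover have "tr (x' * (iv g * y * g)) = tr (g * x' * iv g * y)"
      using tr_comm[of "x' * (iv g * y)" g] x y g by (simp add: mult.assoc)
    ultimately have "phi (t ^ mm * tr (x * y) - t ^ mm * tr (g * x' * iv g * y)) = 1"
      by (simp add: phi_diff_1)
    then show "phi (t ^ mm * tr ((x - g * x' * iv g) * y)) = 1"
      by (simp only: left_diff_distrib[of x] tr_diff right_diff_distrib)
  qed (use x g in simp)
  then have "cg (t ^ mm) x (g * x' * iv g)" by (simp add: cg_def right_diff_distrib)
  then have "cg (t ^ mm) (x * g) (g * x' * iv g * g)" by (rule cg_mult[OF _ cg_refl])
  then show ?thesis using g by (simp add: mult.assoc)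
qed

text \<open>On U intersected with \<open>K^m\<close> the component transforms both by theta and by
  the character of x; theta survives the passage to components because conjugation by
  \<open>K^m\<close> does not move x modulo the conductor. So x and \<open>ff\<close> agree against
  \<open>NN\<close>.\<close>

lemma DD_support:
  assumes x: "x \<in> M" "x' \<in> M" and g: "g \<in> GL" and nz: "DD x x' g \<noteq> 0"
  shows "\<exists>xh\<in>XX. cg (t ^ mm) x xh" "\<exists>xh\<in>XX. cg (t ^ mm) x' xh"
proof -
  have a: "theta (LL a) = phi (t ^ mm * tr (ff * a))" if "a \<in> NN" for a
    by (simp add: theta_one_plus sc_left_commute[of ff] tr_sc_mult)
  have l: "l \<le> mm + mm" using rm(5) by simp
  show "\<exists>xh\<in>XX. cg (t ^ mm) x xh"
  proof (rule cg_XX[OF x(1)])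
    fix b assume b: "b \<in> NN"
    have u: "LL b \<in> UU" using b by simp
    have "DD x x' (LL b * g) = theta (LL b) * DD x x' g"
      using DD_U[OF u g x(1)] DD_cg[OF K_conj_cg(1)[OF NN_M[OF b] rm(2) l] cg_refl] by simp
    then show "phi (t ^ mm * tr (x * b)) = phi (t ^ mm * tr (ff * b))"
      using DD_L[OF NN_M[OF b], of x x' g] nz a[OF b] by simp
  qed
  show "\<exists>xh\<in>XX. cg (t ^ mm) x' xh"
  proof (rule cg_XX[OF x(2)])
    fix b assume b: "b \<in> NN"
    have u: "LL b \<in> UU" using b by simp
    have "DD x x' (g * LL b) = theta (LL b) * DD x x' g"
      using DD_U'[OF u g x(2)] DD_cg[OF cg_refl K_conj_cg(2)[OF NN_M[OF b] rm(2) l]] by simp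
    then show "phi (t ^ mm * tr (x' * b)) = phi (t ^ mm * tr (ff * b))"
      using DD_L'[OF NN_M[OF b], of x x' g] nz a[OF b] by simp
  qed
qed

lemma DD_total:
  obtains N :: complex where "N \<noteq> 0" "\<And>g. (\<Sum>x\<in>M. \<Sum>x'\<in>M. DD x x' g) = N * F g"
proof -
  obtain N where N: "N \<noteq> 0" "\<And>G. (\<Sum>x\<in>M. AA x G) = N * G 1" using AA_total by blast
  have "(\<Sum>x\<in>M. \<Sum>x'\<in>M. DD x x' g) = N * N * F g" for g
  proof -
    have "(\<Sum>x'\<in>M. DD x x' g) = N * AA x (\<lambda>k. F (k * g))" for x
      unfolding DD_def AA_sum[symmetric] N(2) by (simp add: AA_mult)
    then show ?thesis by (simp add: sum_distrib_left[symmetric] N(2))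
  qed
  then show ?thesis using that[of "N * N"] N(1) by simp
qed

text \<open>With u from \<open>tau_conj\<close>, the map \<open>sg a = iv u * tau a * u\<close>
  fixes x. Its square is conjugation by a unipotent v that commutes with x; such a v fixes the
  cyclic first basis vector, hence is 1, and sg is an involution as \<open>core\<close> requires.
  Returning from sg to tau costs \<open>theta (iv u)\<close> and \<open>theta u\<close>, which
  cancel.\<close>

lemma DD_diagonal:
  assumes x: "x \<in> XX" and q: "q \<in> RX x" "q \<in> GL" and y: "y \<in> M"
  shows "DD (tau x) (tau x) (tau (KK y * q)) = DD x x (KK y * q)"
proof -
  obtain u where u: "u \<in> UU" "tau x = u * x * iv u" using tau_conj[OF x] .
  have uG: "u \<in> GL" using u by simp
  define sg where "sg a = iv u * tau a * u" for a
  have tu: "tau u \<in> UU" using u by simp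
  have sgx: "sg x = x" using uG by (simp add: sg_def u(2) mult.assoc)
  define v where "v = iv u * tau u"
  have v: "v \<in> UU" using u tu by (simp add: v_def)
  have sgsg: "sg (sg a) = v * a * iv v" if "a \<in> M" for a
    using that uG by (simp add: sg_def v_def tau_mult tau_iv iv_mult mult.assoc)
  have "v * x * iv v = x" using sgsg[of x] x sgx by simp
  then have "v * x * iv v * v = x * v" by simp
  then have vx: "v * x = x * v" using v by (simp add: mult.assoc)
  have "cg 1 (v - 1) 0"
  proof (rule commutant_XX[OF x])
    show "cg 1 ((v - 1) * x) (x * (v - 1))" using vx by (simp add: cg_def algebra_simps)
    show "1 * ent (v - 1) i 0 = 0" if "i < n" for i
      using NN_D[OF UU_D[OF v] that n_pos] by simp
  qed (use v in simp)
  then have v1: "v = 1" by (simp add: cg_def sc_1)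
  have conj: "theta (iv u) * theta u = 1" using u by (simp add: theta_iv)
  interpret core n t l p phi c x sg "DD x x"
  proof unfold_locales
    show "sg (sg a) = a" if "a \<in> M" for a using sgsg[OF that] v1 by simp
    show "tr (sg a) = tr a" if "a \<in> M" for a
      using tr_comm[of "iv u" "tau a * u"] uG by (simp add: sg_def mult.assoc tr_tau)
    show "sg a \<in> NN" if "a \<in> NN" for a using that u by (simp add: sg_def)
    show "sg (Em 0 (n - 1)) = Em 0 (n - 1)"
      using UU_Em(1)[OF UU_iv[OF u(1)]] UU_Em(2)[OF u(1)] by (simp only: sg_def tau_Em)
    show "sg (a + b) = sg a + sg b" for a b by (simp add: sg_def tau_add distrib_left distrib_right)
    show "sg (sc d * a) = sc d * sg a" for d a
      by (simp add: sg_def tau_sc_mult sc_left_commute[of "iv u"] mult.assoc)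
    show "sg 1 = 1" using uG by (simp add: sg_def)
    show "sg (a * b) = sg b * sg a" if "a \<in> M" "b \<in> M" for a b
      using that uG by (simp add: sg_def tau_mult mult.assoc)
    show "DD x x (KK a * g) = phi (t ^ rr * tr (ff * a)) * DD x x g" if "g \<in> GL" "a \<in> NN" for g a
      using DD_U[of "KK a" g x x] DD_cg[OF K_conj_cg(1)[OF NN_M[OF that(2)] rm(1)] cg_refl, of x x] x that rm
      by (simp add: theta_one_plus sc_left_commute[of ff] tr_sc_mult)
    show "DD x x (g * KK a) = phi (t ^ rr * tr (ff * a)) * DD x x g" if "g \<in> GL" "a \<in> NN" for g a
      using DD_U'[of "KK a" g x x] DD_cg[OF cg_refl K_conj_cg(2)[OF NN_M[OF that(2)] rm(1)], of x x] x that rm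
      by (simp add: theta_one_plus sc_left_commute[of ff] tr_sc_mult)
  qed (use x uG sgx in \<open>simp_all add: sg_def DD_L DD_L'\<close>)
  have tG: "tau (KK y * q) \<in> GL" using y q by simp
  have "DD x x (KK y * q) = DD x x (sg (KK y * q))" by (rule Psi_sg[OF q y, symmetric])
  also have "\<dots> = theta (iv u) * DD (iv (iv u) * x * iv u) x (tau (KK y * q) * u)"
    unfolding sg_def mult.assoc[of "iv u"] by (rule DD_U) (use u tG x in simp_all)
  also have "\<dots> = theta (iv u) * (theta u * DD (tau x) (u * x * iv u) (tau (KK y * q)))"
    using u tG x by (simp add: DD_U' u(2))
  also have "\<dots> = (theta (iv u) * theta u) * DD (tau x) (tau x) (tau (KK y * q))"
    by (simp only: u(2) mult.assoc)
  finally show ?thesis unfolding conj by simp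
qed

text \<open>In the decomposition of g the unipotent factor u carries x' to x. It contributes
  \<open>theta u\<close> to one side and \<open>theta (tau u)\<close> to the other, and these are
  equal; what is left is the diagonal case.\<close>

lemma DD_tau_XX:
  assumes x: "x \<in> XX" "x' \<in> XX" and g: "g \<in> GL" and c: "cg (t ^ mm) (x * g) (g * x')"
  shows "DD (tau x') (tau x) (tau g) = DD x x' g"
proof -
  have ml: "mm < l" using rm by linarith
  obtain q u y where d: "q \<in> RX x" "q \<in> GL" "u \<in> UU" "y \<in> M"
    "g = (1 + sc (t ^ (l - mm)) * y) * q * u" "cg (t ^ mm) (u * x') (x * u)"
    by (rule intertwiner_decomposition[OF x g ml c])
  have uG: "u \<in> GL" using d by simp
  define s where "s = KK y * q"
  have gs: "g = s * u" using d(5) rm(10) by (simp add: s_def)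
  have sG: "s \<in> GL" using d by (simp add: s_def)
  have "cg (t ^ mm) (u * x' * iv u) (x * u * iv u)" by (rule cg_mult[OF d(6) cg_refl])
  then have ux: "cg (t ^ mm) (u * x' * iv u) x" using uG by (simp add: mult.assoc)
  have tu: "tau u \<in> UU" "tau s \<in> GL" using d sG by simp_all
  have 1: "DD x x' g = theta u * DD x x s"
    unfolding gs using DD_U'[OF d(3) sG XX_M[OF x(2)]] DD_cg[OF cg_refl ux] by simp
  have "DD (tau x') (tau x) (tau g) = theta (tau u) * DD (iv (tau u) * tau x' * tau u) (tau x) (tau s)"
    using DD_U[OF tu tau_M] sG uG by (simp add: gs tau_mult)
  also have "iv (tau u) * tau x' * tau u = tau (u * x' * iv u)"
    using uG x by (simp add: tau_mult tau_iv mult.assoc)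
  also have "DD (tau (u * x' * iv u)) (tau x) (tau s) = DD (tau x) (tau x) (tau s)"
    using DD_cg[OF cg_tau[OF ux] cg_refl] by simp
  also have "\<dots> = DD x x s" unfolding s_def by (rule DD_diagonal[OF x(1) d(1,2,4)])
  finally show ?thesis using 1 uG by (simp add: theta_tau)
qed

text \<open>Nonvanishing of either side forces x and x' into f + b up to congruence and makes g
  intertwine them; components depend only on congruence classes, so representatives in
  \<open>XX\<close> may be used.\<close>

lemma DD_tau:
  assumes x: "x \<in> M" "x' \<in> M" and g: "g \<in> GL"
  shows "DD (tau x') (tau x) (tau g) = DD x x' g"
proof (cases "DD x x' g = 0 \<and> DD (tau x') (tau x) (tau g) = 0")
  case False
  have "(\<exists>xh\<in>XX. cg (t ^ mm) x xh) \<and> (\<exists>xh\<in>XX. cg (t ^ mm) x' xh) \<and> cg (t ^ mm) (x * g) (g * x')"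
  proof (cases "DD x x' g = 0")
    case True
    with False have nz: "DD (tau x') (tau x) (tau g) \<noteq> 0" by simp
    have tg: "tau g \<in> GL" using g by simp
    have "\<exists>xh\<in>XX. cg (t ^ mm) y xh" if ty: "\<exists>xh\<in>XX. cg (t ^ mm) (tau y) xh" and y: "y \<in> M" for y
    proof -
      obtain xh where h: "xh \<in> XX" "cg (t ^ mm) (tau y) xh" using ty by blast
      have "cg (t ^ mm) y (tau xh)" using cg_tau[OF h(2)] y by simp
      then show ?thesis using h(1) by (intro bexI[of _ "tau xh"]) simp_all
    qed
    moreover have "cg (t ^ mm) (x * g) (g * x')"
      using cg_tau[OF DD_intertwine[OF tau_M tau_M tg nz]] x g by (simp add: tau_mult cg_sym)
    ultimately show ?thesis using DD_support[OF tau_M tau_M tg nz] x by blast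
  next
    case False
    then show ?thesis using DD_support[OF x g False] DD_intertwine[OF x g False] by blast
  qed
  then obtain xh xh' where h: "xh \<in> XX" "cg (t ^ mm) x xh" "xh' \<in> XX" "cg (t ^ mm) x' xh'"
    and c: "cg (t ^ mm) (x * g) (g * x')" by blast
  have "cg (t ^ mm) (xh * g) (x * g)" by (rule cg_mult[OF cg_sym[OF h(2)] cg_refl])
  also note c
  also have "cg (t ^ mm) (g * x') (g * xh')" by (rule cg_mult[OF cg_refl h(4)])
  finally have "DD (tau xh') (tau xh) (tau g) = DD xh xh' g" by (intro DD_tau_XX h g)
  then show ?thesis using DD_cg[OF h(2) h(4)] DD_cg[OF cg_tau[OF h(4)] cg_tau[OF h(2)]] by simp
qed simp

theorem F_tau: assumes g: "g \<in> GL" shows "F (tau g) = F g"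
proof -
  obtain N where N: "N \<noteq> 0" "\<And>g. (\<Sum>x\<in>M. \<Sum>x'\<in>M. DD x x' g) = N * F g" using DD_total by blast
  have "N * F g = (\<Sum>x\<in>M. \<Sum>x'\<in>M. DD (tau x') (tau x) (tau g))"
    unfolding N(2)[symmetric] by (intro sum.cong refl) (simp add: DD_tau[OF _ _ g])
  also have "\<dots> = (\<Sum>x'\<in>M. \<Sum>x\<in>M. DD (tau x') (tau x) (tau g))" by (rule sum.swap)
  also have "\<dots> = (\<Sum>x'\<in>M. \<Sum>x\<in>M. DD (tau x') x (tau g))"
    by (intro sum.cong refl sum.reindex_bij_witness[of _ tau tau]) simp_all
  also have "\<dots> = (\<Sum>x'\<in>M. \<Sum>x\<in>M. DD x' x (tau g))"
    by (rule sum.reindex_bij_witness[of _ tau tau]) simp_all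
  also have "\<dots> = N * F (tau g)" by (rule N(2))
  finally show ?thesis using N(1) by simp
qed

end

section \<open>Sums of complex vectors, and eigenvectors in subspaces\<close>

definition vsum :: "nat \<Rightarrow> 'i set \<Rightarrow> ('i \<Rightarrow> complex vec) \<Rightarrow> complex vec" where
  "vsum d S f = vec d (\<lambda>i. \<Sum>s\<in>S. f s $ i)"

lemma vsum_carrier [simp]: "vsum d S f \<in> carrier_vec d" and vsum_dim [simp]: "dim_vec (vsum d S f) = d"
  by (simp_all add: vsum_def)

lemma vsum_index [simp]: "i < d \<Longrightarrow> vsum d S f $ i = (\<Sum>s\<in>S. f s $ i)"
  by (simp add: vsum_def)

lemma vsum_cong: "(\<And>s. s \<in> S \<Longrightarrow> f s = g s) \<Longrightarrow> vsum d S f = vsum d S g"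
  by (auto simp: vsum_def intro!: eq_vecI sum.cong)

lemma vsum_zero: "vsum d S (\<lambda>s. 0\<^sub>v d) = 0\<^sub>v d"
  by (rule eq_vecI) simp_all

lemma vsum_insert:
  assumes "finite S" "a \<notin> S" "f a \<in> carrier_vec d"
  shows "vsum d (insert a S) f = f a + vsum d S f"
  using assms by (intro eq_vecI) simp_all

lemma vsum_add:
  assumes "\<And>s. s \<in> S \<Longrightarrow> f s \<in> carrier_vec d" "\<And>s. s \<in> S \<Longrightarrow> g s \<in> carrier_vec d"
  shows "vsum d S (\<lambda>s. f s + g s) = vsum d S f + vsum d S g"
proof (rule eq_vecI)
  fix i assume "i < dim_vec (vsum d S f + vsum d S g)"
  then have i: "i < d" by simp
  have "(\<Sum>s\<in>S. (f s + g s) $ i) = (\<Sum>s\<in>S. f s $ i + g s $ i)"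
    by (rule sum.cong) (use assms[THEN carrier_vecD] i in auto)
  then show "vsum d S (\<lambda>s. f s + g s) $ i = (vsum d S f + vsum d S g) $ i"
    using i by (simp add: sum.distrib)
qed simp

lemma vsum_smult:
  assumes "\<And>s. s \<in> S \<Longrightarrow> f s \<in> carrier_vec d"
  shows "vsum d S (\<lambda>s. k \<cdot>\<^sub>v f s) = k \<cdot>\<^sub>v vsum d S f"
proof (rule eq_vecI)
  fix i assume "i < dim_vec (k \<cdot>\<^sub>v vsum d S f)"
  then have i: "i < d" by simp
  have "(\<Sum>s\<in>S. (k \<cdot>\<^sub>v f s) $ i) = (\<Sum>s\<in>S. k * f s $ i)"
    by (rule sum.cong) (use assms[THEN carrier_vecD] i in auto)
  then show "vsum d S (\<lambda>s. k \<cdot>\<^sub>v f s) $ i = (k \<cdot>\<^sub>v vsum d S f) $ i"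
    using i by (simp add: sum_distrib_left)
qed simp

lemma vsum_coeff_smult:
  assumes "w \<in> carrier_vec d"
  shows "vsum d S (\<lambda>s. k s \<cdot>\<^sub>v w) = (\<Sum>s\<in>S. k s) \<cdot>\<^sub>v w"
  by (rule eq_vecI) (use assms in \<open>auto simp: sum_distrib_right\<close>)

lemma vsum_reindex:
  assumes "\<And>a. a \<in> S \<Longrightarrow> i (j a) = a" "\<And>a. a \<in> S \<Longrightarrow> j a \<in> T"
    "\<And>b. b \<in> T \<Longrightarrow> j (i b) = b" "\<And>b. b \<in> T \<Longrightarrow> i b \<in> S" "\<And>a. a \<in> S \<Longrightarrow> h (j a) = g a"
  shows "vsum d S g = vsum d T h"
  unfolding vsum_def
proof (rule eq_vecI, simp_all)
  fix k assume "k < d"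
  show "(\<Sum>s\<in>S. g s $ k) = (\<Sum>s\<in>T. h s $ k)"
    by (rule sum.reindex_bij_witness[of S i j T]) (use assms in auto)
qed

lemma vsum_swap: "vsum d S (\<lambda>s. vsum d T (f s)) = vsum d T (\<lambda>t. vsum d S (\<lambda>s. f s t))"
proof (rule eq_vecI, simp_all)
  fix i assume "i < d"
  show "(\<Sum>s\<in>S. \<Sum>t\<in>T. f s t $ i) = (\<Sum>t\<in>T. \<Sum>s\<in>S. f s t $ i)" by (rule sum.swap)
qed

lemma linear_vsum:
  assumes add: "\<And>v w. v \<in> carrier_vec d \<Longrightarrow> w \<in> carrier_vec d \<Longrightarrow> L (v + w) = L v + (L w :: complex)"
    and smult: "\<And>k v. v \<in> carrier_vec d \<Longrightarrow> L (k \<cdot>\<^sub>v v) = k * L v"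
    and S: "finite S" "\<And>s. s \<in> S \<Longrightarrow> f s \<in> carrier_vec d"
  shows "L (vsum d S f) = (\<Sum>s\<in>S. L (f s))"
  using S
proof (induction S rule: finite_induct)
  case empty
  have "0 \<cdot>\<^sub>v 0\<^sub>v d = (0\<^sub>v d :: complex vec)" by (rule eq_vecI) simp_all
  then have "L (0\<^sub>v d) = 0" using smult[of "0\<^sub>v d" 0] by simp
  moreover have "vsum d {} f = 0\<^sub>v d" by (rule eq_vecI) simp_all
  ultimately show ?case by simp
next
  case (insert a S)
  then show ?case using add[of "f a" "vsum d S f"] by (simp add: vsum_insert)
qed

lemma mult_mat_vec_vsum:
  assumes A: "A \<in> carrier_mat d d" and S: "finite S" "\<And>s. s \<in> S \<Longrightarrow> f s \<in> carrier_vec d"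
  shows "A *\<^sub>v vsum d S f = vsum d S (\<lambda>s. A *\<^sub>v f s)"
proof (rule eq_vecI)
  fix i assume "i < dim_vec (vsum d S (\<lambda>s. A *\<^sub>v f s))"
  then have i: "i < d" by simp
  have "(A *\<^sub>v vsum d S f) $ i = (\<Sum>s\<in>S. (A *\<^sub>v f s) $ i)"
    by (rule linear_vsum[where L = "\<lambda>v. (A *\<^sub>v v) $ i"])
      (use A i S in \<open>auto simp: mult_add_distrib_mat_vec mult_mat_vec\<close>)
  then show "(A *\<^sub>v vsum d S f) $ i = vsum d S (\<lambda>s. A *\<^sub>v f s) $ i" using i by simp
qed (use A in simp)

text \<open>The d + 1 vectors become the columns of a square matrix whose last row is zero, so its
  determinant vanishes. The kernel vector is stored as the coefficients of a polynomial, ready to be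
  factored.\<close>

lemma ex_linear_dependency:
  assumes u: "\<And>j. u j \<in> carrier_vec d"
  obtains p :: "complex poly" where "p \<noteq> 0" "degree p \<le> d" "vsum d {..d} (\<lambda>j. coeff p j \<cdot>\<^sub>v u j) = 0\<^sub>v d"
proof -
  define A where "A = mat (Suc d) (Suc d) (\<lambda>(i, j). if i < d then u j $ i else 0)"
  have A: "A \<in> carrier_mat (Suc d) (Suc d)" by (simp add: A_def)
  have "A\<^sup>T *\<^sub>v unit_vec (Suc d) d = 0\<^sub>v (Suc d)"
  proof (rule eq_vecI)
    fix i assume "i < dim_vec (0\<^sub>v (Suc d) :: complex vec)"
    then have i: "i < Suc d" by simp
    have "(A\<^sup>T *\<^sub>v unit_vec (Suc d) d) $ i = col A i $ d"
      using i A by (simp add: A_def)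
    then show "(A\<^sup>T *\<^sub>v unit_vec (Suc d) d) $ i = 0\<^sub>v (Suc d) $ i" using i by (simp add: A_def)
  qed (use A in simp)
  moreover have "unit_vec (Suc d) d \<noteq> (0\<^sub>v (Suc d) :: complex vec)"
  proof
    assume "unit_vec (Suc d) d = (0\<^sub>v (Suc d) :: complex vec)"
    then have "unit_vec (Suc d) d $ d = (0\<^sub>v (Suc d) :: complex vec) $ d" by simp
    then show False by simp
  qed
  ultimately have "det A\<^sup>T = 0"
    using det_0_iff_vec_prod_zero_field[of "A\<^sup>T" "Suc d"] A by (metis transpose_carrier_mat unit_vec_carrier)
  then have "det A = 0" using det_transpose[OF A] by simp
  then obtain v where v: "v \<in> carrier_vec (Suc d)" "v \<noteq> 0\<^sub>v (Suc d)" "A *\<^sub>v v = 0\<^sub>v (Suc d)"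
    using det_0_iff_vec_prod_zero_field[OF A] by blast
  define p where "p = (\<Sum>j\<le>d. monom (v $ j) j)"
  have cp: "coeff p j = (if j \<le> d then v $ j else 0)" for j
    by (simp add: p_def coeff_sum)
  show ?thesis
  proof
    show "p \<noteq> 0"
    proof
      assume "p = 0"
      then have "v $ j = 0" if "j < Suc d" for j using cp[of j] that by simp
      then have "v = 0\<^sub>v (Suc d)" using v(1) by (intro eq_vecI) simp_all
      with v(2) show False by simp
    qed
    show "degree p \<le> d" by (rule degree_le) (simp add: cp)
    show "vsum d {..d} (\<lambda>j. coeff p j \<cdot>\<^sub>v u j) = 0\<^sub>v d"
    proof (rule eq_vecI)
      fix i assume "i < dim_vec (0\<^sub>v d :: complex vec)"
      then have i: "i < d" by simp
      have "(\<Sum>j\<le>d. (coeff p j \<cdot>\<^sub>v u j) $ i) = (\<Sum>j<Suc d. u j $ i * v $ j)"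
        unfolding lessThan_Suc_atMost using i u[THEN carrier_vecD] by (intro sum.cong) (simp_all add: cp)
      also have "\<dots> = (A *\<^sub>v v) $ i"
        using i v(1) by (simp add: A_def scalar_prod_def lessThan_atLeast0)
      finally show "vsum d {..d} (\<lambda>j. coeff p j \<cdot>\<^sub>v u j) $ i = 0\<^sub>v d $ i" using i v(3) by simp
    qed simp
  qed
qed

text \<open>A polynomial p with \<open>p(X) v = 0\<close> is stripped of linear factors. If
  \<open>(X - z) q(X) v = 0\<close>, then \<open>q(X) v\<close> is an eigenvector, or it is zero and
  q annihilates v in smaller degree; a nonzero constant does not annihilate v. The form with a
  stable subspace W is needed for the image of the theta-projection.\<close>

lemma ex_eigenvector:
  fixes X :: "complex vec \<Rightarrow> complex vec"
  assumes W: "W \<subseteq> carrier_vec d" "\<And>v w. v \<in> W \<Longrightarrow> w \<in> W \<Longrightarrow> v + w \<in> W" "\<And>k v. v \<in> W \<Longrightarrow> k \<cdot>\<^sub>v v \<in> W"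
    and X: "\<And>v. v \<in> W \<Longrightarrow> X v \<in> W" "\<And>v w. v \<in> W \<Longrightarrow> w \<in> W \<Longrightarrow> X (v + w) = X v + X w"
      "\<And>k v. v \<in> W \<Longrightarrow> X (k \<cdot>\<^sub>v v) = k \<cdot>\<^sub>v X v"
    and v: "v \<in> W" "v \<noteq> 0\<^sub>v d"
  shows "\<exists>w\<in>W. w \<noteq> 0\<^sub>v d \<and> (\<exists>mu. X w = mu \<cdot>\<^sub>v w)"
proof -
  define u where "u j = (X ^^ j) v" for j
  have uW: "u j \<in> W" for j unfolding u_def by (induction j) (simp_all add: v X)
  have uc: "u j \<in> carrier_vec d" for j using uW W(1) by blast
  have W0: "0\<^sub>v d \<in> W"
  proof -
    have "0 \<cdot>\<^sub>v v = 0\<^sub>v d" using v(1) W(1) by (intro eq_vecI) auto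
    then show ?thesis using W(3)[OF v(1), of 0] by simp
  qed
  have X0: "X (0\<^sub>v d) = 0\<^sub>v d"
  proof -
    have z: "0 \<cdot>\<^sub>v w = 0\<^sub>v d" if "w \<in> W" for w using that W(1) by (intro eq_vecI) auto
    have "X (0 \<cdot>\<^sub>v v) = 0 \<cdot>\<^sub>v X v" by (rule X(3)[OF v(1)])
    then show ?thesis using z[OF v(1)] z[OF X(1)[OF v(1)]] by simp
  qed
  have vW: "vsum d S f \<in> W \<and> X (vsum d S f) = vsum d S (\<lambda>s. X (f s))" if "finite S" "\<And>s. s \<in> S \<Longrightarrow> f s \<in> W" for S :: "nat set" and f
    using that
  proof (induction S rule: finite_induct)
    case empty
    have "vsum d {} f = 0\<^sub>v d" for f :: "nat \<Rightarrow> complex vec" by (rule eq_vecI) simp_all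
    then show ?case by (simp add: W0 X0)
  next
    case (insert a S)
    have fa: "f a \<in> W" "X (f a) \<in> W" using insert.prems X by auto
    then have fc: "f a \<in> carrier_vec d" "X (f a) \<in> carrier_vec d" using W(1) by blast+
    have IH: "vsum d S f \<in> W" "X (vsum d S f) = vsum d S (\<lambda>s. X (f s))" using insert by auto
    show ?case
      using insert.hyps fa IH by (simp add: vsum_insert fc W(2) X(2))
  qed
  define ev where "ev p = vsum d {..degree p} (\<lambda>j. coeff p j \<cdot>\<^sub>v u j)" for p
  have ev: "ev p = vsum d {..D} (\<lambda>j. coeff p j \<cdot>\<^sub>v u j)" if "degree p \<le> D" for p D
    unfolding ev_def
  proof (rule eq_vecI, simp_all)
    fix i assume i: "i < d"
    show "(\<Sum>j\<le>degree p. (coeff p j \<cdot>\<^sub>v u j) $ i) = (\<Sum>j\<le>D. (coeff p j \<cdot>\<^sub>v u j) $ i)"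
      by (rule sum.mono_neutral_left) (use that i uc[THEN carrier_vecD] in \<open>auto simp: coeff_eq_0 not_le\<close>)
  qed
  have evW: "ev p \<in> W" for p
    unfolding ev_def using vW[of "{..degree p}" "\<lambda>j. coeff p j \<cdot>\<^sub>v u j"] W(3)[OF uW] by simp
  have evX: "X (ev q) = z \<cdot>\<^sub>v ev q" if "ev ([:- z, 1:] * q) = 0\<^sub>v d" for z q
  proof -
    let ?p = "[:- z, 1:] * q"
    let ?D = "Suc (degree q)"
    have dp: "degree ?p \<le> ?D" using degree_mult_le[of "[:- z, 1:]" q] by simp
    have "X (ev q) = vsum d {..degree q} (\<lambda>j. coeff q j \<cdot>\<^sub>v u (Suc j))"
      unfolding ev_def using vW[of "{..degree q}" "\<lambda>j. coeff q j \<cdot>\<^sub>v u j"] W(3)[OF uW] X(3)[OF uW]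
      by (simp add: u_def)
    moreover have "vsum d {..degree q} (\<lambda>j. coeff q j \<cdot>\<^sub>v u (Suc j)) = z \<cdot>\<^sub>v ev q"
    proof (rule eq_vecI)
      fix i assume "i < dim_vec (z \<cdot>\<^sub>v ev q)"
      then have i: "i < d" by (simp add: ev_def)
      have ui: "(k \<cdot>\<^sub>v u j) $ i = k * u j $ i" for k j using i uc[THEN carrier_vecD] by simp
      have "0 = ev ?p $ i" using that i by simp
      also have "\<dots> = (\<Sum>j\<le>?D. coeff ?p j * u j $ i)" unfolding ev[OF dp] using i by (simp add: ui)
      also have "\<dots> = (\<Sum>j\<le>?D. coeff (pCons 0 q) j * u j $ i) - (\<Sum>j\<le>?D. z * (coeff q j * u j $ i))"
        unfolding sum_subtractf[symmetric] by (rule sum.cong) (simp_all add: algebra_simps)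
      also have "(\<Sum>j\<le>?D. coeff (pCons 0 q) j * u j $ i) = (\<Sum>j\<le>degree q. coeff q j * u (Suc j) $ i)"
        by (subst sum.atMost_Suc_shift) simp
      also have "(\<Sum>j\<le>?D. z * (coeff q j * u j $ i)) = z * ev q $ i"
        unfolding ev[of q ?D, simplified] using i by (simp add: ui sum_distrib_left del: sum.atMost_Suc)
      finally show "vsum d {..degree q} (\<lambda>j. coeff q j \<cdot>\<^sub>v u (Suc j)) $ i = (z \<cdot>\<^sub>v ev q) $ i"
        using i by (simp add: ui ev_def)
    qed (simp add: ev_def)
    ultimately show ?thesis by simp
  qed
  obtain p where p: "p \<noteq> 0" "degree p \<le> d" "vsum d {..d} (\<lambda>j. coeff p j \<cdot>\<^sub>v u j) = 0\<^sub>v d"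
    by (rule ex_linear_dependency[OF uc])
  have "ev p = 0\<^sub>v d" using ev[OF p(2)] p(3) by simp
  with p(1) show ?thesis
  proof (induction "degree p" arbitrary: p rule: less_induct)
    case less
    show ?case
    proof (cases "degree p = 0")
      case True
      then obtain a where a: "p = [:a:]" by (metis degree_eq_zeroE)
      then have "a \<noteq> 0" using less.prems by simp
      moreover have "ev p = a \<cdot>\<^sub>v v"
        unfolding ev_def a by (rule eq_vecI) (use v W(1) in \<open>auto simp: u_def\<close>)
      ultimately have "a \<cdot>\<^sub>v v = 0\<^sub>v d" "a \<noteq> 0" using less.prems by simp_all
      have vd: "dim_vec v = d" using v(1) W(1) by auto
      have "v $ i = 0" if "i < d" for i
        using arg_cong[OF \<open>a \<cdot>\<^sub>v v = 0\<^sub>v d\<close>, of "\<lambda>w. w $ i"] \<open>a \<noteq> 0\<close> that vd by simp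
      then have "v = 0\<^sub>v d" using vd by (intro eq_vecI) simp_all
      with v(2) show ?thesis by simp
    next
      case False
      then have "\<not> constant (poly p)" by (simp add: constant_degree)
      then obtain z where "poly p z = 0" using fundamental_theorem_of_algebra by blast
      then have "[:- z, 1:] dvd p" by (simp only: poly_eq_0_iff_dvd)
      then obtain q where q: "p = [:- z, 1:] * q" by (rule dvdE)
      then have q0: "q \<noteq> 0" using less.prems by auto
      have dq: "degree q < degree p" unfolding q using q0 by (subst degree_mult_eq) simp_all
      show ?thesis
      proof (cases "ev q = 0\<^sub>v d")
        case True
        then show ?thesis using less.hyps[OF dq q0] by simp
      next
        case False
        then show ?thesis using evX[of z q] less.prems q evW[of q] by blast
      qed
    qed
  qed
qed

section \<open>Multiplicity one\<close>

lemma Gset_carrier: "A \<in> Gset s k \<Longrightarrow> A \<in> carrier_mat k k"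
  unfolding Gset_def by (cases s) simp_all

context trunc begin

lemma det_ma_mult: "a \<in> M \<Longrightarrow> b \<in> M \<Longrightarrow> det (ma (a * b)) = det (ma a) * det (ma (b :: 'r endo))"
  by (simp add: ma_mult det_mult[OF ma_carrier ma_carrier])

lemma GL_iff_det: assumes a: "a \<in> M" shows "a \<in> GL \<longleftrightarrow> det (ma a) dvd 1"
proof
  assume "a \<in> GL"
  then have "det (ma a) * det (ma (iv a)) = 1"
    using det_ma_mult[of a "iv a"] by (simp add: ma_1)
  then show "det (ma a) dvd 1" by (metis dvdI)
next
  assume "det (ma a) dvd 1"
  then obtain e where e: "1 = det (ma a) * e" by (rule dvdE)
  let ?A = "adj_mat (ma a)"
  note adj = adj_mat[OF ma_carrier[of a]]
  let ?b = "sc e * em ?A"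
  have mb: "ma (em ?A) = ?A" by (rule ma_em[OF adj(1)])
  have 1: "ma (a * em ?A) = ma (sc (det (ma a)))" "ma (em ?A * a) = ma (sc (det (ma a)))"
    using a adj(2,3) by (auto simp: ma_mult mb ma_def[of "sc _"] ent_sc intro!: eq_matI)
  have "a * em ?A = sc (det (ma a))" "em ?A * a = sc (det (ma a))"
    by (rule ma_inj[OF _ _ 1(1)] ma_inj[OF _ _ 1(2)]; use a in simp)+
  then have "a * ?b = 1" "?b * a = 1"
    using e by (simp_all add: sc_left_commute[of a] mult.assoc mult.commute[of e] sc_1 flip: sc_mult)
  then show "a \<in> GL" using a by (intro GL_I[of a ?b]) simp_all
qed

lemma det_UU: assumes "u \<in> UU" shows "det (ma u) = 1"
proof -
  obtain a where a: "a \<in> NN" "u = 1 + a" using assms by (rule UU_E)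
  have "upper_triangular (ma u)" using a by (intro upper_triangularI) (simp add: ent_1 NN_D)
  then have "det (ma u) = prod_list (diag_mat (ma u))" by (rule det_upper_triangular[OF _ ma_carrier])
  also have "\<dots> = (\<Prod>i=0..<n. ma u $$ (i, i))" by (simp add: prod_list_diag_prod)
  also have "\<dots> = 1" by (rule prod.neutral) (use a in \<open>simp add: ent_1 NN_D\<close>)
  finally show ?thesis .
qed

lemma Uset_ma: "u \<in> UU \<Longrightarrow> ma u \<in> Uset n"
  by (erule UU_E) (auto simp: Uset_def ent_1 NN_D)

end

section \<open>The action on a complex representation\<close>

locale repn = trunc n t l p phi for n and t :: "'r::{comm_ring_1,finite}" and l p phi +
  fixes sl :: bool and d :: nat and rho :: "'r mat \<Rightarrow> complex mat"
  assumes rep: "is_rep n (Gset sl n) d rho"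
begin

definition GG :: "'r endo set" where "GG = {a \<in> M. ma a \<in> Gset sl n}"

definition act :: "'r endo \<Rightarrow> complex vec \<Rightarrow> complex vec" where
  "act a v = rho (ma a) *\<^sub>v v"

abbreviation V :: "complex vec set" where "V \<equiv> carrier_vec d"

lemma GG_iff: "a \<in> M \<Longrightarrow> a \<in> GG \<longleftrightarrow> (if sl then det (ma a) = 1 else det (ma a) dvd 1)"
  by (simp add: GG_def Gset_def)

lemma GG_M: "a \<in> GG \<Longrightarrow> a \<in> M" and GG_Gset: "a \<in> GG \<Longrightarrow> ma a \<in> Gset sl n"
  and GG_I: "a \<in> M \<Longrightarrow> ma a \<in> Gset sl n \<Longrightarrow> a \<in> GG"
  unfolding GG_def by blast+

lemma GG_GL [simp]: assumes "a \<in> GG" shows "a \<in> GL"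
proof -
  have a: "a \<in> M" using assms by (rule GG_M)
  have "det (ma a) dvd 1" using assms unfolding GG_iff[OF a] by (cases sl) simp_all
  then show ?thesis unfolding GL_iff_det[OF a] .
qed

lemma GG_mult [simp]: assumes "a \<in> GG" "b \<in> GG" shows "a * b \<in> GG"
proof -
  have ab: "a \<in> M" "b \<in> M" using assms by (simp_all add: GG_M)
  have "if sl then det (ma a) = 1 else det (ma a) dvd 1" "if sl then det (ma b) = 1 else det (ma b) dvd 1"
    using assms unfolding GG_iff[OF ab(1)] GG_iff[OF ab(2)] .
  then have "if sl then det (ma (a * b)) = 1 else det (ma (a * b)) dvd 1"
    unfolding det_ma_mult[OF ab] by (cases sl) (simp_all add: is_unit_mult_iff)
  then show ?thesis unfolding GG_iff[OF M_mult[OF ab]] .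
qed

lemma GG_1 [simp]: "1 \<in> GG"
  unfolding GG_iff[OF M_1] by (simp add: ma_1)

lemma GG_iv [simp]: assumes "a \<in> GG" shows "iv a \<in> GG"
proof -
  have a: "a \<in> GL" "a \<in> M" "iv a \<in> M" "iv a \<in> GL" using assms by (simp_all add: GG_M)
  have "det (ma a) * det (ma (iv a)) = 1"
    using a(1) by (simp add: ma_1 flip: det_ma_mult[OF a(2,3)])
  moreover have "det (ma (iv a)) dvd 1" using a(4) unfolding GL_iff_det[OF a(3)] .
  moreover have "if sl then det (ma a) = 1 else det (ma a) dvd 1" using assms unfolding GG_iff[OF a(2)] .
  ultimately show ?thesis unfolding GG_iff[OF a(3)] by (cases sl) simp_all
qed

lemma UU_GG [simp]: "u \<in> UU \<Longrightarrow> u \<in> GG"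
  by (subst GG_iff) (simp_all add: det_UU)

lemma GG_cancel: assumes "a \<in> GG" "b \<in> M" shows "a * b \<in> GG \<longleftrightarrow> b \<in> GG" "b * a \<in> GG \<longleftrightarrow> b \<in> GG"
proof -
  have "b \<in> GG" if "a * b \<in> GG" using GG_mult[OF GG_iv[OF assms(1)] that] assms by simp
  then show "a * b \<in> GG \<longleftrightarrow> b \<in> GG" using assms by auto
  have "b \<in> GG" if "b * a \<in> GG" using GG_mult[OF that GG_iv[OF assms(1)]] assms by (simp add: mult.assoc)
  then show "b * a \<in> GG \<longleftrightarrow> b \<in> GG" using assms by auto
qed

lemma rho_carrier [simp]: "a \<in> GG \<Longrightarrow> rho (ma a) \<in> carrier_mat d d"
  using rep unfolding is_rep_def GG_def by blast

lemma act_V [simp]: "a \<in> GG \<Longrightarrow> v \<in> V \<Longrightarrow> act a v \<in> V"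
  unfolding act_def by (rule mult_mat_vec_carrier[OF rho_carrier])

lemma act_mult: assumes "a \<in> GG" "b \<in> GG" "v \<in> V" shows "act (a * b) v = act a (act b v)"
proof -
  have m: "ma (a * b) = ma a * ma b" using assms by (simp add: ma_mult GG_M)
  have "\<forall>g\<in>Gset sl n. \<forall>h\<in>Gset sl n. rho (g * h) = rho g * rho h"
    using rep unfolding is_rep_def by blast
  moreover have "ma a \<in> Gset sl n" "ma b \<in> Gset sl n" using assms unfolding GG_def by blast+
  ultimately have "rho (ma a * ma b) = rho (ma a) * rho (ma b)" by blast
  then show ?thesis
    unfolding act_def m using assoc_mult_mat_vec[OF rho_carrier[OF assms(1)] rho_carrier[OF assms(2)] assms(3)] by simp
qed

lemma act_1 [simp]: "v \<in> V \<Longrightarrow> act 1 v = v"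
proof -
  have "rho (1\<^sub>m n) = 1\<^sub>m d" using rep unfolding is_rep_def by blast
  then show "v \<in> V \<Longrightarrow> act 1 v = v" unfolding act_def ma_1 by simp
qed

lemma act_add: "a \<in> GG \<Longrightarrow> v \<in> V \<Longrightarrow> w \<in> V \<Longrightarrow> act a (v + w) = act a v + act a w"
  unfolding act_def by (rule mult_add_distrib_mat_vec[OF rho_carrier])

lemma act_smult: "a \<in> GG \<Longrightarrow> v \<in> V \<Longrightarrow> act a (k \<cdot>\<^sub>v v) = k \<cdot>\<^sub>v act a v"
  unfolding act_def by (rule mult_mat_vec[OF rho_carrier])

lemma act_vsum: "a \<in> GG \<Longrightarrow> finite S \<Longrightarrow> (\<And>s. s \<in> S \<Longrightarrow> f s \<in> V) \<Longrightarrow> act a (vsum d S f) = vsum d S (\<lambda>s. act a (f s))"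
  unfolding act_def by (rule mult_mat_vec_vsum[OF rho_carrier])

lemma whittaker_outside: "whittaker_hom n (Gset sl n) th d rho T \<Longrightarrow> v \<in> V \<Longrightarrow> h \<notin> Gset sl n \<Longrightarrow> T v h = 0"
  unfolding whittaker_hom_def by blast

lemma one_Gset: "(1\<^sub>m n :: 'r mat) \<in> Gset sl n"
  using GG_Gset[OF GG_1] by (simp only: ma_1)

text \<open>Frobenius reciprocity: T is recovered from the linear functional given by its values at
  the identity.\<close>

lemma whittaker_inside:
  assumes T: "whittaker_hom n (Gset sl n) th d rho T" and v: "v \<in> V" and h: "h \<in> Gset sl n"
  shows "T v h = T (rho h *\<^sub>v v) (1\<^sub>m n)"
proof -
  have "T (rho h *\<^sub>v v) (1\<^sub>m n) = T v (1\<^sub>m n * h)" using T v h one_Gset unfolding whittaker_hom_def by simp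
  then show ?thesis using Gset_carrier[OF h] by simp
qed

lemma rho_V: assumes "h \<in> Gset sl n" "v \<in> V" shows "rho h *\<^sub>v v \<in> V"
proof -
  have "rho h \<in> carrier_mat d d" using rep assms(1) unfolding is_rep_def by blast
  then show ?thesis using assms(2) by (rule mult_mat_vec_carrier)
qed

end

section \<open>The projection onto theta and its commuting compressions\<close>

locale repn_c = repn n t l p phi sl d rho + trunc_c n t l p phi c
  for n and t :: "'r::{comm_ring_1,finite}" and l p phi sl d rho c
begin

text \<open>\<open>NU\<close> times the projection onto the vectors on which U acts by theta.
  Leaving out the normalisation avoids divisions; only its image and its kernel matter.\<close>

definition PP :: "complex vec \<Rightarrow> complex vec" where
  "PP v = vsum d UU (\<lambda>u. theta (iv u) \<cdot>\<^sub>v act u v)"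

definition NU :: complex where "NU = of_nat (card UU)"

lemma NU_nz: "NU \<noteq> 0"
  unfolding NU_def using finite_UU UU_1 by (metis card_0_eq empty_iff of_nat_eq_0_iff)

lemma PP_V [simp]: "PP v \<in> V" and PP_dim [simp]: "dim_vec (PP v) = d"
  by (simp_all add: PP_def)

lemma PP_add: "v \<in> V \<Longrightarrow> w \<in> V \<Longrightarrow> PP (v + w) = PP v + PP w"
  unfolding PP_def by (subst vsum_add[symmetric]) (auto simp: act_add smult_add_distrib_vec[of _ d] intro!: vsum_cong)

lemma PP_smult: "v \<in> V \<Longrightarrow> PP (k \<cdot>\<^sub>v v) = k \<cdot>\<^sub>v PP v"
  unfolding PP_def by (subst vsum_smult[symmetric]) (auto simp: act_smult smult_smult_assoc mult.commute intro!: vsum_cong)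

lemma PP_act_right: assumes u: "u \<in> UU" and v: "v \<in> V" shows "PP (act u v) = theta u \<cdot>\<^sub>v PP v"
proof -
  have "PP (act u v) = vsum d UU (\<lambda>w. theta u \<cdot>\<^sub>v (theta (iv w) \<cdot>\<^sub>v act w v))"
    unfolding PP_def
  proof (rule vsum_reindex[where j = "\<lambda>w. w * u" and i = "\<lambda>w. w * iv u"])
    fix w assume w: "w \<in> UU"
    have "theta u * theta (iv (w * u)) = (theta u * theta (iv u)) * theta (iv w)"
      using u w by (simp add: iv_mult theta_mult)
    then have "theta u * theta (iv (w * u)) = theta (iv w)" using theta_iv(2)[OF u] by simp
    then show "theta u \<cdot>\<^sub>v (theta (iv (w * u)) \<cdot>\<^sub>v act (w * u) v) = theta (iv w) \<cdot>\<^sub>v act w (act u v)"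
      using u v w by (simp add: act_mult smult_smult_assoc)
  qed (use u in \<open>simp_all add: mult.assoc\<close>)
  also have "\<dots> = theta u \<cdot>\<^sub>v PP v"
    unfolding PP_def by (rule vsum_smult) (use v in simp)
  finally show ?thesis .
qed

lemma act_PP: assumes u: "u \<in> UU" and v: "v \<in> V" shows "act u (PP v) = theta u \<cdot>\<^sub>v PP v"
proof -
  have "act u (PP v) = vsum d UU (\<lambda>w. theta (iv w) \<cdot>\<^sub>v act (u * w) v)"
    unfolding PP_def using u v by (subst act_vsum) (auto simp: act_smult act_mult intro!: vsum_cong)
  also have "\<dots> = vsum d UU (\<lambda>w. theta u \<cdot>\<^sub>v (theta (iv w) \<cdot>\<^sub>v act w v))"
  proof (rule vsum_reindex[where j = "\<lambda>w. u * w" and i = "\<lambda>w. iv u * w"])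
    fix w assume w: "w \<in> UU"
    have "theta u * theta (iv (u * w)) = (theta u * theta (iv u)) * theta (iv w)"
      using u w by (simp add: iv_mult theta_mult)
    then have "theta u * theta (iv (u * w)) = theta (iv w)" using theta_iv(2)[OF u] by simp
    then show "theta u \<cdot>\<^sub>v (theta (iv (u * w)) \<cdot>\<^sub>v act (u * w) v) = theta (iv w) \<cdot>\<^sub>v act (u * w) v"
      by (simp add: smult_smult_assoc)
  qed (use u in simp_all)
  also have "\<dots> = theta u \<cdot>\<^sub>v PP v"
    unfolding PP_def by (rule vsum_smult) (use v in simp)
  finally show ?thesis .
qed

lemma tau_GG [simp]: assumes "g \<in> GG" shows "tau g \<in> GG"
  using assms unfolding GG_iff[OF GG_M[OF assms]] GG_iff[OF tau_M] det_tau[OF GG_M[OF assms]] .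

text \<open>The functional \<open>T v 1\<close> is theta-equivariant under U, so every one of the
  \<open>NU\<close> summands of \<open>PP v\<close> contributes the same value.\<close>

lemma whittaker_reduce:
  assumes th: "\<And>u. u \<in> UU \<Longrightarrow> th (ma u) = theta u" and T: "whittaker_hom n (Gset sl n) th d rho T" and vV: "v \<in> V"
  shows "NU * T v (1\<^sub>m n) = T (PP v) (1\<^sub>m n)"
proof -
  have Tadd: "T (v + w) = (\<lambda>h. T v h + T w h)" if "v \<in> V" "w \<in> V" for v w
    using T that by (auto simp: whittaker_hom_def)
  have Tsm: "T (k \<cdot>\<^sub>v v) = (\<lambda>h. k * T v h)" if "v \<in> V" for k v
    using T that by (auto simp: whittaker_hom_def)
  have one: "(1\<^sub>m n :: 'r mat) \<in> Gset sl n" by (rule one_Gset)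
  have Tu: "T (act u v) (1\<^sub>m n) = theta u * T v (1\<^sub>m n)" if u: "u \<in> UU" and v: "v \<in> V" for u v
  proof -
    have uG: "ma u \<in> Gset sl n" by (rule GG_Gset[OF UU_GG[OF u]])
    have "T (act u v) (1\<^sub>m n) = T v (1\<^sub>m n * ma u)"
      using T uG v one unfolding whittaker_hom_def act_def by simp
    also have "1\<^sub>m n * ma u = ma u * 1\<^sub>m n" by simp
    also have "T v (ma u * 1\<^sub>m n) = th (ma u) * T v (1\<^sub>m n)"
      using T Uset_ma[OF u] v one unfolding whittaker_hom_def by blast
    finally show ?thesis using th[OF u] by simp
  qed
  have "T (PP v) (1\<^sub>m n) = (\<Sum>u\<in>UU. T (theta (iv u) \<cdot>\<^sub>v act u v) (1\<^sub>m n))"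
    unfolding PP_def by (rule linear_vsum) (use vV in \<open>simp_all add: Tadd Tsm\<close>)
  also have "\<dots> = (\<Sum>u\<in>UU. T v (1\<^sub>m n))"
  proof (rule sum.cong[OF refl])
    fix u assume u: "u \<in> UU"
    have "T (theta (iv u) \<cdot>\<^sub>v act u v) (1\<^sub>m n) = (theta (iv u) * theta u) * T v (1\<^sub>m n)"
      using u vV by (simp add: Tsm Tu)
    then show "T (theta (iv u) \<cdot>\<^sub>v act u v) (1\<^sub>m n) = T v (1\<^sub>m n)" using theta_iv(1)[OF u] by simp
  qed
  finally show ?thesis by (simp add: NU_def)
qed

text \<open>Each coordinate of \<open>PP (act g (PP v))\<close>, extended by zero from the group to
  \<open>GL_n\<close>, transforms by theta under U on both sides since U lies in the group. Thus
  \<open>F_tau\<close> covers \<open>SL_n\<close> as well.\<close>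

lemma PP_act_tau:
  assumes g: "g \<in> GG" and v: "v \<in> V"
  shows "PP (act (tau g) (PP v)) = PP (act g (PP v))"
proof (rule eq_vecI)
  fix i assume "i < dim_vec (PP (act g (PP v)))"
  then have i: "i < d" by (simp add: PP_def)
  define F where "F h = (if h \<in> GG then PP (act h (PP v)) $ i else 0)" for h
  interpret whittaker_function n t l p phi c F
  proof unfold_locales
    fix h u assume h: "h \<in> GL" and u: "u \<in> UU"
    have hM: "h \<in> M" using h by simp
    show "F (u * h) = theta u * F h"
      using GG_cancel(1)[OF UU_GG[OF u] hM] u i by (simp add: F_def act_mult PP_act_right)
    show "F (h * u) = theta u * F h"
      using GG_cancel(2)[OF UU_GG[OF u] hM] u v i by (simp add: F_def act_mult act_PP act_smult PP_smult)
  qed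
  have "tau g \<in> GG" using g by simp
  then show "PP (act (tau g) (PP v)) $ i = PP (act g (PP v)) $ i"
    using F_tau[OF GG_GL[OF g]] g by (simp add: F_def)
qed (simp add: PP_def)

lemma PP_vsum: "finite S \<Longrightarrow> (\<And>s. s \<in> S \<Longrightarrow> f s \<in> V) \<Longrightarrow> PP (vsum d S f) = vsum d S (\<lambda>s. PP (f s))"
  unfolding PP_def
proof -
  assume S: "finite S" "\<And>s. s \<in> S \<Longrightarrow> f s \<in> V"
  have "vsum d UU (\<lambda>u. theta (iv u) \<cdot>\<^sub>v act u (vsum d S f)) = vsum d UU (\<lambda>u. vsum d S (\<lambda>s. theta (iv u) \<cdot>\<^sub>v act u (f s)))"
    by (rule vsum_cong) (use S in \<open>simp add: act_vsum vsum_smult\<close>)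
  also have "\<dots> = vsum d S (\<lambda>s. vsum d UU (\<lambda>u. theta (iv u) \<cdot>\<^sub>v act u (f s)))" by (rule vsum_swap)
  finally show "vsum d UU (\<lambda>u. theta (iv u) \<cdot>\<^sub>v act u (vsum d S f)) = vsum d S (\<lambda>s. vsum d UU (\<lambda>u. theta (iv u) \<cdot>\<^sub>v act u (f s)))" .
qed

definition CC :: "'r endo \<Rightarrow> 'r endo \<Rightarrow> complex vec \<Rightarrow> complex vec" where
  "CC g h v = PP (act g (PP (act h (PP v))))"

lemma CC_expand:
  assumes g: "g \<in> GG" and h: "h \<in> GG" and v: "v \<in> V"
  shows "CC g h v = vsum d UU (\<lambda>u. theta (iv u) \<cdot>\<^sub>v PP (act (g * u * h) (PP v)))"
proof -
  have hv: "act h (PP v) \<in> V" using h by simp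
  have "act g (PP (act h (PP v))) = vsum d UU (\<lambda>u. theta (iv u) \<cdot>\<^sub>v act (g * u * h) (PP v))"
    unfolding PP_def[of "act h (PP v)"] using g h hv
    by (subst act_vsum) (auto simp: act_smult act_mult intro!: vsum_cong)
  then have "CC g h v = vsum d UU (\<lambda>u. PP (theta (iv u) \<cdot>\<^sub>v act (g * u * h) (PP v)))"
    unfolding CC_def using g h by (simp add: PP_vsum)
  then show ?thesis using g h by (simp add: PP_smult cong: vsum_cong)
qed

text \<open>Expanding the middle projection gives a sum over the products \<open>g * u * h\<close>.
  Tau reverses such a product, permutes U and preserves theta.\<close>

lemma CC_tau:
  assumes g: "g \<in> GG" and h: "h \<in> GG" and v: "v \<in> V"
  shows "CC g h v = CC (tau h) (tau g) v"
proof -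
  have "CC (tau h) (tau g) v = vsum d UU (\<lambda>u. theta (iv u) \<cdot>\<^sub>v PP (act (tau h * u * tau g) (PP v)))"
    using g h v by (intro CC_expand) simp_all
  also have "\<dots> = vsum d UU (\<lambda>u. theta (iv u) \<cdot>\<^sub>v PP (act (g * u * h) (PP v)))"
  proof (rule vsum_reindex[where j = tau and i = tau])
    fix u assume u: "u \<in> UU"
    have "tau h * u * tau g = tau (g * tau u * h)"
      using g h u by (simp add: tau_mult mult.assoc)
    then have "PP (act (tau h * u * tau g) (PP v)) = PP (act (g * tau u * h) (PP v))"
      using PP_act_tau[of "g * tau u * h" v] g h u v by simp
    moreover have "theta (iv (tau u)) = theta (iv u)"
      using u theta_tau[of "iv u"] by (simp add: tau_iv)
    ultimately show "theta (iv (tau u)) \<cdot>\<^sub>v PP (act (g * tau u * h) (PP v)) = theta (iv u) \<cdot>\<^sub>v PP (act (tau h * u * tau g) (PP v))"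
      by simp
  qed simp_all
  finally show ?thesis using CC_expand[OF g h v] by simp
qed

text \<open>Tau reverses the order of the two factors as a whole, yet leaves each factor
  \<open>PP g PP\<close> unchanged by \<open>PP_act_tau\<close>.\<close>

lemma CC_commute:
  assumes g: "g \<in> GG" and h: "h \<in> GG" and v: "v \<in> V"
  shows "CC g h v = CC h g v"
proof -
  have "CC (tau h) (tau g) v = CC h g v"
    unfolding CC_def PP_act_tau[OF g v] using g by (intro PP_act_tau[OF h]) simp
  then show ?thesis using CC_tau[OF assms] by simp
qed

end

locale irrep_c = repn_c +
  assumes irr: "irreducible_rep n (Gset sl n) d rho"
begin

lemma invariant_subspace:
  assumes W: "W \<subseteq> V" "\<And>v w. v \<in> W \<Longrightarrow> w \<in> W \<Longrightarrow> v + w \<in> W" "\<And>k v. v \<in> W \<Longrightarrow> k \<cdot>\<^sub>v v \<in> W"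
    "\<And>g v. g \<in> GG \<Longrightarrow> v \<in> W \<Longrightarrow> act g v \<in> W" and v: "v \<in> W" "v \<noteq> 0\<^sub>v d"
  shows "W = V"
proof -
  have "0 \<cdot>\<^sub>v v = 0\<^sub>v d" using v(1) W(1) by (intro eq_vecI) auto
  then have z: "0\<^sub>v d \<in> W" using W(3)[OF v(1), of 0] by simp
  have "rho A *\<^sub>v v \<in> W" if "A \<in> Gset sl n" "v \<in> W" for A v
  proof -
    have A: "A \<in> carrier_mat n n" using that(1) by (rule Gset_carrier)
    have "em A \<in> GG" by (rule GG_I) (simp_all only: em_in_M ma_em[OF A] that(1))
    from W(4)[OF this that(2)] show ?thesis by (simp add: act_def ma_em[OF A])
  qed
  then have "0\<^sub>v d \<in> W \<and> (\<forall>v\<in>W. \<forall>w\<in>W. v + w \<in> W) \<and> (\<forall>k. \<forall>v\<in>W. k \<cdot>\<^sub>v v \<in> W) \<and>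
      (\<forall>g\<in>Gset sl n. \<forall>v\<in>W. rho g *\<^sub>v v \<in> W)"
    using z W(2,3) by simp
  moreover have "\<forall>W\<subseteq>V. (0\<^sub>v d \<in> W \<and> (\<forall>v\<in>W. \<forall>w\<in>W. v + w \<in> W) \<and> (\<forall>k. \<forall>v\<in>W. k \<cdot>\<^sub>v v \<in> W) \<and>
      (\<forall>g\<in>Gset sl n. \<forall>v\<in>W. rho g *\<^sub>v v \<in> W)) \<longrightarrow> W = {0\<^sub>v d} \<or> W = V"
    using irr unfolding irreducible_rep_def by (elim conjE)
  ultimately have "W = {0\<^sub>v d} \<or> W = V" using W(1) by simp
  with v show ?thesis by blast
qed

text \<open>A Schur argument. An eigenvector \<open>PP w0\<close> of \<open>PP g PP\<close> exists
  inside the image of \<open>PP\<close>. The vectors all of whose translates satisfy the eigenvalue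
  equation after projection form an invariant subspace W; by commutativity it contains
  \<open>PP w0\<close>, so irreducibility makes it everything.\<close>

lemma PP_act_scalar:
  assumes g: "g \<in> GG"
  shows "\<exists>mu. \<forall>v\<in>V. PP (act g (PP v)) = mu \<cdot>\<^sub>v PP v"
proof (cases "\<forall>v\<in>V. PP v = 0\<^sub>v d")
  case True
  have "PP (act g (PP v)) = 0 \<cdot>\<^sub>v PP v" if "v \<in> V" for v
  proof -
    have "PP (act g (PP v)) = 0\<^sub>v d" "PP v = 0\<^sub>v d" using True g that by simp_all
    then show ?thesis by (intro eq_vecI) simp_all
  qed
  then show ?thesis by blast
next
  case False
  then obtain v0 where v0: "v0 \<in> V" "PP v0 \<noteq> 0\<^sub>v d" by blast
  have "\<exists>w\<in>PP ` V. w \<noteq> 0\<^sub>v d \<and> (\<exists>mu. PP (act g w) = mu \<cdot>\<^sub>v w)"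
  proof (rule ex_eigenvector)
    show "v + w \<in> PP ` V" if vw: "v \<in> PP ` V" "w \<in> PP ` V" for v w
    proof -
      obtain a b where "a \<in> V" "v = PP a" "b \<in> V" "w = PP b" using vw by blast
      then have "v + w = PP (a + b)" "a + b \<in> V" by (simp_all add: PP_add)
      then show ?thesis by blast
    qed
    show "k \<cdot>\<^sub>v v \<in> PP ` V" if kv: "v \<in> PP ` V" for k v
    proof -
      obtain a where "a \<in> V" "v = PP a" using kv by blast
      then have "k \<cdot>\<^sub>v v = PP (k \<cdot>\<^sub>v a)" "k \<cdot>\<^sub>v a \<in> V" by (simp_all add: PP_smult)
      then show ?thesis by blast
    qed
    show "PP (act g v) \<in> PP ` V" if "v \<in> PP ` V" for v using that g by auto
    show "PP (act g (v + w)) = PP (act g v) + PP (act g w)" if "v \<in> PP ` V" "w \<in> PP ` V" for v w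
      using that g by (auto simp: act_add PP_add)
    show "PP (act g (k \<cdot>\<^sub>v v)) = k \<cdot>\<^sub>v PP (act g v)" if "v \<in> PP ` V" for k v
      using that g by (auto simp: act_smult PP_smult)
    show "PP ` V \<subseteq> V" by auto
  qed (use v0 in auto)
  then obtain w0 mu where w0: "w0 \<in> V" "PP w0 \<noteq> 0\<^sub>v d" "PP (act g (PP w0)) = mu \<cdot>\<^sub>v PP w0"
    by blast
  define W where "W = {v \<in> V. \<forall>h\<in>GG. PP (act g (PP (act h v))) = mu \<cdot>\<^sub>v PP (act h v)}"
  have "W = V"
  proof (rule invariant_subspace[where v = "PP w0"])
    show "W \<subseteq> V" by (auto simp: W_def)
    show "v + w \<in> W" if "v \<in> W" "w \<in> W" for v w
      using that g by (auto simp: W_def act_add PP_add smult_add_distrib_vec[of _ d])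
    show "k \<cdot>\<^sub>v v \<in> W" if "v \<in> W" for k v
      using that g by (auto simp: W_def act_smult PP_smult smult_smult_assoc mult.commute)
    show "act h v \<in> W" if h: "h \<in> GG" and v: "v \<in> W" for h v
    proof -
      have vV: "v \<in> V" using v by (simp add: W_def)
      have "PP (act g (PP (act k (act h v)))) = mu \<cdot>\<^sub>v PP (act k (act h v))" if k: "k \<in> GG" for k
      proof -
        have "PP (act g (PP (act (k * h) v))) = mu \<cdot>\<^sub>v PP (act (k * h) v)"
          using v GG_mult[OF k h] by (simp add: W_def)
        then show ?thesis using act_mult[OF k h vV] by simp
      qed
      then show ?thesis using act_V[OF h vV] by (simp add: W_def)
    qed
    have "PP (act g (PP (act h (PP w0)))) = mu \<cdot>\<^sub>v PP (act h (PP w0))" if h: "h \<in> GG" for h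
    proof -
      have "CC g h w0 = CC h g w0" by (rule CC_commute[OF g h w0(1)])
      also have "\<dots> = mu \<cdot>\<^sub>v PP (act h (PP w0))"
        unfolding CC_def w0(3) using h by (simp add: act_smult PP_smult)
      finally show ?thesis by (simp add: CC_def)
    qed
    then show "PP w0 \<in> W" by (simp add: W_def)
  qed (rule w0(2))
  have "PP (act g (PP v)) = mu \<cdot>\<^sub>v PP v" if "v \<in> V" for v
  proof -
    have "v \<in> W" using that \<open>W = V\<close> by simp
    then have "PP (act g (PP (act 1 v))) = mu \<cdot>\<^sub>v PP (act 1 v)" using GG_1 unfolding W_def by blast
    then show ?thesis using that by simp
  qed
  then show ?thesis by blast
qed

text \<open>The vectors all of whose translates project into the line of \<open>PP v0\<close> form
  an invariant subspace, and it contains \<open>PP v0\<close> because every \<open>PP g PP\<close>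
  is a scalar on the image.\<close>

lemma PP_rank_one:
  assumes v0: "v0 \<in> V" "PP v0 \<noteq> 0\<^sub>v d" and v: "v \<in> V"
  shows "\<exists>a. PP v = a \<cdot>\<^sub>v PP v0"
proof -
  define W where "W = {v \<in> V. \<forall>h\<in>GG. \<exists>a. PP (act h v) = a \<cdot>\<^sub>v PP v0}"
  have "W = V"
  proof (rule invariant_subspace[where v = "PP v0"])
    show "W \<subseteq> V" by (auto simp: W_def)
    show "v + w \<in> W" if vw: "v \<in> W" "w \<in> W" for v w
    proof -
      have "\<exists>a. PP (act h (v + w)) = a \<cdot>\<^sub>v PP v0" if h: "h \<in> GG" for h
      proof -
        obtain a b where "PP (act h v) = a \<cdot>\<^sub>v PP v0" "PP (act h w) = b \<cdot>\<^sub>v PP v0"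
          using vw h unfolding W_def by blast
        then have "PP (act h (v + w)) = (a + b) \<cdot>\<^sub>v PP v0"
          using vw h by (simp add: W_def act_add PP_add add_smult_distrib_vec)
        then show ?thesis by blast
      qed
      then show ?thesis using vw by (simp add: W_def)
    qed
    show "k \<cdot>\<^sub>v v \<in> W" if vw: "v \<in> W" for k v
    proof -
      have "\<exists>a. PP (act h (k \<cdot>\<^sub>v v)) = a \<cdot>\<^sub>v PP v0" if h: "h \<in> GG" for h
      proof -
        obtain a where "PP (act h v) = a \<cdot>\<^sub>v PP v0" using vw h unfolding W_def by blast
        then have "PP (act h (k \<cdot>\<^sub>v v)) = (k * a) \<cdot>\<^sub>v PP v0"
          using vw h by (simp add: W_def act_smult PP_smult smult_smult_assoc)
        then show ?thesis by blast
      qed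
      then show ?thesis using vw by (simp add: W_def)
    qed
    show "act h v \<in> W" if h: "h \<in> GG" and v: "v \<in> W" for h v
    proof -
      have vV: "v \<in> V" using v by (simp add: W_def)
      have "\<exists>a. PP (act k (act h v)) = a \<cdot>\<^sub>v PP v0" if k: "k \<in> GG" for k
      proof -
        have "\<exists>a. PP (act (k * h) v) = a \<cdot>\<^sub>v PP v0" using v GG_mult[OF k h] by (simp add: W_def)
        then show ?thesis using act_mult[OF k h vV] by simp
      qed
      then show ?thesis using act_V[OF h vV] by (simp add: W_def)
    qed
    have "\<exists>a. PP (act h (PP v0)) = a \<cdot>\<^sub>v PP v0" if "h \<in> GG" for h
      using PP_act_scalar[OF that] v0(1) by blast
    then show "PP v0 \<in> W" by (simp add: W_def)
  qed (rule v0(2))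
  with v have "v \<in> W" by simp
  then have "\<exists>a. PP (act 1 v) = a \<cdot>\<^sub>v PP v0" using GG_1 unfolding W_def by blast
  then show ?thesis using v by simp
qed

theorem at_most_one:
  assumes th: "\<And>u. u \<in> UU \<Longrightarrow> th (ma u) = theta u"
  shows "at_most_one_whittaker n (Gset sl n) th d rho"
  unfolding at_most_one_whittaker_def
proof (intro allI impI)
  fix T1 T2
  assume T: "whittaker_hom n (Gset sl n) th d rho T1 \<and> whittaker_hom n (Gset sl n) th d rho T2"
  have reduce: "NU * T v (1\<^sub>m n) = T (PP v) (1\<^sub>m n)" if "whittaker_hom n (Gset sl n) th d rho T" "v \<in> V" for T v
    by (rule whittaker_reduce[OF _ that]) (rule th)
  have "\<exists>a b. (a, b) \<noteq> (0, 0) \<and> (\<forall>v\<in>V. a * T1 v (1\<^sub>m n) + b * T2 v (1\<^sub>m n) = 0)"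
  proof (cases "\<forall>v\<in>V. PP v = 0\<^sub>v d")
    case True
    have "T1 v (1\<^sub>m n) = 0" if v: "v \<in> V" for v
    proof -
      have z: "PP v = 0 \<cdot>\<^sub>v PP v" using True v by (intro eq_vecI) simp_all
      have "T1 (0 \<cdot>\<^sub>v PP v) (1\<^sub>m n) = 0 * T1 (PP v) (1\<^sub>m n)"
        using T PP_V[of v] unfolding whittaker_hom_def by metis
      then show ?thesis using reduce[of T1 v] T v NU_nz z by simp
    qed
    then show ?thesis by (rule_tac x = 1 in exI, rule_tac x = 0 in exI) simp
  next
    case False
    then obtain v0 where v0: "v0 \<in> V" "PP v0 \<noteq> 0\<^sub>v d" by blast
    have r: "\<exists>a. \<forall>T. whittaker_hom n (Gset sl n) th d rho T \<longrightarrow> T v (1\<^sub>m n) = a * T (PP v0) (1\<^sub>m n)" if v: "v \<in> V" for v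
    proof -
      obtain a where a: "PP v = a \<cdot>\<^sub>v PP v0" using PP_rank_one[OF v0 v] by blast
      have "T v (1\<^sub>m n) = (a / NU) * T (PP v0) (1\<^sub>m n)" if Tw: "whittaker_hom n (Gset sl n) th d rho T" for T
      proof -
        have "T (a \<cdot>\<^sub>v PP v0) = (\<lambda>h. a * T (PP v0) h)" using Tw PP_V unfolding whittaker_hom_def by blast
        then show ?thesis using reduce[OF Tw v] a NU_nz by (simp add: field_simps)
      qed
      then show ?thesis by blast
    qed
    let ?l1 = "T1 (PP v0) (1\<^sub>m n)" and ?l2 = "T2 (PP v0) (1\<^sub>m n)"
    show ?thesis
    proof (cases "?l1 = 0 \<and> ?l2 = 0")
      case True
      then have "\<forall>v\<in>V. 1 * T1 v (1\<^sub>m n) + 0 * T2 v (1\<^sub>m n) = 0" using r T by fastforce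
      then show ?thesis by (rule_tac x = 1 in exI, rule_tac x = 0 in exI) simp
    next
      case False
      \<comment> \<open>Both functionals factor through the same coordinate a of \<open>PP v\<close>
        along \<open>PP v0\<close>, so this combination of their values at \<open>PP v0\<close>
        vanishes everywhere.\<close>
      have "?l2 * T1 v (1\<^sub>m n) + (- ?l1) * T2 v (1\<^sub>m n) = 0" if vV: "v \<in> V" for v
      proof -
        obtain a where "T1 v (1\<^sub>m n) = a * ?l1" "T2 v (1\<^sub>m n) = a * ?l2" using r[OF vV] T by blast
        then show ?thesis by simp
      qed
      then show ?thesis using False by (rule_tac x = ?l2 in exI, rule_tac x = "- ?l1" in exI) auto
    qed
  qed
  then obtain a b where ab: "(a, b) \<noteq> (0, 0)" "\<And>v. v \<in> V \<Longrightarrow> a * T1 v (1\<^sub>m n) + b * T2 v (1\<^sub>m n) = 0" by blast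
  have "a * T1 v h + b * T2 v h = 0" if v: "v \<in> V" for v h
  proof (cases "h \<in> Gset sl n")
    case True
    have "rho h *\<^sub>v v \<in> V" using True v by (rule rho_V)
    then show ?thesis using ab(2) whittaker_inside[OF conjunct1[OF T] v True] whittaker_inside[OF conjunct2[OF T] v True] by simp
  next
    case False
    then show ?thesis using whittaker_outside[OF conjunct1[OF T] v] whittaker_outside[OF conjunct2[OF T] v] by simp
  qed
  with ab(1) show "\<exists>a b. (a, b) \<noteq> (0, 0) \<and> (\<forall>v\<in>V. \<forall>h. a * T1 v h + b * T2 v h = 0)" by blast
qed

end

section \<open>Regular elements\<close>

lemma prod_one_plus_expand: "(c::'r::comm_ring_1)\<^sup>2 dvd (\<Prod>i<(k::nat). 1 + c * f i) - (1 + c * (\<Sum>i<k. f i))"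
proof (induction k)
  case (Suc k)
  let ?P = "\<Prod>i<k. 1 + c * f i" and ?S = "\<Sum>i<k. f i"
  have "(\<Prod>i<Suc k. 1 + c * f i) - (1 + c * (\<Sum>i<Suc k. f i)) =
      (?P - (1 + c * ?S)) * (1 + c * f k) + c\<^sup>2 * (?S * f k)"
    by (simp add: algebra_simps power2_eq_square)
  then show ?case using Suc by (simp only: dvd_add dvd_mult2 dvd_triv_left)
qed simp

context trunc begin

text \<open>In the Leibniz expansion a permutation other than the identity moves some i and also its
  image, so its product contains two off-diagonal entries, each divisible by c.\<close>

lemma det_one_plus:
  obtains e where "det (ma (1 + sc c * y)) = 1 + c * tr y + c\<^sup>2 * (e :: 'r)"
proof -
  let ?A = "ma (1 + sc c * y)"
  let ?f = "\<lambda>p. signof p * (\<Prod>i = 0..<n. ?A $$ (i, p i))"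
  let ?S = "{p. p permutes {0..<n}}"
  have fin: "finite ?S" by (rule finite_permutations) simp
  have A: "?A $$ (i, j) = (if i = j then 1 else 0) + c * ent y i j" if "i < n" "j < n" for i j
    using that by (simp add: ent_1)
  have "c\<^sup>2 dvd sum ?f (?S - {id})"
  proof (rule dvd_sum)
    fix p assume "p \<in> ?S - {id}"
    then have p: "p permutes {0..<n}" "p \<noteq> id" by auto
    then obtain i where i: "p i \<noteq> i" by (metis eq_id_iff)
    have iS: "i \<in> {0..<n}" using permutes_not_in[OF p(1)] i by blast
    define j where "j = p i"
    have jS: "j \<in> {0..<n}" using permutes_in_image[OF p(1)] iS by (simp add: j_def)
    have ij: "j \<noteq> i" "p j \<noteq> j" using i permutes_inj[OF p(1)] by (auto simp: j_def dest: injD)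
    have pjS: "p j \<in> {0..<n}" "p i \<in> {0..<n}" using permutes_in_image[OF p(1)] iS jS by blast+
    let ?g = "\<lambda>k. ?A $$ (k, p k)"
    have "prod ?g {0..<n} = ?g i * prod ?g ({0..<n} - {i})"
      by (rule prod.remove) (use iS in simp_all)
    moreover have "prod ?g ({0..<n} - {i}) = ?g j * prod ?g ({0..<n} - {i} - {j})"
      by (rule prod.remove) (use jS ij in simp_all)
    ultimately have "prod ?g {0..<n} = ?g i * ?g j * prod ?g ({0..<n} - {i} - {j})"
      by (simp only: mult.assoc)
    moreover have "c dvd ?g i" "c dvd ?g j"
      using A[of i "p i"] A[of j "p j"] iS jS pjS i ij by auto
    ultimately have "c * c dvd prod ?g {0..<n}"
      by (simp only: dvd_mult2 mult_dvd_mono)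
    then show "c\<^sup>2 dvd ?f p" by (simp add: power2_eq_square)
  qed
  moreover have "c\<^sup>2 dvd ?f id - (1 + c * tr y)"
  proof -
    have "?f id = (\<Prod>i<n. 1 + c * ent y i i)"
      by (simp add: lessThan_atLeast0 ent_1 sign_id)
    then show ?thesis using prod_one_plus_expand[of c "\<lambda>i. ent y i i" n] by (simp add: tr_def)
  qed
  ultimately have "c\<^sup>2 dvd (?f id - (1 + c * tr y)) + sum ?f (?S - {id})" by (rule dvd_add[rotated])
  moreover have "det ?A = ?f id + sum ?f (?S - {id})"
    using sum.remove[OF fin, of id ?f] permutes_id[of "{0..<n}"] by (simp only: det_def'[OF ma_carrier] mem_Collect_eq)
  ultimately have "c\<^sup>2 dvd det ?A - (1 + c * tr y)" by (simp add: algebra_simps)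
  then obtain e where "det ?A - (1 + c * tr y) = c\<^sup>2 * e" by (rule dvdE)
  then have "det ?A = 1 + c * tr y + c\<^sup>2 * e" by (simp add: algebra_simps)
  then show ?thesis by (rule that)
qed

lemma in_uR_iff: "in_uR t a \<longleftrightarrow> t ^ (l - 1) * a = 0"
proof
  assume "in_uR t a"
  then obtain b where "a = t * b" by (auto simp: in_uR_def)
  moreover have "t ^ (l - 1) * t = 0" using t_l l2 by (cases l) (simp_all add: mult.commute)
  ultimately show "t ^ (l - 1) * a = 0" by (simp flip: mult.assoc)
next
  assume "t ^ (l - 1) * a = 0"
  then obtain b where "a = t ^ (l - (l - 1)) * b" using t_pow_mult_0[of "l - 1" a] by auto
  moreover have "l - (l - 1) = 1" using l2 by simp
  ultimately show "in_uR t a" by (auto simp: in_uR_def)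
qed

lemma K_mult: "l \<le> i + j \<Longrightarrow> (1 + sc (t ^ i) * y) * (1 + sc (t ^ j) * z) = 1 + sc (t ^ i) * y + sc (t ^ j) * z"
proof -
  assume "l \<le> i + j"
  then have "sc (t ^ i) * (y * (sc (t ^ j) * z)) = 0"
    by (simp add: sc_left_commute[of y] sc_sc sc_t_0 flip: power_add)
  then show ?thesis by (simp add: distrib_left distrib_right mult.assoc add.assoc)
qed

lemma K_commute: "l \<le> i + j \<Longrightarrow> (1 + sc (t ^ i) * y) * (1 + sc (t ^ j) * z) = (1 + sc (t ^ j) * z) * (1 + sc (t ^ i) * y)"
  by (simp add: K_mult add.commute[of j] ac_simps)

lemma ma_power: "a \<in> M \<Longrightarrow> ma (a ^ k) = ma a ^\<^sub>m k"
proof (induction k)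
  case (Suc k)
  have "ma (a ^ Suc k) = ma (a ^ k * a)" by (simp add: power_commutes)
  then show ?case using Suc by (simp add: ma_mult)
qed (simp add: ma_1)

text \<open>A vector is encoded as the matrix with this first column and zeros elsewhere, which
  keeps vectors inside the ring \<open>M\<close>.\<close>

lemma mat_vec_index: "a \<in> M \<Longrightarrow> v \<in> carrier_vec n \<Longrightarrow> i < n \<Longrightarrow>
    (ma a *\<^sub>v v) $ i = ent (a * mt (\<lambda>i j. if j = 0 then v $ i else 0)) i 0"
  using n_pos by (simp add: ent_mult ent_mt scalar_prod_def lessThan_atLeast0)

end

context trunc_c begin

text \<open>The first basis vector is cyclic: by \<open>XX_power_col\<close> the vectors
  \<open>x^k e\<close> form a triangular system with units on the diagonal. Independence modulo t is
  read off from the highest coefficient downwards.\<close>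

lemma residue_regular_XX:
  assumes x: "x \<in> M" "xh \<in> XX" "cg (t ^ (l - 1)) x xh"
  shows "residue_regular t n (ma x)"
proof -
  let ?z = "t ^ (l - 1)"
  define v :: "'r vec" where "v = unit_vec n 0"
  have vc: "v \<in> carrier_vec n" by (simp add: v_def)
  have E: "mt (\<lambda>i j. if j = 0 then v $ i else 0) = Em 0 0"
    unfolding Em_def using n_pos by (intro mt_cong) (auto simp: v_def)
  have col: "ent (a * Em 0 0) i 0 = ent a i 0" if "a \<in> M" "i < n" for a i
  proof -
    have "ent (a * Em 0 0) i 0 = (\<Sum>k<n. ent a i k * ent (Em 0 0) k 0)"
      using that n_pos by (simp add: ent_mult)
    also have "\<dots> = (\<Sum>k<n. if k = 0 then ent a i 0 else 0)"
      using n_pos by (intro sum.cong) (auto simp: ent_Em)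
    finally have "ent (a * Em 0 0) i 0 = (\<Sum>k<n. if k = 0 then ent a i 0 else 0)" .
    then show ?thesis using n_pos by simp
  qed
  have lc: "lcomb n (ma x) v e j = ent (pol x n e) j 0" if "j < n" for e j
  proof -
    have "(ma x ^\<^sub>m i *\<^sub>v v) $ j = ent (x ^ i) j 0" for i
      using mat_vec_index[OF M_power[OF x(1)] vc that, of i] col[OF M_power[OF x(1)] that, of i]
      by (simp only: ma_power[OF x(1)] E)
    then show ?thesis by (simp add: lcomb_def pol_def)
  qed
  have cgp: "cg ?z (pol x n e) (pol xh n e)" for e
  proof -
    have "cg ?z (pol x k e) (pol xh k e)" for k
      unfolding pol_def
    proof (induction k)
      case (Suc k)
      show ?case unfolding sum.lessThan_Suc by (rule cg_add[OF Suc cg_sc[OF cg_power[OF x(3)]]])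
    qed simp
    then show ?thesis .
  qed
  show ?thesis unfolding residue_regular_def in_uR_iff
  proof (intro bexI[OF _ vc] conjI ballI allI impI)
    fix w :: "'r vec" assume "w \<in> carrier_vec n"
    obtain e where e: "\<forall>i<n. ent (pol xh n e) i 0 = w $ i"
      using pol_col[OF x(2), of n "\<lambda>i. w $ i"] by auto
    have "?z * (w $ j - lcomb n (ma x) v e j) = 0" if "j < n" for j
      using cg_ent[OF cgp[of e], of j 0] e that by (simp add: lc right_diff_distrib)
    then show "\<exists>e. \<forall>j<n. ?z * (w $ j - lcomb n (ma x) v e j) = 0" by blast
  next
    fix e i
    assume h: "\<forall>j<n. ?z * lcomb n (ma x) v e j = 0" and i: "i < n"
    have z: "?z * ent (pol xh n e) j 0 = 0" if "j < n" for j
      using h that cg_ent[OF cgp[of e], of j 0] by (simp add: lc)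
    show "?z * e i = 0"
      using i
    proof (induction "n - i" arbitrary: i rule: less_induct)
      case less
      have "?z * ent (pol xh n e) i 0 = (\<Sum>q<n. if q = i then ?z * (e i * ent (xh ^ i) i 0) else 0)"
        unfolding pol_def ent_sum sum_distrib_left
      proof (rule sum.cong[OF refl])
        fix q assume "q \<in> {..<n}"
        then have q: "q < n" by simp
        consider "q < i" | "q = i" | "i < q" by linarith
        then show "?z * ent (sc (e q) * xh ^ q) i 0 = (if q = i then ?z * (e i * ent (xh ^ i) i 0) else 0)"
        proof cases
          case 1
          then have "ent (xh ^ q) i 0 = 0" using XX_power_col[OF x(2) q] less.prems by blast
          then show ?thesis using 1 by simp
        next
          case 3
          then have "?z * e q = 0" using less.hyps[of q] less.prems q by simp
          then have "?z * (e q * ent (xh ^ q) i 0) = 0" by (simp only: mult.assoc[symmetric] mult_zero_left)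
          then show ?thesis using 3 by simp
        qed simp
      qed
      then have "?z * (ent (xh ^ i) i 0 * e i) = 0" using z[OF less.prems] less.prems by (simp add: mult.commute[of "e i"])
      then show ?case using XX_power_col[OF x(2) less.prems] by (blast intro: dvd_one_cancel)
    qed
  qed
qed

end

context trunc begin

text \<open>The columns \<open>x1 ^ j * b\<close> of T, for a lift b of a cyclic vector, are a basis
  because they are one modulo t, and T brings \<open>x1\<close> into companion form with ones on the
  subdiagonal. Multiplying the first column by the inverse of \<open>det (ma T)\<close> yields
  determinant 1 and replaces the first of these ones by that inverse, so f depends on x.\<close>

lemma residue_regular_conj:
  assumes x: "x \<in> M" "x1 \<in> M" "cg (t ^ (l - 1)) x x1" and reg: "residue_regular t n (ma x)"
  obtains T c where "T \<in> GL" "det (ma T) = 1" "\<And>i. c i dvd 1"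
    "\<And>i j. i < n \<Longrightarrow> j < i \<Longrightarrow> ent (iv T * x1 * T) i j = (if i = Suc j then c j else 0)"
proof -
  let ?z = "t ^ (l - 1)"
  obtain v where v: "v \<in> carrier_vec n"
    and sp: "\<And>w. w \<in> carrier_vec n \<Longrightarrow> \<exists>e. \<forall>j<n. in_uR t (w $ j - lcomb n (ma x) v e j)"
    using reg unfolding residue_regular_def by blast
  define b where "b = mt (\<lambda>i j. if j = 0 then v $ i else 0)"
  have b: "b \<in> M" by (simp add: b_def)
  define T where "T = mt (\<lambda>i j. ent (x1 ^ j * b) i 0)"
  have TM: "T \<in> M" by (simp add: T_def)
  have "\<exists>C. \<forall>k. \<forall>j<n. in_uR t ((if j = k then 1 else 0) - lcomb n (ma x) v (C k) j)"
  proof (rule choice, rule allI)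
    fix k
    obtain e where "\<forall>j<n. in_uR t (vec n (\<lambda>j. if j = k then 1 else 0) $ j - lcomb n (ma x) v e j)"
      using sp[of "vec n (\<lambda>j. if j = k then 1 else 0)"] by auto
    then show "\<exists>e. \<forall>j<n. in_uR t ((if j = k then 1 else 0) - lcomb n (ma x) v e j)"
      by (intro exI[of _ e]) simp
  qed
  then obtain C where C: "\<And>k j. j < n \<Longrightarrow> ?z * ((if j = k then 1 else 0) - lcomb n (ma x) v (C k) j) = 0"
    unfolding in_uR_iff by blast
  define Cm where "Cm = mt (\<lambda>i k. C k i)"
  have CM: "Cm \<in> M" by (simp add: Cm_def)
  have lc: "?z * lcomb n (ma x) v e j = ?z * (\<Sum>i<n. e i * ent (x1 ^ i * b) j 0)" if j: "j < n" for e j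
  proof -
    have "?z * (e i * (ma x ^\<^sub>m i *\<^sub>v v) $ j) = ?z * (e i * ent (x1 ^ i * b) j 0)" for i
    proof -
      have "?z * ent (x ^ i * b) j 0 = ?z * ent (x1 ^ i * b) j 0"
        by (rule cg_ent[OF cg_mult[OF cg_power[OF x(3)] cg_refl]])
      moreover have "(ma x ^\<^sub>m i *\<^sub>v v) $ j = ent (x ^ i * b) j 0"
        using mat_vec_index[OF M_power[OF x(1)] v j, of i] by (simp only: ma_power[OF x(1)] b_def)
      ultimately show ?thesis by (simp add: mult.left_commute)
    qed
    then show ?thesis unfolding lcomb_def sum_distrib_left by simp
  qed
  have "cg ?z (T * Cm) 1"
  proof (rule cg_I)
    fix i k assume ik: "i < n" "k < n"
    have "?z * (if i = k then 1 else 0) = ?z * lcomb n (ma x) v (C k) i"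
      using C[OF ik(1), of k] by (simp add: right_diff_distrib)
    also have "\<dots> = ?z * (\<Sum>q<n. C k q * ent (x1 ^ q * b) i 0)" by (rule lc[OF ik(1)])
    also have "(\<Sum>q<n. C k q * ent (x1 ^ q * b) i 0) = ent (T * Cm) i k"
      using ik TM CM by (simp add: ent_mult) (simp add: T_def Cm_def ent_mt mult.commute)
    finally show "?z * ent (T * Cm) i k = ?z * ent 1 i k" by (simp add: ent_1)
  qed (use TM CM in simp_all)
  then obtain y where y: "y \<in> M" "T * Cm = 1 + sc (t ^ (l - (l - 1))) * y"
    using cg_0_div[of "l - 1" "T * Cm" 1] TM CM by auto
  have l1: "1 \<le> l - (l - 1)" using l2 by simp
  have "T * Cm \<in> GL" unfolding y(2) by (rule K_GL[OF l1 y(1)])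
  then have "det (ma T) * det (ma Cm) dvd 1"
    using GL_iff_det[of "T * Cm"] TM CM by (simp add: det_ma_mult)
  then have dT: "det (ma T) dvd 1" by (simp add: is_unit_mult_iff)
  then have TG: "T \<in> GL" using GL_iff_det[OF TM] by blast
  obtain e where e: "1 = det (ma T) * e" using dT by (rule dvdE)
  have eu: "e dvd 1" "e * det (ma T) = 1" using e by (metis dvdI mult.commute)+
  define f where "f i = (if i = 0 then e else (1::'r))" for i :: nat
  define f' where "f' i = (if i = 0 then det (ma T) else (1::'r))" for i :: nat
  define D where "D = mt (\<lambda>i j. if i = j then f i else 0)"
  define D' where "D' = mt (\<lambda>i j. if i = j then f' i else 0)"
  have DM: "D \<in> M" "D' \<in> M" by (simp_all add: D_def D'_def)
  have Dl: "ent (D' * a) i j = f' i * ent a i j" "ent (D * a) i j = f i * ent a i j" if "a \<in> M" "i < n" "j < n" for a i j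
    using that DM by (simp_all add: ent_mult D'_def D_def ent_mt if_distrib if_distribR cong: if_cong)
  have Dr: "ent (a * D) i j = ent a i j * f j" if "a \<in> M" "i < n" "j < n" for a i j
    using that DM by (simp add: ent_mult D_def ent_mt if_distrib if_distribR cong: if_cong)
  have ff': "f i * f' i = 1" "f' i * f i = 1" for i using eu by (simp_all add: f_def f'_def mult.commute)
  have DD: "D * D' = 1" "D' * D = 1"
    by (rule M_eqI; use DM in \<open>simp add: Dl\<close>; use ff' in \<open>simp add: D_def D'_def ent_mt ent_1\<close>)+
  have DG: "D \<in> GL" "iv D = D'" using GL_I[OF DM DD] iv_eq[OF DD] by simp_all
  have "upper_triangular (ma D)" by (intro upper_triangularI) (simp add: D_def ent_mt)
  then have "det (ma D) = prod_list (diag_mat (ma D))" by (rule det_upper_triangular[OF _ ma_carrier])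
  also have "\<dots> = (\<Prod>i=0..<n. f i)" by (simp add: prod_list_diag_prod D_def ent_mt)
  also have "\<dots> = (\<Prod>i=0..<n. if i = 0 then e else 1)" by (simp add: f_def)
  also have "\<dots> = e" using n_pos by simp
  finally have dD: "det (ma D) = e" .
  have dTD: "det (ma (T * D)) = 1" using TM DM dD e by (simp add: det_ma_mult)
  have col: "ent (iv T * x1 * T) i j = (if i = Suc j then 1 else 0)" if ij: "i < n" "Suc j < n" for i j
  proof -
    have xT: "ent (x1 * T) k j = ent T k (Suc j)" if "k < n" for k
    proof -
      have "ent (x1 * T) k j = ent (x1 * (x1 ^ j * b)) k 0"
        using that ij x TM b n_pos by (simp add: ent_mult[of x1 T] ent_mult[of x1 "x1 ^ j * b"]) (simp add: T_def ent_mt)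
      then show ?thesis using that ij by (simp add: T_def ent_mt mult.assoc)
    qed
    have "ent (iv T * x1 * T) i j = ent (iv T * (x1 * T)) i j" by (simp add: mult.assoc)
    also have "\<dots> = (\<Sum>k<n. ent (iv T) i k * ent T k (Suc j))"
      using ij TG x by (simp add: ent_mult[of "iv T" "x1 * T"] xT)
    also have "\<dots> = ent (iv T * T) i (Suc j)" using ij TG by (simp only: ent_mult iv_M GL_M)
    finally show ?thesis using TG by (simp add: ent_1)
  qed
  show ?thesis
  proof (rule that[of "T * D" f])
    show "T * D \<in> GL" using TG DG by simp
    show "det (ma (T * D)) = 1" by (rule dTD)
    show "f i dvd 1" for i using eu by (simp add: f_def)
    fix i j assume ij: "i < n" "j < i"
    have "iv (T * D) * x1 * (T * D) = D' * (iv T * x1 * T * D)"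
      using TG DG by (simp add: iv_mult mult.assoc)
    then have "ent (iv (T * D) * x1 * (T * D)) i j = f' i * (ent (iv T * x1 * T) i j * f j)"
      using ij TG x DM by (simp add: Dl Dr)
    then show "ent (iv (T * D) * x1 * (T * D)) i j = (if i = Suc j then f j else 0)"
      using ij col[of i j] by (simp add: f'_def)
  qed
qed

end

section \<open>Regularity and Whittaker models\<close>

locale repn_n = repn n t l p phi sl d rho
  for n and t :: "'r::{comm_ring_1,finite}" and l p phi sl d rho +
  assumes n_unit: "sl \<Longrightarrow> (of_nat n :: 'r) dvd 1"
begin

definition gal :: "'r endo set" where "gal = {y \<in> M. sl \<longrightarrow> tr y = 0}"

lemma gal_I: "y \<in> M \<Longrightarrow> tr y = 0 \<Longrightarrow> y \<in> gal"
  and gal_D: "y \<in> gal \<Longrightarrow> sl \<Longrightarrow> tr y = 0"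
  and gal_M [simp]: "y \<in> gal \<Longrightarrow> y \<in> M"
  unfolding gal_def by blast+

lemma gal_0 [simp]: "0 \<in> gal" by (rule gal_I) (simp_all add: tr_0)

lemma gal_add [simp]: "y \<in> gal \<Longrightarrow> z \<in> gal \<Longrightarrow> y + z \<in> gal"
  and gal_diff [simp]: "y \<in> gal \<Longrightarrow> z \<in> gal \<Longrightarrow> y - z \<in> gal"
  and gal_uminus [simp]: "y \<in> gal \<Longrightarrow> - y \<in> gal"
  and gal_sc [simp]: "y \<in> gal \<Longrightarrow> sc k * y \<in> gal"
  unfolding gal_def by (auto simp: tr_add tr_diff tr_uminus tr_sc_mult)

lemma gal_conj [simp]: assumes "y \<in> gal" "g \<in> GL" shows "g * y * iv g \<in> gal" "iv g * y * g \<in> gal"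
proof -
  have "tr (g * y * iv g) = tr y" "tr (iv g * y * g) = tr y"
    using assms tr_comm[of "g * y" "iv g"] tr_comm[of "iv g * y" g] by (simp_all flip: mult.assoc)
  then show "g * y * iv g \<in> gal" "iv g * y * g \<in> gal"
    using assms gal_D[OF assms(1)] unfolding gal_def by simp_all
qed

lemma gal_commutator [simp]: "a \<in> M \<Longrightarrow> b \<in> M \<Longrightarrow> a * b - b * a \<in> gal"
  by (rule gal_I) (simp_all add: tr_diff tr_comm[of b a])

lemma NN_gal [simp]: "a \<in> NN \<Longrightarrow> a \<in> gal"
  using BB_NN_tr[OF BB_1, of a] by (intro gal_I) simp_all

lemma finite_gal [simp]: "finite gal"
  by (rule finite_subset[OF _ finite_M]) (simp add: subset_iff)

lemma card_gal: "card gal \<noteq> 0"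
  using finite_gal gal_0 by (metis card_0_eq empty_iff)

lemma gal_project:
  assumes y: "y \<in> M"
  shows "\<exists>k. y - sc k \<in> gal \<and> (sl \<longrightarrow> of_nat n * k = tr y) \<and> (\<not> sl \<longrightarrow> k = 0)"
proof (cases sl)
  case True
  obtain e where e: "1 = (of_nat n :: 'r) * e" using n_unit[OF True] by (rule dvdE)
  have k: "of_nat n * (e * tr y) = tr y" using e by (simp flip: mult.assoc)
  have "y - sc (e * tr y) \<in> gal" by (rule gal_I) (use y k in \<open>simp_all add: tr_diff tr_sc\<close>)
  with k True show ?thesis by blast
next
  case False
  have "y \<in> gal" using y False unfolding gal_def by blast
  then have "y - sc 0 \<in> gal" by (simp add: sc_0)
  with False show ?thesis by blast
qed

text \<open>For \<open>SL_n\<close> a traceless w pairs to zero with scalars, so a test matrix may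
  be made traceless by subtracting its trace divided by n. This is where n being a unit
  enters.\<close>

lemma gal_nondegenerate:
  assumes w: "w \<in> gal" and h: "\<And>y. y \<in> gal \<Longrightarrow> phi (z * tr (w * y)) = 1"
  shows "sc z * w = 0"
proof (rule phi_trace_nondegenerate[OF gal_M[OF w]])
  fix y :: "'r endo" assume y: "y \<in> M"
  obtain k where k: "y - sc k \<in> gal" "sl \<longrightarrow> of_nat n * k = tr y" "\<not> sl \<longrightarrow> k = 0"
    using gal_project[OF y] by blast
  have "tr (w * sc k) = 0"
    using gal_D[OF w] k(3) by (cases sl) (simp_all add: sc_central[of w] tr_sc_mult sc_0 tr_0)
  then have "tr (w * (y - sc k)) = tr (w * y)" by (simp add: right_diff_distrib tr_diff)
  then show "phi (z * tr (w * y)) = 1" using h[OF k(1)] by simp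
qed

lemma gal_sum:
  assumes w: "w \<in> gal"
  shows "(\<Sum>y\<in>gal. phi (z * tr (w * y))) = (if sc z * w = 0 then of_nat (card gal) else 0)"
proof (cases "sc z * w = 0")
  case True
  have "z * tr (w * y) = 0" for y
    using tr_sc_mult[of z "w * y"] True by (simp add: tr_0 flip: mult.assoc)
  then show ?thesis using True by (simp add: phi_0)
next
  case False
  then obtain y where y: "y \<in> gal" "phi (z * tr (w * y)) \<noteq> 1" using gal_nondegenerate[OF w] by blast
  have "(\<Sum>y\<in>gal. phi (z * tr (w * y))) = 0"
    by (rule character_sum_zero[where a = y]) (use y in \<open>simp_all add: distrib_left tr_add phi_add\<close>)
  then show ?thesis using False by simp
qed

text \<open>The quadratic term of the determinant dies since \<open>2 * i\<close> reaches l, and the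
  linear one is the trace.\<close>

lemma K_GG [simp]: assumes y: "y \<in> gal" and i: "1 \<le> i" "l \<le> 2 * i" shows "1 + sc (t ^ i) * y \<in> GG"
proof -
  have M: "1 + sc (t ^ i) * y \<in> M" using y by simp
  obtain e where "det (ma (1 + sc (t ^ i) * y)) = 1 + t ^ i * tr y + (t ^ i)\<^sup>2 * e" by (rule det_one_plus)
  moreover have "(t ^ i)\<^sup>2 = 0" using i by (simp add: t_pow_0 flip: power_mult)
  moreover have "det (ma (1 + sc (t ^ i) * y)) dvd 1" using GL_iff_det[OF M] K_GL[OF i(1)] y by simp
  ultimately show ?thesis unfolding GG_iff[OF M] using gal_D[OF y] by (cases sl) simp_all
qed

text \<open>Determinant one only yields \<open>t ^ i * tr y = 0\<close>. For \<open>SL_n\<close> the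
  scalar \<open>tr y / n\<close> is then killed by \<open>t ^ i\<close>, and subtracting it leaves
  the group element unchanged.\<close>

lemma K_GG_gal:
  assumes y: "y \<in> M" and g: "1 + sc (t ^ i) * y \<in> GG" and i: "l \<le> 2 * i"
  obtains y0 where "y0 \<in> gal" "cg (t ^ i) y y0"
proof -
  obtain k where k: "y - sc k \<in> gal" "sl \<longrightarrow> of_nat n * k = tr y" "\<not> sl \<longrightarrow> k = 0"
    using gal_project[OF y] by blast
  have "t ^ i * k = 0"
  proof (cases sl)
    case True
    obtain e where "det (ma (1 + sc (t ^ i) * y)) = 1 + t ^ i * tr y + (t ^ i)\<^sup>2 * e" by (rule det_one_plus)
    moreover have "(t ^ i)\<^sup>2 = 0" using i by (simp add: t_pow_0 flip: power_mult)
    moreover have "det (ma (1 + sc (t ^ i) * y)) = 1" using g GG_iff[OF GG_M[OF g]] True by simp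
    ultimately have "t ^ i * tr y = 0" by simp
    then have "t ^ i * (of_nat n * k) = 0" using k(2) True by simp
    then show ?thesis by (rule dvd_one_cancel[OF n_unit[OF True]])
  qed (simp add: k(3))
  then have "cg (t ^ i) y (y - sc k)"
    by (simp add: cg_def right_diff_distrib sc_0 flip: sc_mult)
  with k(1) show ?thesis by (rule that)
qed

lemma cg_K: "cg (t ^ i) y y0 \<Longrightarrow> 1 + sc (t ^ i) * y = 1 + sc (t ^ i) * y0"
  by (simp add: cg_def)

text \<open>For \<open>SL_n\<close> and traceless y the determinant of \<open>KK y\<close> is
  \<open>1 + zz * e\<close>, which for odd l need not be 1. The factor \<open>1 - zz * e\<close> in
  the corner \<open>Em 0 0\<close> repairs it and changes y only by a multiple of
  \<open>t ^ rr\<close>, invisible to zz.\<close>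

lemma KK_GG_approx:
  assumes y: "y \<in> gal"
  shows "\<exists>y'. y' \<in> M \<and> KK y' \<in> GG \<and> cg zz y' y"
proof (cases sl)
  case False
  have M: "KK y \<in> M" using y by simp
  have "KK y \<in> GL" using y by simp
  then have "KK y \<in> GG" using False unfolding GG_iff[OF M] GL_iff_det[OF M] by simp
  with y show ?thesis by (intro exI[of _ y]) simp
next
  case True
  obtain e where e: "det (ma (KK y)) = 1 + t ^ rr * tr y + (t ^ rr)\<^sup>2 * e" by (rule det_one_plus)
  have z2: "(t ^ rr)\<^sup>2 = zz" by (simp add: mult.commute flip: power_mult)
  have zz0: "zz * zz = 0" using rm by (simp add: t_pow_0 flip: power_add)
  have zr: "t ^ (2 * rr) * t ^ rr = 0" using rm by (simp add: t_pow_0 flip: power_add)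
  let ?b = "sc (- e) * Em 0 0"
  obtain e' where e': "det (ma (1 + sc zz * ?b)) = 1 + zz * tr ?b + zz\<^sup>2 * e'" by (rule det_one_plus)
  have "tr (1 * Em 0 0) = 1" using n_pos by (subst tr_mult_Em) (simp_all add: ent_1)
  then have db: "det (ma (1 + sc zz * ?b)) = 1 - zz * e"
    using e' zz0 by (simp add: tr_sc_mult power2_eq_square[of zz])
  let ?y = "y + sc (t ^ rr) * ?b"
  have "sc zz * (?b * (sc (t ^ rr) * y)) = 0" by (rule sc_zz_rr)
  then have prod: "(1 + sc zz * ?b) * KK y = KK ?y"
    by (simp add: distrib_left distrib_right sc_sc mult.assoc mult_2 power_add add.assoc)
  have "det (ma (KK ?y)) = (1 - zz * e) * (1 + zz * e)"
    unfolding prod[symmetric] using y db e gal_D[OF y True] by (simp add: det_ma_mult z2)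
  also have "\<dots> = 1 - zz * zz * (e * e)" by (simp add: algebra_simps)
  finally have "det (ma (KK ?y)) = 1" by (simp add: zz0)
  then have "KK ?y \<in> GG" using y True by (subst GG_iff) simp_all
  moreover have "cg zz ?y y" using rm by (intro cg_plus_t) simp
  ultimately show ?thesis using y by (intro exI[of _ ?y]) simp
qed

text \<open>Unnormalised projection onto the eigenvectors of \<open>K^i\<close> for the character of
  x. The parameters are traceless for \<open>SL_n\<close>, so that the elements stay in the
  group.\<close>

definition EE :: "nat \<Rightarrow> 'r endo \<Rightarrow> complex vec \<Rightarrow> complex vec" where
  "EE i x v = vsum d gal (\<lambda>y. phi (- (t ^ i * tr (x * y))) \<cdot>\<^sub>v act (1 + sc (t ^ i) * y) v)"

lemma EE_V [simp]: "EE i x v \<in> V" by (simp add: EE_def)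

text \<open>By orthogonality the components \<open>EE i x v\<close>, summed over x, give a positive
  multiple of v, so not all of them vanish.\<close>

lemma EE_nonzero:
  assumes v: "v \<in> V" "v \<noteq> 0\<^sub>v d" and i: "1 \<le> i" "l \<le> 2 * i"
  obtains x where "x \<in> gal" "EE i x v \<noteq> 0\<^sub>v d"
proof -
  have dv: "dim_vec v = d" using v by simp
  let ?Z = "{y \<in> gal. sc (t ^ i) * y = 0}"
  have "0 \<in> ?Z" "finite ?Z" by simp_all
  then have cz: "card ?Z \<noteq> 0" by (metis card_0_eq empty_iff)
  have "vsum d gal (\<lambda>x. EE i x v) = (of_nat (card gal) * of_nat (card ?Z)) \<cdot>\<^sub>v v"
  proof -
    have "vsum d gal (\<lambda>x. EE i x v) = vsum d gal (\<lambda>y. vsum d gal (\<lambda>x. phi (- (t ^ i * tr (x * y))) \<cdot>\<^sub>v act (1 + sc (t ^ i) * y) v))"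
      unfolding EE_def by (rule vsum_swap)
    also have "\<dots> = vsum d gal (\<lambda>y. (if y \<in> ?Z then of_nat (card gal) else 0) \<cdot>\<^sub>v v)"
    proof (rule vsum_cong)
      fix y assume y: "y \<in> gal"
      have aV: "act (1 + sc (t ^ i) * y) v \<in> V" using y v i by simp
      have "(\<Sum>x\<in>gal. phi (- (t ^ i * tr (x * y)))) = (\<Sum>x\<in>gal. phi (t ^ i * tr (- y * x)))"
        by (rule sum.cong) (use y in \<open>simp_all add: tr_uminus tr_comm[of y]\<close>)
      also have "\<dots> = (if sc (t ^ i) * y = 0 then of_nat (card gal) else 0)"
        using y by (subst gal_sum) simp_all
      finally have s: "(\<Sum>x\<in>gal. phi (- (t ^ i * tr (x * y)))) = (if sc (t ^ i) * y = 0 then of_nat (card gal) else 0)" .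
      show "vsum d gal (\<lambda>x. phi (- (t ^ i * tr (x * y))) \<cdot>\<^sub>v act (1 + sc (t ^ i) * y) v) = (if y \<in> ?Z then of_nat (card gal) else 0) \<cdot>\<^sub>v v"
      proof (cases "sc (t ^ i) * y = 0")
        case True
        then show ?thesis using y v unfolding vsum_coeff_smult[OF aV] s by simp
      next
        case False
        then show ?thesis unfolding vsum_coeff_smult[OF aV] s using aV dv by (intro eq_vecI) simp_all
      qed
    qed
    also have "\<dots> = (\<Sum>y\<in>gal. if y \<in> ?Z then of_nat (card gal) else 0) \<cdot>\<^sub>v v"
      by (rule vsum_coeff_smult[OF v(1)])
    also have "(\<Sum>y\<in>gal. if y \<in> ?Z then of_nat (card gal) else (0::complex)) = (\<Sum>y\<in>?Z. of_nat (card gal))"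
      by (rule sum.mono_neutral_cong_right) auto
    finally show ?thesis by (simp add: mult.commute)
  qed
  moreover have "(of_nat (card gal) * of_nat (card ?Z)) \<cdot>\<^sub>v v \<noteq> 0\<^sub>v d"
  proof
    assume e: "(of_nat (card gal) * of_nat (card ?Z)) \<cdot>\<^sub>v v = 0\<^sub>v d"
    have "v $ j = 0" if "j < d" for j
      using arg_cong[OF e, of "\<lambda>w. w $ j"] that dv cz card_gal by simp
    then have "v = 0\<^sub>v d" using dv by (intro eq_vecI) simp_all
    with v(2) show False by simp
  qed
  ultimately have ne: "vsum d gal (\<lambda>x. EE i x v) \<noteq> 0\<^sub>v d" by simp
  have "\<exists>x\<in>gal. EE i x v \<noteq> 0\<^sub>v d"
  proof (rule ccontr)
    assume "\<not> ?thesis"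
    then have "vsum d gal (\<lambda>x. EE i x v) = vsum d gal (\<lambda>x. 0\<^sub>v d)" by (intro vsum_cong) blast
    with ne show False by (simp add: vsum_zero)
  qed
  then show ?thesis using that by blast
qed

lemma EE_eigen:
  assumes v: "v \<in> V" and i: "1 \<le> i" "l \<le> 2 * i" and y0: "y0 \<in> gal"
  shows "act (1 + sc (t ^ i) * y0) (EE i x v) = phi (t ^ i * tr (x * y0)) \<cdot>\<^sub>v EE i x v"
proof -
  have ii: "l \<le> i + i" using i by simp
  have "act (1 + sc (t ^ i) * y0) (EE i x v) =
      vsum d gal (\<lambda>y. phi (- (t ^ i * tr (x * y))) \<cdot>\<^sub>v act (1 + sc (t ^ i) * (y + y0)) v)"
  proof -
    have c: "(1 + sc (t ^ i) * y0) * (1 + sc (t ^ i) * y) = 1 + sc (t ^ i) * (y + y0)" for y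
      by (subst K_mult[OF ii]) (simp only: distrib_left ac_simps)
    have "act (1 + sc (t ^ i) * y0) (phi (- (t ^ i * tr (x * y))) \<cdot>\<^sub>v act (1 + sc (t ^ i) * y) v) =
        phi (- (t ^ i * tr (x * y))) \<cdot>\<^sub>v act (1 + sc (t ^ i) * (y + y0)) v" if y: "y \<in> gal" for y
      using act_mult[OF K_GG[OF y0 i] K_GG[OF y i] v] act_smult[OF K_GG[OF y0 i] act_V[OF K_GG[OF y i] v]]
      unfolding c by simp
    then show ?thesis unfolding EE_def using v i y0
      by (subst act_vsum) (auto intro!: vsum_cong)
  qed
  also have "\<dots> = vsum d gal (\<lambda>y. phi (t ^ i * tr (x * y0)) \<cdot>\<^sub>v (phi (- (t ^ i * tr (x * y))) \<cdot>\<^sub>v act (1 + sc (t ^ i) * y) v))"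
  proof (rule vsum_reindex[where j = "\<lambda>y. y + y0" and i = "\<lambda>y. y - y0"])
    fix y assume y: "y \<in> gal"
    have "phi (t ^ i * tr (x * y0)) * phi (- (t ^ i * tr (x * (y + y0)))) = phi (- (t ^ i * tr (x * y)))"
      by (simp add: distrib_left tr_add flip: phi_add)
    then show "phi (t ^ i * tr (x * y0)) \<cdot>\<^sub>v (phi (- (t ^ i * tr (x * (y + y0)))) \<cdot>\<^sub>v act (1 + sc (t ^ i) * (y + y0)) v) =
        phi (- (t ^ i * tr (x * y))) \<cdot>\<^sub>v act (1 + sc (t ^ i) * (y + y0)) v"
      by (simp only: smult_smult_assoc)
  qed (use y0 in simp_all)
  also have "\<dots> = phi (t ^ i * tr (x * y0)) \<cdot>\<^sub>v EE i x v"
    unfolding EE_def by (rule vsum_smult) (use v i in simp)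
  finally show ?thesis .
qed

lemma EE_commuting:
  assumes v: "v \<in> V" and i: "1 \<le> i" "l \<le> 2 * i" and a: "a \<in> GG"
    and comm: "\<And>y. y \<in> gal \<Longrightarrow> a * (1 + sc (t ^ i) * y) = (1 + sc (t ^ i) * y) * a"
    and e: "act a v = k \<cdot>\<^sub>v v"
  shows "act a (EE i x v) = k \<cdot>\<^sub>v EE i x v"
proof -
  have c: "act a (act (1 + sc (t ^ i) * y) v) = k \<cdot>\<^sub>v act (1 + sc (t ^ i) * y) v" if y: "y \<in> gal" for y
  proof -
    have "act a (act (1 + sc (t ^ i) * y) v) = act (1 + sc (t ^ i) * y) (act a v)"
      using v i a y by (simp add: comm flip: act_mult)
    then show ?thesis using v i y by (simp add: e act_smult)
  qed
  have "act a (EE i x v) = vsum d gal (\<lambda>y. k \<cdot>\<^sub>v (phi (- (t ^ i * tr (x * y))) \<cdot>\<^sub>v act (1 + sc (t ^ i) * y) v))"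
    unfolding EE_def using v i a
    by (subst act_vsum) (auto simp: act_smult c smult_smult_assoc mult.commute intro!: vsum_cong)
  also have "\<dots> = k \<cdot>\<^sub>v EE i x v"
    unfolding EE_def by (rule vsum_smult) (use v i in simp)
  finally show ?thesis .
qed

lemma smult_vec_cancel:
  assumes "v \<in> V" "v \<noteq> 0\<^sub>v d" "a \<cdot>\<^sub>v v = b \<cdot>\<^sub>v v"
  shows "a = b"
proof (rule ccontr)
  assume "a \<noteq> b"
  have "v $ i = 0" if "i < d" for i
    using arg_cong[OF assms(3), of "\<lambda>w. w $ i"] that assms(1) \<open>a \<noteq> b\<close> by simp
  then have "v = 0\<^sub>v d" using assms(1) by (intro eq_vecI) simp_all
  with assms(2) show False by simp
qed

text \<open>The definition ranges over all Y whose element lies in the group.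
  \<open>K_GG_gal\<close> replaces Y by a traceless representative without changing the group
  element or the value of the character.\<close>

lemma contains_phi_x_iff:
  assumes x: "x \<in> gal"
  shows "contains_phi_x t l n (Gset sl n) phi (ma x) d rho \<longleftrightarrow>
    (\<exists>v\<in>V. v \<noteq> 0\<^sub>v d \<and> (\<forall>y\<in>gal. act (1 + sc (t ^ (l - 1)) * y) v = phi (t ^ (l - 1) * tr (x * y)) \<cdot>\<^sub>v v))"
proof -
  let ?z = "t ^ (l - 1)"
  have l1: "1 \<le> l - 1" "l \<le> 2 * (l - 1)" using l2 by linarith+
  have K: "ma (1 + sc ?z * y) = 1\<^sub>m n + ?z \<cdot>\<^sub>m ma y" for y
    by (simp only: ma_add ma_1 ma_sc_mult)
  have T: "mtrace (ma x * ma y) = tr (x * y)" if "y \<in> M" for y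
    using that x by (simp add: mtrace_ma flip: ma_mult)
  have "(\<forall>Y\<in>carrier_mat n n. 1\<^sub>m n + ?z \<cdot>\<^sub>m Y \<in> Gset sl n \<longrightarrow>
      rho (1\<^sub>m n + ?z \<cdot>\<^sub>m Y) *\<^sub>v v = phi (?z * mtrace (ma x * Y)) \<cdot>\<^sub>v v) \<longleftrightarrow>
    (\<forall>y\<in>gal. act (1 + sc ?z * y) v = phi (?z * tr (x * y)) \<cdot>\<^sub>v v)" for v
  proof
    assume h: "\<forall>Y\<in>carrier_mat n n. 1\<^sub>m n + ?z \<cdot>\<^sub>m Y \<in> Gset sl n \<longrightarrow>
      rho (1\<^sub>m n + ?z \<cdot>\<^sub>m Y) *\<^sub>v v = phi (?z * mtrace (ma x * Y)) \<cdot>\<^sub>v v"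
    show "\<forall>y\<in>gal. act (1 + sc ?z * y) v = phi (?z * tr (x * y)) \<cdot>\<^sub>v v"
    proof
      fix y assume y: "y \<in> gal"
      have "1\<^sub>m n + ?z \<cdot>\<^sub>m ma y \<in> Gset sl n" using GG_Gset[OF K_GG[OF y l1]] unfolding K .
      then have "rho (1\<^sub>m n + ?z \<cdot>\<^sub>m ma y) *\<^sub>v v = phi (?z * mtrace (ma x * ma y)) \<cdot>\<^sub>v v"
        using h ma_carrier by blast
      then show "act (1 + sc ?z * y) v = phi (?z * tr (x * y)) \<cdot>\<^sub>v v"
        unfolding act_def K T[OF gal_M[OF y]] .
    qed
  next
    assume h: "\<forall>y\<in>gal. act (1 + sc ?z * y) v = phi (?z * tr (x * y)) \<cdot>\<^sub>v v"
    show "\<forall>Y\<in>carrier_mat n n. 1\<^sub>m n + ?z \<cdot>\<^sub>m Y \<in> Gset sl n \<longrightarrow>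
      rho (1\<^sub>m n + ?z \<cdot>\<^sub>m Y) *\<^sub>v v = phi (?z * mtrace (ma x * Y)) \<cdot>\<^sub>v v"
    proof (intro ballI impI)
      fix Y :: "'r mat" assume Y: "Y \<in> carrier_mat n n" and g: "1\<^sub>m n + ?z \<cdot>\<^sub>m Y \<in> Gset sl n"
      define y where "y = em Y"
      have y: "y \<in> M" "ma y = Y" using Y by (simp_all add: y_def ma_em)
      have yM: "1 + sc ?z * y \<in> M" using y(1) by simp
      have g': "1 + sc ?z * y \<in> GG" by (rule GG_I[OF yM]) (use g in \<open>simp only: K y(2)\<close>)
      obtain y0 where y0: "y0 \<in> gal" "cg ?z y y0" by (rule K_GG_gal[OF y(1) g' l1(2)])
      have "act (1 + sc ?z * y) v = phi (?z * tr (x * y0)) \<cdot>\<^sub>v v" using h y0(1) cg_K[OF y0(2)] by simp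
      also have "?z * tr (x * y0) = ?z * tr (x * y)" by (rule cg_tr[OF cg_mult[OF cg_refl cg_sym[OF y0(2)]]])
      finally show "rho (1\<^sub>m n + ?z \<cdot>\<^sub>m Y) *\<^sub>v v = phi (?z * mtrace (ma x * Y)) \<cdot>\<^sub>v v"
        unfolding act_def K y(2) T[OF y(1), unfolded y(2)] .
    qed
  qed
  then show ?thesis unfolding contains_phi_x_def by simp
qed

lemma gal_galg: "x \<in> M \<Longrightarrow> x \<in> gal \<longleftrightarrow> ma x \<in> galg sl n"
  unfolding gal_def galg_def by (simp add: mtrace_ma)

end

section \<open>Theta-vectors and eigenvectors of congruence subgroups\<close>

locale repn_cn = repn_c n t l p phi sl d rho c + repn_n n t l p phi sl d rho
  for n and t :: "'r::{comm_ring_1,finite}" and l p phi sl d rho c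
begin

text \<open>The elements of U in \<open>K^(l-1)\<close> commute with all of \<open>K^(l-1)\<close>,
  so a nonzero component of a theta-vector is an eigenvector for theta and for the character of x at
  once. Equating the two on \<open>NN\<close> puts x into f + b modulo t.\<close>

theorem whittaker_imp_regular:
  assumes th: "\<And>u. u \<in> UU \<Longrightarrow> th (ma u) = theta u"
    and adm: "admits_whittaker n (Gset sl n) th d rho"
  shows "regular_rep t l sl n phi d rho"
proof -
  obtain T v where T: "whittaker_hom n (Gset sl n) th d rho T" and v: "v \<in> V" "T v \<noteq> (\<lambda>h. 0)"
    using adm unfolding admits_whittaker_def by blast
  then obtain h where h: "T v h \<noteq> 0" by blast
  then have hG: "h \<in> Gset sl n" using whittaker_outside[OF T v(1)] by blast
  define v1 where "v1 = rho h *\<^sub>v v"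
  have v1: "v1 \<in> V" unfolding v1_def by (rule rho_V[OF hG v(1)])
  have "T v1 (1\<^sub>m n) \<noteq> 0" using h whittaker_inside[OF T v(1) hG] by (simp add: v1_def)
  moreover have "NU * T v1 (1\<^sub>m n) = T (PP v1) (1\<^sub>m n)"
    by (rule whittaker_reduce[OF _ T v1]) (rule th)
  ultimately have nz: "T (PP v1) (1\<^sub>m n) \<noteq> 0" using NU_nz by (metis mult_eq_0_iff)
  have w: "PP v1 \<noteq> 0\<^sub>v d"
  proof
    assume z: "PP v1 = 0\<^sub>v d"
    have "T (0 \<cdot>\<^sub>v PP v1) = (\<lambda>h. 0 * T (PP v1) h)" using T PP_V unfolding whittaker_hom_def by blast
    moreover have "0 \<cdot>\<^sub>v PP v1 = PP v1" unfolding z by (rule eq_vecI) simp_all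
    ultimately show False using nz by simp
  qed
  let ?i = "l - 1" and ?z = "t ^ (l - 1)"
  have l1: "1 \<le> ?i" "l \<le> 2 * ?i" "l \<le> ?i + ?i" using l2 by linarith+
  obtain x where x: "x \<in> gal" "EE ?i x (PP v1) \<noteq> 0\<^sub>v d" by (rule EE_nonzero[OF PP_V w l1(1,2)])
  let ?w = "EE ?i x (PP v1)"
  have "phi (?z * tr (x * a)) = phi (?z * tr (ff * a))" if a: "a \<in> NN" for a
  proof -
    let ?u = "1 + sc ?z * a"
    have u: "?u \<in> UU" using a by simp
    have "act ?u ?w = theta ?u \<cdot>\<^sub>v ?w"
      by (rule EE_commuting[OF PP_V l1(1,2) UU_GG[OF u] K_commute[OF l1(3)] act_PP[OF u v1]])
    moreover have "act ?u ?w = phi (?z * tr (x * a)) \<cdot>\<^sub>v ?w"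
      by (rule EE_eigen[OF PP_V l1(1,2) NN_gal[OF a]])
    ultimately have "phi (?z * tr (x * a)) \<cdot>\<^sub>v ?w = theta ?u \<cdot>\<^sub>v ?w" by simp
    then have "phi (?z * tr (x * a)) = theta ?u" by (rule smult_vec_cancel[OF EE_V x(2)])
    then show ?thesis by (simp only: theta_one_plus sc_left_commute[of ff] tr_sc_mult)
  qed
  then obtain xh where xh: "xh \<in> XX" "cg ?z x xh" using cg_XX[OF gal_M[OF x(1)], of ?z] by blast
  have "residue_regular t n (ma x)" by (rule residue_regular_XX[OF gal_M[OF x(1)] xh])
  moreover have "contains_phi_x t l n (Gset sl n) phi (ma x) d rho"
    unfolding contains_phi_x_iff[OF x(1)]
    by (rule bexI[of _ ?w]) (use x(2) EE_eigen[OF PP_V l1(1,2)] in auto)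
  moreover have "ma x \<in> galg sl n" using gal_galg[OF gal_M[OF x(1)]] x(1) by simp
  ultimately show ?thesis unfolding regular_rep_def by blast
qed

text \<open>The intersection of U with \<open>K^r\<close>: scaling by \<open>t ^ mm\<close>
  expresses congruence modulo \<open>t ^ rr\<close>.\<close>

definition UA :: "'r endo set" where "UA = {u \<in> UU. cg (t ^ mm) u 1}"

lemma UA_UU: "u \<in> UA \<Longrightarrow> u \<in> UU" and UA_cg: "u \<in> UA \<Longrightarrow> cg (t ^ mm) u 1"
  and UA_I: "u \<in> UU \<Longrightarrow> cg (t ^ mm) u 1 \<Longrightarrow> u \<in> UA"
  unfolding UA_def by blast+

lemma finite_UA [simp]: "finite UA"
  unfolding UA_def by simp

lemma UA_mult: "u \<in> UA \<Longrightarrow> v \<in> UA \<Longrightarrow> u * v \<in> UA"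
  using cg_mult[of "t ^ mm" u 1 v 1] by (intro UA_I) (simp_all add: UA_UU UA_cg)

lemma UA_iv: "u \<in> UA \<Longrightarrow> iv u \<in> UA"
proof -
  assume u: "u \<in> UA"
  have "cg (t ^ mm) (iv u * u) (iv u * 1)" by (rule cg_mult[OF cg_refl UA_cg[OF u]])
  then have "cg (t ^ mm) 1 (iv u)" using UA_UU[OF u] by simp
  then have c: "cg (t ^ mm) (iv u) 1" by (rule cg_sym)
  show ?thesis by (rule UA_I[OF UU_iv[OF UA_UU[OF u]] c])
qed

lemma UA_E: assumes "u \<in> UA" obtains a where "a \<in> NN" "u = KK a"
proof -
  have u: "u \<in> UU" "u \<in> M" "cg (t ^ mm) u 1" using assms UA_UU[OF assms] by (simp_all add: UA_cg)
  obtain y where y: "y \<in> M" "u = 1 + sc (t ^ (l - mm)) * y"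
    using cg_0_div[OF rm(11) u(2) M_1 u(3)] by blast
  then have uy: "u = 1 + sc (t ^ rr) * y" by (simp only: rm(10))
  define a where "a = mt (\<lambda>i j. if j \<le> i then 0 else ent y i j)"
  have a: "a \<in> NN" by (rule NN_I) (simp_all add: a_def ent_mt)
  have "u - 1 = sc (t ^ rr) * y" using uy by simp
  then have e: "ent (u - 1) i j = t ^ rr * ent y i j" for i j by (simp only: ent_sc_mult)
  have "sc (t ^ rr) * y = sc (t ^ rr) * a"
  proof (rule M_eqI)
    fix i j assume ij: "i < n" "j < n"
    show "ent (sc (t ^ rr) * y) i j = ent (sc (t ^ rr) * a) i j"
      using NN_D[OF UU_D[OF u(1)] ij] e[of i j] ij by (cases "j \<le> i") (simp_all add: a_def ent_mt)
  qed (use y a in simp_all)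
  then have "u = KK a" using uy by simp
  with a show ?thesis by (rule that)
qed

definition PA :: "complex vec \<Rightarrow> complex vec" where
  "PA v = vsum d UA (\<lambda>u. theta (iv u) \<cdot>\<^sub>v act u v)"

lemma UA_GG [simp]: "u \<in> UA \<Longrightarrow> u \<in> GG" by (simp add: UA_UU)

lemma act_PA: assumes u: "u \<in> UA" and v: "v \<in> V" shows "act u (PA v) = theta u \<cdot>\<^sub>v PA v"
proof -
  have uU: "u \<in> UU" using u by (rule UA_UU)
  have "act u (PA v) = vsum d UA (\<lambda>w. theta (iv w) \<cdot>\<^sub>v act (u * w) v)"
    unfolding PA_def using u v by (subst act_vsum) (auto simp: act_smult act_mult intro!: vsum_cong)
  also have "\<dots> = vsum d UA (\<lambda>w. theta u \<cdot>\<^sub>v (theta (iv w) \<cdot>\<^sub>v act w v))"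
  proof (rule vsum_reindex[where j = "\<lambda>w. u * w" and i = "\<lambda>w. iv u * w"])
    fix w assume w: "w \<in> UA"
    have "theta u * theta (iv (u * w)) = (theta u * theta (iv u)) * theta (iv w)"
      using uU UA_UU[OF w] by (simp add: iv_mult theta_mult)
    then have "theta u * theta (iv (u * w)) = theta (iv w)" using theta_iv(2)[OF uU] by simp
    then show "theta u \<cdot>\<^sub>v (theta (iv (u * w)) \<cdot>\<^sub>v act (u * w) v) = theta (iv w) \<cdot>\<^sub>v act (u * w) v"
      by (simp add: smult_smult_assoc)
  qed (use u uU in \<open>simp_all add: UA_mult UA_iv\<close>)
  also have "\<dots> = theta u \<cdot>\<^sub>v PA v"
    unfolding PA_def by (rule vsum_smult) (use v in simp)
  finally show ?thesis .
qed

definition eig :: "'r endo \<Rightarrow> complex vec \<Rightarrow> bool" where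
  "eig x v \<longleftrightarrow> v \<in> V \<and> (\<forall>y\<in>gal. act (LL y) v = phi (t ^ mm * tr (x * y)) \<cdot>\<^sub>v v)"

lemma eig_V: "eig x v \<Longrightarrow> v \<in> V" and eig_act: "eig x v \<Longrightarrow> y \<in> gal \<Longrightarrow> act (LL y) v = phi (t ^ mm * tr (x * y)) \<cdot>\<^sub>v v"
  by (auto simp: eig_def)

lemma LL_GG [simp]: "y \<in> gal \<Longrightarrow> LL y \<in> GG"
  using rm by simp

text \<open>Moving by g carries eigenvectors for x to eigenvectors for \<open>g * x * iv g\<close>;
  the conjugation is written on y.\<close>

lemma act_LL_act:
  assumes v: "eig x v" and g: "g \<in> GG" and y: "y \<in> gal"
  shows "act (LL y) (act g v) = phi (t ^ mm * tr (x * (iv g * y * g))) \<cdot>\<^sub>v act g v"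
proof -
  have vV: "v \<in> V" by (rule eig_V[OF v])
  have gy: "iv g * y * g \<in> gal" using g y by simp
  have "act (LL y) (act g v) = act (g * LL (iv g * y * g)) v"
    using vV g y K_conj[OF GG_GL[OF g], of "t ^ mm" y] by (simp flip: act_mult)
  also have "\<dots> = act g (act (LL (iv g * y * g)) v)" by (rule act_mult[OF g LL_GG[OF gy] vV])
  also have "\<dots> = phi (t ^ mm * tr (x * (iv g * y * g))) \<cdot>\<^sub>v act g v"
    using eig_act[OF v gy] act_smult[OF g vV] by simp
  finally show ?thesis .
qed

lemma eig_act_K:
  assumes v: "eig x v" and g: "g \<in> GG" and c: "cg (t ^ mm) g 1"
  shows "eig x (act g v)"
proof -
  have "act (LL y) (act g v) = phi (t ^ mm * tr (x * y)) \<cdot>\<^sub>v act g v" if y: "y \<in> gal" for y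
  proof -
    have "cg (t ^ mm) (iv g * y * g) (iv g * y * 1)" by (rule cg_mult[OF cg_refl c])
    also have "iv g * y * 1 = iv g * (y * 1)" by simp
    also have "cg (t ^ mm) (iv g * (y * 1)) (iv g * (g * y))"
    proof (rule cg_mult[OF cg_refl])
      have "cg (t ^ mm) (g * y) (1 * y)" by (rule cg_mult[OF c cg_refl])
      from cg_sym[OF this] have "cg (t ^ mm) y (g * y)" by simp
      then show "cg (t ^ mm) (y * 1) (g * y)" by simp
    qed
    also have "iv g * (g * y) = y" using g by simp
    finally have "t ^ mm * tr (x * (iv g * y * g)) = t ^ mm * tr (x * y)"
      by (rule cg_tr[OF cg_mult[OF cg_refl]])
    then show ?thesis using act_LL_act[OF v g y] by simp
  qed
  then show ?thesis using eig_V[OF v] g by (simp add: eig_def)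
qed

lemma eig_vsum:
  assumes "finite S" "\<And>s. s \<in> S \<Longrightarrow> eig x (f s)"
  shows "eig x (vsum d S (\<lambda>s. k s \<cdot>\<^sub>v f s))"
proof -
  have fV: "f s \<in> V" if "s \<in> S" for s using assms(2)[OF that] by (rule eig_V)
  have "act (LL y) (vsum d S (\<lambda>s. k s \<cdot>\<^sub>v f s)) = phi (t ^ mm * tr (x * y)) \<cdot>\<^sub>v vsum d S (\<lambda>s. k s \<cdot>\<^sub>v f s)" if y: "y \<in> gal" for y
  proof -
    have "act (LL y) (vsum d S (\<lambda>s. k s \<cdot>\<^sub>v f s)) = vsum d S (\<lambda>s. phi (t ^ mm * tr (x * y)) \<cdot>\<^sub>v (k s \<cdot>\<^sub>v f s))"
    proof -
      have "act (LL y) (k s \<cdot>\<^sub>v f s) = phi (t ^ mm * tr (x * y)) \<cdot>\<^sub>v (k s \<cdot>\<^sub>v f s)" if s: "s \<in> S" for s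
        unfolding act_smult[OF LL_GG[OF y] fV[OF s]] eig_act[OF assms(2)[OF s] y]
        by (simp only: smult_smult_assoc mult.commute)
      then show ?thesis using y fV assms(1) by (subst act_vsum) (auto intro!: vsum_cong)
    qed
    then show ?thesis using fV by (simp add: vsum_smult)
  qed
  then show ?thesis by (simp add: eig_def)
qed

text \<open>The vector v is projected to theta under \<open>UA\<close> after being moved by elements
  k of \<open>K^r\<close>. If every projection vanished, so would the sum of their translates back
  by k. But conjugating \<open>u = KK a\<close> by k multiplies its term by a character in the
  commutator of a and x, and orthogonality over k leaves only those u whose a commutes with x up to
  \<open>cg zz\<close>. By \<open>commutant_XX\<close> such u lie in \<open>K^m\<close>, where theta
  is the character of x; so the sum is a positive multiple of v.\<close>

lemma UA_eigenvector:
  assumes x: "x \<in> XX" and v: "eig x v" "v \<noteq> 0\<^sub>v d"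
  shows "\<exists>w. eig x w \<and> w \<noteq> 0\<^sub>v d \<and> (\<forall>u\<in>UA. act u w = theta u \<cdot>\<^sub>v w)"
proof -
  have vV: "v \<in> V" and dv: "dim_vec v = d" using eig_V[OF v(1)] by simp_all
  have "\<exists>Y. \<forall>y\<in>gal. Y y \<in> M \<and> KK (Y y) \<in> GG \<and> cg zz (Y y) y"
    using KK_GG_approx by (intro bchoice ballI)
  then obtain Y where Y: "\<And>y. y \<in> gal \<Longrightarrow> Y y \<in> M" "\<And>y. y \<in> gal \<Longrightarrow> KK (Y y) \<in> GG" "\<And>y. y \<in> gal \<Longrightarrow> cg zz (Y y) y"
    by blast
  have term1: "act (KK (Y y)) (act u (act (iv (KK (Y y))) v)) = phi (zz * tr ((a * x - x * a) * y)) \<cdot>\<^sub>v act u v"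
    if y: "y \<in> gal" and u: "u \<in> UA" and a: "a \<in> NN" "u = KK a" for y u a
  proof -
    let ?k = "KK (Y y)"
    let ?e = "Y y * a - a * Y y"
    let ?f = "sc (t ^ (2 * rr - mm)) * (y * a - a * y)"
    have kG: "?k \<in> GL" "KK a \<in> GL" "KK a \<in> GG" using Y(2)[OF y] a u by simp_all
    have fg: "?f \<in> gal" using y a by simp
    have ee: "sc zz * ?e = sc (t ^ mm) * ?f"
    proof -
      have "cg zz ?e (y * a - a * y)" using Y(3)[OF y] by (intro cg_diff cg_mult) simp_all
      then show ?thesis unfolding cg_def zz_mm sc_mult mult.assoc .
    qed
    have "?k * KK a * iv ?k = (1 + sc zz * ?e) * (KK a * ?k) * iv ?k" by (simp only: KK_swap[of "Y y" a])
    also have "\<dots> = (1 + sc zz * ?e) * KK a" using kG(1) by (simp add: mult.assoc)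
    also have "\<dots> = KK a * (1 + sc zz * ?e)" by (rule zz_commute)
    finally have conj: "?k * KK a * iv ?k = KK a * LL ?f" unfolding ee .
    have "act ?k (act u (act (iv ?k) v)) = act (?k * KK a * iv ?k) v"
      using Y(2)[OF y] kG vV a(2) by (simp add: act_mult)
    also have "\<dots> = act (KK a) (act (LL ?f) v)" unfolding conj by (rule act_mult[OF kG(3) LL_GG[OF fg] vV])
    also have "\<dots> = phi (t ^ mm * tr (x * ?f)) \<cdot>\<^sub>v act u v"
      using eig_act[OF v(1) fg] act_smult[OF kG(3) vV] a(2) by simp
    also have "t ^ mm * tr (x * ?f) = zz * tr (x * (y * a - a * y))"
      by (simp only: sc_left_commute[of x] tr_sc_mult zz_mm mult.assoc)
    also have "tr (x * (y * a - a * y)) = tr ((a * x - x * a) * y)"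
    proof -
      have "tr (x * (y * a)) = tr (a * x * y)" using tr_comm[of "x * y" a] x y a by (simp add: mult.assoc)
      then show ?thesis by (simp add: right_diff_distrib left_diff_distrib tr_diff mult.assoc)
    qed
    finally show ?thesis .
  qed
  have deep: "act u v = theta u \<cdot>\<^sub>v v" if u: "u \<in> UA" and a: "a \<in> NN" "u = KK a" and z: "sc zz * (a * x - x * a) = 0" for u a
  proof -
    have "cg zz (a * x) (x * a)" using z by (simp add: cg_def right_diff_distrib)
    then have "cg zz a 0"
      by (rule commutant_XX[OF x NN_M[OF a(1)]]) (use NN_D[OF a(1) _ n_pos] in simp)
    then obtain b where b: "b \<in> M" "sc (t ^ rr) * a = sc (t ^ mm) * b"
      using zz_mult_sc_div[OF NN_M[OF a(1)]] by blast
    have ub: "u = LL b" unfolding a(2) b(2) ..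
    have "LL b \<in> GG" using u ub by simp
    then obtain y0 where y0: "y0 \<in> gal" "cg (t ^ mm) b y0" by (rule K_GG_gal[OF b(1) _ rm(5)])
    have "act u v = phi (t ^ mm * tr (x * y0)) \<cdot>\<^sub>v v"
      unfolding ub cg_K[OF y0(2)] by (rule eig_act[OF v(1) y0(1)])
    also have "t ^ mm * tr (x * y0) = t ^ mm * tr (x * b)" by (rule cg_tr[OF cg_mult[OF cg_refl cg_sym[OF y0(2)]]])
    also have "\<dots> = tr (x * (sc (t ^ mm) * b))" by (simp only: sc_left_commute[of x] tr_sc_mult)
    also have "\<dots> = tr (ff * (sc (t ^ rr) * a))" unfolding b(2)[symmetric] using x a by (intro tr_XX_NN) simp_all
    finally show ?thesis unfolding a(2) by (simp only: theta_one_plus)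
  qed
  have "\<exists>y\<in>gal. PA (act (iv (KK (Y y))) v) \<noteq> 0\<^sub>v d"
  proof (rule ccontr)
    assume "\<not> ?thesis"
    then have z: "PA (act (iv (KK (Y y))) v) = 0\<^sub>v d" if "y \<in> gal" for y using that by blast
    define Q where "Q = vsum d gal (\<lambda>y. act (KK (Y y)) (PA (act (iv (KK (Y y))) v)))"
    have "act g (0\<^sub>v d) = 0\<^sub>v d" if "g \<in> GG" for g
      unfolding act_def using rho_carrier[OF that] by (intro eq_vecI) simp_all
    then have "Q = vsum d gal (\<lambda>y. 0\<^sub>v d)" unfolding Q_def using z Y(2) by (intro vsum_cong) simp
    then have Q0: "Q = 0\<^sub>v d" by (simp add: vsum_zero)
    \<comment> \<open>The parameter a in \<open>u = KK a\<close> is determined only modulo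
      \<open>t ^ mm\<close>; a fixed choice makes the summand a function of u.\<close>
    define A where "A u = (SOME a. a \<in> NN \<and> u = KK a)" for u
    have A: "A u \<in> NN \<and> u = KK (A u)" if "u \<in> UA" for u
      unfolding A_def by (rule someI_ex) (use UA_E[OF that] in blast)
    let ?Z = "{u \<in> UA. sc zz * (A u * x - x * A u) = 0}"
    have "Q = vsum d gal (\<lambda>y. vsum d UA (\<lambda>u. phi (zz * tr ((A u * x - x * A u) * y)) \<cdot>\<^sub>v (theta (iv u) \<cdot>\<^sub>v act u v)))"
      unfolding Q_def
    proof (rule vsum_cong)
      fix y assume y: "y \<in> gal"
      have ivV: "act (iv (KK (Y y))) v \<in> V" using Y(2)[OF y] vV by simp
      show "act (KK (Y y)) (PA (act (iv (KK (Y y))) v)) =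
          vsum d UA (\<lambda>u. phi (zz * tr ((A u * x - x * A u) * y)) \<cdot>\<^sub>v (theta (iv u) \<cdot>\<^sub>v act u v))"
        unfolding PA_def using Y(2)[OF y] ivV
      proof (subst act_vsum, simp_all, intro vsum_cong)
        fix u assume u: "u \<in> UA"
        have "act (KK (Y y)) (theta (iv u) \<cdot>\<^sub>v act u (act (iv (KK (Y y))) v)) =
            theta (iv u) \<cdot>\<^sub>v act (KK (Y y)) (act u (act (iv (KK (Y y))) v))"
          using Y(2)[OF y] ivV u by (intro act_smult) simp_all
        also have "\<dots> = theta (iv u) \<cdot>\<^sub>v (phi (zz * tr ((A u * x - x * A u) * y)) \<cdot>\<^sub>v act u v)"
          using term1[OF y u conjunct1[OF A[OF u]] conjunct2[OF A[OF u]]] by simp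
        finally show "act (KK (Y y)) (theta (iv u) \<cdot>\<^sub>v act u (act (iv (KK (Y y))) v)) =
            phi (zz * tr ((A u * x - x * A u) * y)) \<cdot>\<^sub>v (theta (iv u) \<cdot>\<^sub>v act u v)"
          by (simp add: smult_smult_assoc mult.commute)
      qed
    qed
    also have "\<dots> = vsum d UA (\<lambda>u. vsum d gal (\<lambda>y. phi (zz * tr ((A u * x - x * A u) * y)) \<cdot>\<^sub>v (theta (iv u) \<cdot>\<^sub>v act u v)))"
      by (rule vsum_swap)
    also have "\<dots> = vsum d UA (\<lambda>u. (if u \<in> ?Z then of_nat (card gal) else 0) \<cdot>\<^sub>v v)"
    proof (rule vsum_cong)
      fix u assume u: "u \<in> UA"
      have Au: "A u \<in> NN" "u = KK (A u)" using A[OF u] by blast+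
      have tV: "theta (iv u) \<cdot>\<^sub>v act u v \<in> V" using u vV by simp
      have "A u * x - x * A u \<in> gal" using Au(1) x by simp
      note s = gal_sum[OF this, of zz]
      show "vsum d gal (\<lambda>y. phi (zz * tr ((A u * x - x * A u) * y)) \<cdot>\<^sub>v (theta (iv u) \<cdot>\<^sub>v act u v)) =
          (if u \<in> ?Z then of_nat (card gal) else 0) \<cdot>\<^sub>v v"
        unfolding vsum_coeff_smult[OF tV] s
      proof (cases "sc zz * (A u * x - x * A u) = 0")
        case True
        have "theta (iv u) \<cdot>\<^sub>v act u v = (theta (iv u) * theta u) \<cdot>\<^sub>v v"
          unfolding deep[OF u Au True] by (rule smult_smult_assoc)
        also have "\<dots> = v" using theta_iv(1)[OF UA_UU[OF u]] by simp
        finally show "(if sc zz * (A u * x - x * A u) = 0 then of_nat (card gal) else 0) \<cdot>\<^sub>v (theta (iv u) \<cdot>\<^sub>v act u v) =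
          (if u \<in> ?Z then of_nat (card gal) else 0) \<cdot>\<^sub>v v" using True u by simp
      next
        case False
        then show "(if sc zz * (A u * x - x * A u) = 0 then of_nat (card gal) else 0) \<cdot>\<^sub>v (theta (iv u) \<cdot>\<^sub>v act u v) =
          (if u \<in> ?Z then of_nat (card gal) else 0) \<cdot>\<^sub>v v"
          using tV dv by (intro eq_vecI) simp_all
      qed
    qed
    also have "\<dots> = (\<Sum>u\<in>UA. if u \<in> ?Z then of_nat (card gal) else 0) \<cdot>\<^sub>v v"
      by (rule vsum_coeff_smult[OF vV])
    also have "(\<Sum>u\<in>UA. if u \<in> ?Z then of_nat (card gal) else (0::complex)) = (\<Sum>u\<in>?Z. of_nat (card gal))"
      by (rule sum.mono_neutral_cong_right) auto
    finally have Qv: "Q = (of_nat (card ?Z) * of_nat (card gal)) \<cdot>\<^sub>v v" by simp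
    have o: "1 \<in> UA" by (rule UA_I) simp_all
    have deep0: "sc zz * (A 1 * x - x * A 1) = 0"
    proof -
      have "sc (t ^ rr) * A 1 = 0" using A[OF o] by simp
      then have "sc zz * A 1 = 0"
        by (simp add: mult_2 power_add sc_mult mult.assoc)
      then have "cg zz (A 1) 0" by (simp add: cg_def)
      then have "cg zz (A 1 * x - x * A 1) (0 * x - x * 0)" by (intro cg_diff cg_mult cg_refl)
      then show ?thesis by (simp add: cg_def)
    qed
    have oz: "1 \<in> ?Z" using o deep0 by (rule_tac CollectI, rule_tac conjI)
    have fz: "finite ?Z" by simp
    have "card ?Z \<noteq> 0" unfolding card_0_eq[OF fz] using oz by (rule_tac notI, simp only: empty_iff)
    then have k: "of_nat (card ?Z) * of_nat (card gal) \<noteq> (0::complex)"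
      using card_gal unfolding mult_eq_0_iff of_nat_eq_0_iff by blast
    have "0 \<cdot>\<^sub>v v = 0\<^sub>v d" using dv by (intro eq_vecI) simp_all
    then have "(of_nat (card ?Z) * of_nat (card gal)) \<cdot>\<^sub>v v = 0 \<cdot>\<^sub>v v" using Qv Q0 by (rule_tac trans[OF trans[OF Qv[symmetric] Q0]], rule_tac sym)
    from smult_vec_cancel[OF vV v(2) this] k show False by (rule_tac notE)
  qed
  then obtain y where y: "y \<in> gal" "PA (act (iv (KK (Y y))) v) \<noteq> 0\<^sub>v d" by blast
  have kG: "iv (KK (Y y)) \<in> GG" using Y(2)[OF y(1)] by simp
  obtain y' where y': "iv (KK (Y y)) = KK y'" using KK_iv[OF Y(1)[OF y(1)]] by blast
  have "cg (t ^ mm) (iv (KK (Y y))) 1"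
    unfolding y' by (rule cg_plus_t) (rule eq_refl[OF rm(3)[symmetric]])
  then have e1: "eig x (act (iv (KK (Y y))) v)" by (rule eig_act_K[OF v(1) kG])
  have "eig x (PA (act (iv (KK (Y y))) v))"
    unfolding PA_def by (rule eig_vsum) (use eig_act_K[OF e1] UA_cg in auto)
  moreover have "\<forall>u\<in>UA. act u (PA (act (iv (KK (Y y))) v)) = theta u \<cdot>\<^sub>v PA (act (iv (KK (Y y))) v)"
    using act_PA[OF _ eig_V[OF e1]] by blast
  ultimately show ?thesis using y(2) by (intro exI conjI)
qed

text \<open>Each u in U moves w into the eigenspace of \<open>u * x * iv u\<close>, which is that of
  x only if u commutes with x modulo \<open>t ^ rr\<close>, that is, for u in \<open>UA\<close>.
  There u acts on w by theta. So the component of \<open>PP w\<close> at x is a positive multiple of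
  w, and \<open>PP w\<close> cannot vanish.\<close>

theorem UU_eigenvector:
  assumes x: "x \<in> XX" and v: "eig x v" "v \<noteq> 0\<^sub>v d"
  shows "\<exists>w\<in>V. PP w \<noteq> 0\<^sub>v d"
proof -
  obtain w where w: "eig x w" "w \<noteq> 0\<^sub>v d" "\<And>u. u \<in> UA \<Longrightarrow> act u w = theta u \<cdot>\<^sub>v w"
    using UA_eigenvector[OF x v] by blast
  have wV: "w \<in> V" and dw: "dim_vec w = d" using eig_V[OF w(1)] by simp_all
  have i: "1 \<le> mm" "l \<le> 2 * mm" using rm by simp_all
  have "EE mm x (PP w) = vsum d gal (\<lambda>y. vsum d UU (\<lambda>u. phi (t ^ mm * tr ((u * x * iv u - x) * y)) \<cdot>\<^sub>v (theta (iv u) \<cdot>\<^sub>v act u w)))"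
    unfolding EE_def
  proof (rule vsum_cong)
    fix y assume y: "y \<in> gal"
    have "act (LL y) (PP w) = vsum d UU (\<lambda>u. act (LL y) (theta (iv u) \<cdot>\<^sub>v act u w))"
      unfolding PP_def by (rule act_vsum) (use y wV in simp_all)
    then have "phi (- (t ^ mm * tr (x * y))) \<cdot>\<^sub>v act (LL y) (PP w) =
        vsum d UU (\<lambda>u. phi (- (t ^ mm * tr (x * y))) \<cdot>\<^sub>v act (LL y) (theta (iv u) \<cdot>\<^sub>v act u w))"
      using y wV by (simp add: vsum_smult)
    also have "\<dots> = vsum d UU (\<lambda>u. phi (t ^ mm * tr ((u * x * iv u - x) * y)) \<cdot>\<^sub>v (theta (iv u) \<cdot>\<^sub>v act u w))"
    proof (rule vsum_cong)
      fix u assume u: "u \<in> UU"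
      have "act (LL y) (theta (iv u) \<cdot>\<^sub>v act u w) = theta (iv u) \<cdot>\<^sub>v (phi (t ^ mm * tr (x * (iv u * y * u))) \<cdot>\<^sub>v act u w)"
        using y u wV act_LL_act[OF w(1) UU_GG[OF u] y] by (simp add: act_smult)
      moreover have "tr (x * (iv u * y * u)) = tr (u * x * iv u * y)"
        using tr_comm[of "x * (iv u * y)" u] u x y by (simp add: mult.assoc)
      moreover have "phi (- (t ^ mm * tr (x * y))) * phi (t ^ mm * tr (u * x * iv u * y)) = phi (t ^ mm * tr ((u * x * iv u - x) * y))"
        by (simp add: left_diff_distrib tr_diff right_diff_distrib flip: phi_add)
      ultimately show "phi (- (t ^ mm * tr (x * y))) \<cdot>\<^sub>v act (LL y) (theta (iv u) \<cdot>\<^sub>v act u w) =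
          phi (t ^ mm * tr ((u * x * iv u - x) * y)) \<cdot>\<^sub>v (theta (iv u) \<cdot>\<^sub>v act u w)"
        by (simp add: smult_smult_assoc) (simp add: mult.left_commute mult.commute)
    qed
    finally show "phi (- (t ^ mm * tr (x * y))) \<cdot>\<^sub>v act (LL y) (PP w) =
        vsum d UU (\<lambda>u. phi (t ^ mm * tr ((u * x * iv u - x) * y)) \<cdot>\<^sub>v (theta (iv u) \<cdot>\<^sub>v act u w))" .
  qed
  also have "\<dots> = vsum d UU (\<lambda>u. vsum d gal (\<lambda>y. phi (t ^ mm * tr ((u * x * iv u - x) * y)) \<cdot>\<^sub>v (theta (iv u) \<cdot>\<^sub>v act u w)))"
    by (rule vsum_swap)
  also have "\<dots> = vsum d UU (\<lambda>u. (if u \<in> UA then of_nat (card gal) else 0) \<cdot>\<^sub>v w)"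
  proof (rule vsum_cong)
    fix u assume u: "u \<in> UU"
    have tV: "theta (iv u) \<cdot>\<^sub>v act u w \<in> V" using u wV by simp
    have uG: "u \<in> GL" using u by simp
    have "tr (u * x * iv u - x) = 0" using tr_comm[of "u * x" "iv u"] u x by (simp add: tr_diff)
    then have g: "u * x * iv u - x \<in> gal" using u x by (intro gal_I) simp_all
    have iff: "sc (t ^ mm) * (u * x * iv u - x) = 0 \<longleftrightarrow> u \<in> UA"
    proof
      assume "sc (t ^ mm) * (u * x * iv u - x) = 0"
      then have "cg (t ^ mm) (u * x * iv u) x" by (simp add: cg_def right_diff_distrib)
      then have "cg (t ^ mm) (u * x * iv u * u) (x * u)" by (rule cg_mult[OF _ cg_refl])
      then have "cg (t ^ mm) (u * x) (x * u)" using uG by (simp add: mult.assoc)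
      then have c: "cg (t ^ mm) ((u - 1) * x) (x * (u - 1))"
        using cg_diff[OF _ cg_refl, of "t ^ mm" "u * x" "x * u" x] by (simp add: algebra_simps)
      have "cg (t ^ mm) (u - 1) 0"
        by (rule commutant_XX[OF x _ c]) (use u NN_D[OF UU_D[OF u] _ n_pos] in simp_all)
      then have "cg (t ^ mm) u 1" by (simp only: cg_diff_0[of _ u 1])
      then show "u \<in> UA" by (rule UA_I[OF u])
    next
      assume "u \<in> UA"
      then have c: "cg (t ^ mm) u 1" by (rule UA_cg)
      have "cg (t ^ mm) (u * x) (1 * x)" by (rule cg_mult[OF c cg_refl])
      moreover have "cg (t ^ mm) (x * 1) (x * u)" by (rule cg_mult[OF cg_refl cg_sym[OF c]])
      ultimately have "cg (t ^ mm) (u * x) (x * u)" unfolding mult_1_left mult_1_right by (rule cg_trans)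
      then have "cg (t ^ mm) (u * x * iv u) (x * u * iv u)" by (rule cg_mult[OF _ cg_refl])
      then show "sc (t ^ mm) * (u * x * iv u - x) = 0" using uG by (simp add: mult.assoc cg_def right_diff_distrib)
    qed
    show "vsum d gal (\<lambda>y. phi (t ^ mm * tr ((u * x * iv u - x) * y)) \<cdot>\<^sub>v (theta (iv u) \<cdot>\<^sub>v act u w)) =
        (if u \<in> UA then of_nat (card gal) else 0) \<cdot>\<^sub>v w"
      unfolding vsum_coeff_smult[OF tV] gal_sum[OF g] iff
    proof (cases "u \<in> UA")
      case True
      have "theta (iv u) \<cdot>\<^sub>v act u w = (theta (iv u) * theta u) \<cdot>\<^sub>v w"
        unfolding w(3)[OF True] by (rule smult_smult_assoc)
      also have "\<dots> = w" using theta_iv(1)[OF u] by simp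
      finally show "(if u \<in> UA then of_nat (card gal) else 0) \<cdot>\<^sub>v (theta (iv u) \<cdot>\<^sub>v act u w) = (if u \<in> UA then of_nat (card gal) else 0) \<cdot>\<^sub>v w"
        by simp
    next
      case False
      then show "(if u \<in> UA then of_nat (card gal) else 0) \<cdot>\<^sub>v (theta (iv u) \<cdot>\<^sub>v act u w) = (if u \<in> UA then of_nat (card gal) else 0) \<cdot>\<^sub>v w"
        using tV dw by (intro eq_vecI) simp_all
    qed
  qed
  also have "\<dots> = (\<Sum>u\<in>UU. if u \<in> UA then of_nat (card gal) else 0) \<cdot>\<^sub>v w" by (rule vsum_coeff_smult[OF wV])
  also have "(\<Sum>u\<in>UU. if u \<in> UA then of_nat (card gal) else (0::complex)) = (\<Sum>u\<in>UA. of_nat (card gal))"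
    by (rule sum.mono_neutral_cong_right) (auto dest: UA_UU)
  finally have E: "EE mm x (PP w) = (of_nat (card UA) * of_nat (card gal)) \<cdot>\<^sub>v w" by simp
  have "PP w \<noteq> 0\<^sub>v d"
  proof
    assume z: "PP w = 0\<^sub>v d"
    have "act (LL y) (0\<^sub>v d) = 0\<^sub>v d" if "y \<in> gal" for y
      unfolding act_def using rho_carrier[OF LL_GG[OF that]] by (intro eq_vecI) simp_all
    then have "EE mm x (0\<^sub>v d) = vsum d gal (\<lambda>y. 0\<^sub>v d)" unfolding EE_def by (intro vsum_cong) (auto intro!: eq_vecI)
    then have EZ: "EE mm x (0\<^sub>v d) = 0\<^sub>v d" by (simp only: vsum_zero)
    have "(of_nat (card UA) * of_nat (card gal)) \<cdot>\<^sub>v w = 0\<^sub>v d" unfolding E[symmetric] z by (rule EZ)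
    moreover have "0 \<cdot>\<^sub>v w = 0\<^sub>v d" using dw by (intro eq_vecI) simp_all
    ultimately have "of_nat (card UA) * of_nat (card gal) = (0::complex)"
      using smult_vec_cancel[OF wV w(2), of "of_nat (card UA) * of_nat (card gal)" 0] by simp
    moreover have "1 \<in> UA" by (rule UA_I) simp_all
    then have "card UA \<noteq> 0" using finite_UA by (metis card_0_eq empty_iff)
    ultimately show False using card_gal by simp
  qed
  with wV show ?thesis by blast
qed

text \<open>Frobenius reciprocity in the other direction: any coordinate of
  \<open>PP (rho h v)\<close>, as a function of h, defines a homomorphism into the induced
  representation. The coordinate is taken where \<open>PP w\<close> is nonzero.\<close>

theorem admits_of_PP:
  assumes th: "\<And>u. u \<in> UU \<Longrightarrow> th (ma u) = theta u" and w: "w \<in> V" "PP w \<noteq> 0\<^sub>v d"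
  shows "admits_whittaker n (Gset sl n) th d rho"
proof -
  have "\<exists>i<d. PP w $ i \<noteq> 0"
  proof (rule ccontr)
    assume "\<not> ?thesis"
    then have "PP w = 0\<^sub>v d" by (intro eq_vecI) simp_all
    with w(2) show False by simp
  qed
  then obtain i where i: "i < d" "PP w $ i \<noteq> 0" by blast
  define T :: "complex vec \<Rightarrow> 'r mat \<Rightarrow> complex" where "T v h = (if h \<in> Gset sl n then PP (rho h *\<^sub>v v) $ i else 0)" for v h
  have em_GG: "em A \<in> GG" "A \<in> carrier_mat n n" "ma (em A) = A" if "A \<in> Gset sl n" for A :: "'r mat"
  proof -
    show A: "A \<in> carrier_mat n n" using that by (rule Gset_carrier)
    show e: "ma (em A) = A" by (rule ma_em[OF A])
    show "em A \<in> GG" by (rule GG_I) (simp_all only: em_in_M e that)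
  qed
  have act_rho: "rho A *\<^sub>v v = act (em A) v" if "A \<in> Gset sl n" for A v
    unfolding act_def em_GG(3)[OF that] ..
  have prod: "A * B \<in> Gset sl n" "em (A * B) = em A * em B" if "A \<in> Gset sl n" "B \<in> Gset sl n" for A B :: "'r mat"
  proof -
    have m: "ma (em A * em B) = A * B" using em_GG[OF that(1)] em_GG[OF that(2)] by (simp add: ma_mult)
    show "A * B \<in> Gset sl n" using GG_Gset[OF GG_mult[OF em_GG(1)[OF that(1)] em_GG(1)[OF that(2)]]] unfolding m .
    show "em (A * B) = em A * em B" unfolding m[symmetric] by (rule em_ma) simp
  qed
  have uset: "em u \<in> UU" "u \<in> Gset sl n" if "u \<in> Uset n" for u :: "'r mat"
  proof -
    have uc: "u \<in> carrier_mat n n" using that by (simp add: Uset_def)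
    have "em u - 1 \<in> NN" by (rule NN_I) (use that in \<open>auto simp: em_def ent_mt ent_1 Uset_def\<close>)
    then show e: "em u \<in> UU" by (intro UU_I) simp_all
    show "u \<in> Gset sl n" using GG_Gset[OF UU_GG[OF e]] ma_em[OF uc] by simp
  qed
  have "whittaker_hom n (Gset sl n) th d rho T"
    unfolding whittaker_hom_def
  proof (intro conjI ballI allI impI)
    show "T (v + w) = (\<lambda>h. T v h + T w h)" if "v \<in> V" "w \<in> V" for v w
      by (rule ext) (use that i em_GG in \<open>simp add: T_def act_rho act_add PP_add\<close>)
    show "T (k \<cdot>\<^sub>v v) = (\<lambda>h. k * T v h)" if "v \<in> V" for k v
      by (rule ext) (use that i em_GG in \<open>simp add: T_def act_rho act_smult PP_smult\<close>)
    show "T v h = 0" if "h \<notin> Gset sl n" for v h using that by (simp add: T_def)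
    show "T v (u * h) = th u * T v h" if v: "v \<in> V" and u: "u \<in> Uset n" and h: "h \<in> Gset sl n" for v u h
    proof -
      note U = uset[OF u]
      have "th u = theta (em u)" using th[OF U(1)] em_GG(3)[OF U(2)] by simp
      then show ?thesis
        using v h U prod[OF U(2) h] em_GG(1)[OF h] i by (simp add: T_def act_rho act_mult PP_act_right)
    qed
    show "T (rho g *\<^sub>v v) = (\<lambda>h. if h \<in> Gset sl n then T v (h * g) else 0)" if g: "g \<in> Gset sl n" and v: "v \<in> V" for g v
      by (rule ext) (use g v prod em_GG in \<open>simp add: T_def act_rho act_mult\<close>)
  qed
  moreover have "T w (1\<^sub>m n) \<noteq> 0"
    using i(2) one_Gset rep w(1) by (simp add: T_def is_rep_def)
  then have "T w \<noteq> (\<lambda>h. 0)" by auto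
  ultimately show ?thesis using w(1) unfolding admits_whittaker_def by blast
qed

lemma nondeg_theta: "nondeg_char t l n (\<lambda>A. theta (em A))"
proof -
  have "theta (em u) = (\<Prod>i<n - 1. phi (c i * u $$ (i, i + 1)))" if u: "u \<in> Uset n" for u
  proof -
    have "theta (em u) = (\<Prod>i<n - 1. phi (c i * ent (em u) i (Suc i)))" by (simp add: theta_phi phi_sum)
    also have "\<dots> = (\<Prod>i<n - 1. phi (c i * u $$ (i, i + 1)))"
      by (rule prod.cong) (simp_all add: em_def ent_mt)
    finally show ?thesis .
  qed
  then show ?thesis unfolding nondeg_char_def
    by (intro exI[of _ "\<lambda>i a. phi (c i * a)"]) (simp add: primitive_char_phi c_unit)
qed

end

section \<open>The residue characteristic and the parameters of theta\<close>

context trunc begin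

text \<open>If k were a multiple of t in the ring, then so would be 1, as a Bezout combination of p
  and k, contradicting the nilpotency of t.\<close>

lemma of_nat_unit:
  assumes "\<not> p dvd k" shows "(of_nat k :: 'r) dvd 1"
proof (rule ccontr)
  assume "\<not> ?thesis"
  then obtain b where b: "(of_nat k :: 'r) = t * b" using unit_or[of "of_nat k"] by blast
  have pr: "prime p" and "in_uR t (of_nat p)" using td by (simp_all add: trunc_dvr_def)
  then obtain e where e: "(of_nat p :: 'r) = t * e" by (auto simp: in_uR_def)
  have "coprime p k" using pr assms by (rule prime_imp_coprime)
  then have "gcd (int p) (int k) = 1" by simp
  then obtain u v where "u * int p + v * int k = 1" using bezout_int by metis
  then have "of_int (u * int p + v * int k) = (1 :: 'r)" by simp
  then have "t * (of_int u * e + of_int v * b) = 1" by (simp add: b e algebra_simps)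
  then have "t ^ l * (of_int u * e + of_int v * b) ^ l = 1" by (simp flip: power_mult_distrib)
  then have z: "(1 :: 'r) = 0" by (simp add: t_l)
  have "t ^ (l - 1) = 1 * t ^ (l - 1)" by simp
  then have "t ^ (l - 1) = 0" unfolding z by simp
  with t_l1 show False by simp
qed

lemma nondeg_char_units:
  assumes "nondeg_char t l n th"
  shows "\<exists>c. (\<forall>i. c i dvd 1) \<and> (\<forall>u\<in>UU. th (ma u) = phi (\<Sum>i<n - 1. c i * ent u i (Suc i)))"
proof -
  obtain ch where ch: "\<And>i. i < n - 1 \<Longrightarrow> primitive_char t l (ch i)"
    and th: "\<And>u. u \<in> Uset n \<Longrightarrow> th u = (\<Prod>i<n - 1. ch i (u $$ (i, i + 1)))"
    using assms unfolding nondeg_char_def by blast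
  have "\<exists>e. e dvd 1 \<and> (i < n - 1 \<longrightarrow> (\<forall>a. ch i a = phi (e * a)))" for i
  proof (cases "i < n - 1")
    case True
    obtain e where "e dvd 1" "\<And>a. ch i a = phi (e * a)" using primitive_char_eq[OF ch[OF True]] by blast
    then show ?thesis by blast
  next
    case False
    \<comment> \<open>Indices beyond the superdiagonal receive the default 1, because
      \<open>c_unit\<close> asks for a unit at every index.\<close>
    then show ?thesis by (intro exI[of _ 1]) simp
  qed
  then obtain c where c: "\<And>i. c i dvd 1" "\<And>i a. i < n - 1 \<Longrightarrow> ch i a = phi (c i * a)" by metis
  have "th (ma u) = phi (\<Sum>i<n - 1. c i * ent u i (Suc i))" if u: "u \<in> UU" for u
    unfolding th[OF Uset_ma[OF u]] phi_sum[OF finite_lessThan] by (rule prod.cong) (simp_all add: c(2))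
  with c(1) show ?thesis by blast
qed

end

context repn_n begin

text \<open>Regularity only provides an eigenvector of \<open>K^(l-1)\<close>, while the
  construction of a theta-vector starts from one of \<open>K^m\<close>. Some component of it under
  \<open>K^m\<close> survives. This component keeps the eigenvalues under \<open>K^(l-1)\<close>,
  which commutes with \<open>K^m\<close> and lies in it, so the new x agrees with the old one modulo
  t.\<close>

lemma regular_eigenvector:
  assumes "regular_rep t l sl n phi d rho"
  obtains x0 x v where "x0 \<in> gal" "residue_regular t n (ma x0)" "x \<in> gal" "cg (t ^ (l - 1)) x0 x"
    "v \<in> V" "v \<noteq> 0\<^sub>v d" "\<And>y. y \<in> gal \<Longrightarrow> act (1 + sc (t ^ mm) * y) v = phi (t ^ mm * tr (x * y)) \<cdot>\<^sub>v v"
proof -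
  obtain X0 where X0: "X0 \<in> galg sl n" "residue_regular t n X0" "contains_phi_x t l n (Gset sl n) phi X0 d rho"
    using assms unfolding regular_rep_def by blast
  have Xc: "X0 \<in> carrier_mat n n" using X0(1) unfolding galg_def by (cases sl) simp_all
  define x0 :: "'r endo" where "x0 = em X0"
  have mx: "ma x0 = X0" unfolding x0_def by (rule ma_em[OF Xc])
  have xM: "x0 \<in> M" unfolding x0_def by (rule em_in_M)
  have x0: "x0 \<in> gal" using X0(1) unfolding gal_galg[OF xM] mx .
  let ?l1 = "l - 1"
  obtain v0 where v0: "v0 \<in> V" "v0 \<noteq> 0\<^sub>v d"
    "\<And>y. y \<in> gal \<Longrightarrow> act (1 + sc (t ^ ?l1) * y) v0 = phi (t ^ ?l1 * tr (x0 * y)) \<cdot>\<^sub>v v0"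
    using X0(3) unfolding mx[symmetric] contains_phi_x_iff[OF x0] by blast
  have i: "1 \<le> mm" "l \<le> 2 * mm" using rm by simp_all
  have l1: "1 \<le> ?l1" "l \<le> 2 * ?l1" using l2 by linarith+
  have m1: "mm + (?l1 - mm) = ?l1" using rm l2 by linarith
  obtain x where x: "x \<in> gal" "EE mm x v0 \<noteq> 0\<^sub>v d" using EE_nonzero[OF v0(1,2) i] by blast
  have "phi (t ^ ?l1 * tr ((x0 - x) * y)) = 1" if y: "y \<in> gal" for y
  proof -
    have c: "l \<le> ?l1 + mm" using i(1) l2 by linarith
    have "act (1 + sc (t ^ ?l1) * y) (EE mm x v0) = phi (t ^ ?l1 * tr (x0 * y)) \<cdot>\<^sub>v EE mm x v0"
      by (rule EE_commuting[OF v0(1) i K_GG[OF y l1] _ v0(3)[OF y]]) (rule K_commute[OF c])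
    moreover have "act (1 + sc (t ^ mm) * (sc (t ^ (?l1 - mm)) * y)) (EE mm x v0) =
        phi (t ^ mm * tr (x * (sc (t ^ (?l1 - mm)) * y))) \<cdot>\<^sub>v EE mm x v0"
      by (rule EE_eigen[OF v0(1) i gal_sc[OF y]])
    moreover have "sc (t ^ mm) * (sc (t ^ (?l1 - mm)) * y) = sc (t ^ ?l1) * y"
      by (simp only: m1 mult.assoc[symmetric] sc_mult[symmetric] power_add[symmetric])
    moreover have "t ^ mm * tr (x * (sc (t ^ (?l1 - mm)) * y)) = t ^ ?l1 * tr (x * y)"
      unfolding sc_left_commute[of x] tr_sc_mult by (simp only: m1 mult.assoc[symmetric] power_add[symmetric])
    ultimately have "phi (t ^ ?l1 * tr (x0 * y)) = phi (t ^ ?l1 * tr (x * y))"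
      by (intro smult_vec_cancel[OF EE_V x(2)]) simp
    then have "phi (t ^ ?l1 * tr (x0 * y) - t ^ ?l1 * tr (x * y)) = 1" unfolding phi_diff_1 .
    then show ?thesis by (simp only: left_diff_distrib tr_diff right_diff_distrib)
  qed
  then have "sc (t ^ ?l1) * (x0 - x) = 0" by (rule gal_nondegenerate[OF gal_diff[OF x0 x(1)]])
  then have "cg (t ^ ?l1) x0 x" by (simp only: cg_def right_diff_distrib right_minus_eq)
  then show ?thesis
    by (rule that[OF x0 X0(2)[folded mx] x(1) _ EE_V x(2) EE_eigen[OF v0(1) i]])
qed

end

context repn_cn begin

text \<open>Translation by \<open>iv g\<close> turns an eigenvector for x into one for
  \<open>iv g * x * g\<close>, to which \<open>UU_eigenvector\<close> applies. The conjugating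
  element has to lie in the group itself, hence the care taken to give it determinant 1.\<close>

lemma admits_of_conj:
  assumes g: "g \<in> GG" and x: "x \<in> gal" and X: "iv g * x * g \<in> XX" and v: "eig x v" "v \<noteq> 0\<^sub>v d"
  shows "admits_whittaker n (Gset sl n) (\<lambda>A. theta (em A)) d rho"
proof -
  have iG: "iv g \<in> GG" and gL: "g \<in> GL" and gM: "g \<in> M" using g by (simp_all add: GG_M)
  have vV: "v \<in> V" by (rule eig_V[OF v(1)])
  have "eig (iv g * x * g) (act (iv g) v)" unfolding eig_def
  proof (intro conjI ballI)
    show "act (iv g) v \<in> V" using iG vV by simp
    fix y assume y: "y \<in> gal"
    have "tr (x * (g * y * iv g)) = tr (iv g * x * g * y)"
      using tr_comm[of "iv g" "x * (g * y)"] gL x y by (simp add: mult.assoc)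
    then show "act (LL y) (act (iv g) v) = phi (t ^ mm * tr (iv g * x * g * y)) \<cdot>\<^sub>v act (iv g) v"
      using act_LL_act[OF v(1) iG y] gL by simp
  qed
  moreover have "act (iv g) v \<noteq> 0\<^sub>v d"
  proof
    assume z: "act (iv g) v = 0\<^sub>v d"
    have "v = act (g * iv g) v" using gL vV by simp
    also have "\<dots> = act g (0\<^sub>v d)" unfolding act_mult[OF g iG vV] z ..
    also have "\<dots> = 0\<^sub>v d" unfolding act_def using rho_carrier[OF g] by (intro eq_vecI) simp_all
    finally show False using v(2) by simp
  qed
  ultimately obtain w where w: "w \<in> V" "PP w \<noteq> 0\<^sub>v d" using UU_eigenvector[OF X] by blast
  show ?thesis by (rule admits_of_PP[OF _ w]) (simp add: em_ma)
qed

end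

context repn_n begin

theorem regular_imp_whittaker:
  assumes "regular_rep t l sl n phi d rho"
  shows "\<exists>th. nondeg_char t l n th \<and> admits_whittaker n (Gset sl n) th d rho"
proof -
  obtain x0 x v where x: "x0 \<in> gal" "residue_regular t n (ma x0)" "x \<in> gal" "cg (t ^ (l - 1)) x0 x"
    and v: "v \<in> V" "v \<noteq> 0\<^sub>v d" "\<And>y. y \<in> gal \<Longrightarrow> act (1 + sc (t ^ mm) * y) v = phi (t ^ mm * tr (x * y)) \<cdot>\<^sub>v v"
    using regular_eigenvector[OF assms] by blast
  obtain g c where g: "g \<in> GL" "det (ma g) = 1" and c: "\<And>i. c i dvd 1"
    and e: "\<And>i j. i < n \<Longrightarrow> j < i \<Longrightarrow> ent (iv g * x * g) i j = (if i = Suc j then c j else 0)"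
    using residue_regular_conj[OF gal_M[OF x(1)] gal_M[OF x(3)] x(4,2)] by metis
  interpret repn_cn n t l p phi sl d rho c by unfold_locales (rule c)
  have gM: "g \<in> M" using g by simp
  have gG: "g \<in> GG" unfolding GG_iff[OF gM] using g(2) by simp
  have "iv g * x * g \<in> XX" by (intro XX_I BB_I) (use g gM x(3) e in \<open>simp_all add: ent_ff\<close>)
  moreover have "eig x v" unfolding eig_def using v by blast
  ultimately show ?thesis using admits_of_conj[OF gG x(3) _ _ v(2)] nondeg_theta by blast
qed

end

theorem theorem1p2:
  fixes unif :: "'r::{comm_ring_1,finite}"
    and l n p :: nat
    and sl :: bool
    and phi :: "'r \<Rightarrow> complex"
  assumes "l \<ge> 2"
    and "n \<ge> 1"
    and "trunc_dvr unif l p"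
    and "primitive_char unif l phi"
    and "sl \<longrightarrow> odd p \<and> \<not> p dvd n"
  shows "(\<forall>d rho. irreducible_rep n (Gset sl n) d rho \<longrightarrow>
            ((\<exists>theta. nondeg_char unif l n theta \<and> admits_whittaker n (Gset sl n) theta d rho)
             \<longleftrightarrow> regular_rep unif l sl n phi d rho))
       \<and> (\<forall>theta. nondeg_char unif l n theta \<longrightarrow>
            (\<forall>d rho. irreducible_rep n (Gset sl n) d rho \<longrightarrow>
               at_most_one_whittaker n (Gset sl n) theta d rho))"
proof -
  interpret trunc n unif l p phi
    by unfold_locales (use assms in simp_all)
  have main: "((\<exists>theta. nondeg_char unif l n theta \<and> admits_whittaker n (Gset sl n) theta d rho)
             \<longleftrightarrow> regular_rep unif l sl n phi d rho) \<and>
     (\<forall>theta. nondeg_char unif l n theta \<longrightarrow> at_most_one_whittaker n (Gset sl n) theta d rho)"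
    if irr: "irreducible_rep n (Gset sl n) d rho" for d and rho :: "'r mat \<Rightarrow> complex mat"
  proof -
    interpret repn_n n unif l p phi sl d rho
      by unfold_locales (use irr of_nat_unit assms(5) in \<open>simp_all add: irreducible_rep_def\<close>)
    have W: "at_most_one_whittaker n (Gset sl n) th d rho \<and>
        (admits_whittaker n (Gset sl n) th d rho \<longrightarrow> regular_rep unif l sl n phi d rho)"
      if nd: "nondeg_char unif l n th" for th
    proof -
      obtain c where c: "\<And>i. c i dvd 1" and th: "\<And>u. u \<in> UU \<Longrightarrow> th (ma u) = phi (\<Sum>i<n - 1. c i * ent u i (Suc i))"
        using nondeg_char_units[OF nd] by blast
      interpret repn_cn n unif l p phi sl d rho c by unfold_locales (rule c)
      interpret irrep_c n unif l p phi sl d rho c by unfold_locales (rule irr)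
      have e: "th (ma u) = theta u" if "u \<in> UU" for u
        using th[OF that] theta_phi[of u] that by simp
      show ?thesis using at_most_one[OF e] whittaker_imp_regular[OF e] by blast
    qed
    then show ?thesis using regular_imp_whittaker by blast
  qed
  then show ?thesis by blast
qed

end
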